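(* Let $N\ge2$, $1<p<N$, $\beta>0$, and let $g\in F^{N/p}\cap L^{N/p}(B_1^c)$ be radially symmetric with $g(x)>0$ for all $x\in B_1^c$; assume there exist $l>p$ and $C_0>0$ with $0<g(x)\le C_0|x|^{-l}$ for $|x|\ge1$. Let $\phi(x)=\varphi(|x|)$ be the positive principal eigenfunction corresponding to the principal eigenvalue $\lambda_1$ of \[ -\Delta_p u=\lambda g|u|^{p-2}u \ \text{ in } B_1^c,\qquad |\nabla u|^{p-2}\frac{\partial u}{\partial\nu}+\beta|u|^{p-2}u=0 \ \text{ on }\partial B_1 . \] Then: (a) There exist constants $0<m<M$, $C>0$, $\delta>0$ and a Hölder exponent $\alpha\in(0,1)$ of $\nabla\phi$ such that for all $x\in B_1^c$ with $\mathrm{dist}(x,\partial B_1)<\delta$, \[ m\beta^{1/(p-1)}\varphi(1)\le|\nabla\phi(x)|\le M\beta^{1/(p-1)}\varphi(1)\big(1+C\,\mathrm{dist}(x,\partial B_1)^{\alpha}\big). \] (b) There exists a unique $r_*>1$ such that $\varphi'(r_* )=0$. Moreover there exist constants $0<\hat C_1<\hat C_2$ such that for all $x\in B_{2r_*}^c$, \[ \hat C_1|x|^{-(N-1)/(p-1)}\le|\nabla\phi(x)|\le\hat C_2(\log|x|)^{(N-p)/(N(p-1))}|x|^{-(N-1)/(p-1)}. \]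
   Context: $B_1$ is the closed unit ball in $\mathbb{R}^N$, $B_1^c=\mathbb{R}^N\setminus B_1$, $B_{2r_*}^c=\{|x|>2r_*\}$; $\nu$ is the outward unit normal to $B_1^c$ on $\partial B_1$ ($\nu(x)=-x$). $F^{N/p}$ is the closure of $C_c^\infty(B_1^c)$ in the Lorentz space $L^{N/p,\infty}(B_1^c)$. Eigenfunctions are weak solutions $u\in W^{1,p}(B_1^c)\setminus\{0\}$ of $\int_{B_1^c}|\nabla u|^{p-2}\nabla u\cdot\nabla v+\beta\int_{\partial B_1}|u|^{p-2}uv=\lambda\int_{B_1^c}g|u|^{p-2}uv$ for all $v\in W^{1,p}(B_1^c)$; $\lambda_1=\inf\{\int|\nabla\phi|^p+\beta\int_{\partial B_1}|\phi|^p:\int g|\phi|^p=1\}$ is the principal eigenvalue, which has a positive eigenfunction, unique up to scaling; for radial $g$ it is radial. *)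

theory Defs
  imports "HOL-Analysis.Analysis"
begin

definition ext_ball :: "'a::euclidean_space set" where
  "ext_ball = {x. norm x > 1}"

coinductive smooth_fun :: "('a::euclidean_space \<Rightarrow> real) \<Rightarrow> bool" where
  "(\<forall>x. f differentiable (at x)) \<Longrightarrow>
   (\<forall>i\<in>Basis. smooth_fun (\<lambda>x. frechet_derivative f (at x) i)) \<Longrightarrow> smooth_fun f"

definition supp_closure :: "('a::euclidean_space \<Rightarrow> real) \<Rightarrow> 'a set" where
  "supp_closure f = closure {x. f x \<noteq> 0}"

definition test_fun :: "'a::euclidean_space set \<Rightarrow> ('a \<Rightarrow> real) \<Rightarrow> bool" where
  "test_fun A \<psi> \<longleftrightarrow> smooth_fun \<psi> \<and> compact (supp_closure \<psi>) \<and> supp_closure \<psi> \<subseteq> A"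

definition partial :: "('a::euclidean_space \<Rightarrow> real) \<Rightarrow> 'a \<Rightarrow> 'a \<Rightarrow> real" where
  "partial f i x = frechet_derivative f (at x) i"

definition Lp_on :: "real \<Rightarrow> 'a::euclidean_space set \<Rightarrow> ('a \<Rightarrow> real) \<Rightarrow> bool" where
  "Lp_on q A f \<longleftrightarrow> f \<in> borel_measurable (lebesgue_on A) \<and>
     integrable (lebesgue_on A) (\<lambda>x. \<bar>f x\<bar> powr q)"

definition weakLq_pow :: "real \<Rightarrow> 'a::euclidean_space set \<Rightarrow> ('a \<Rightarrow> real) \<Rightarrow> ennreal" where
  "weakLq_pow q A f = (SUP t\<in>{0<..}. ennreal (t powr q) * emeasure (lebesgue_on A) {x\<in>A. \<bar>f x\<bar> > t})"

definition F_space :: "real \<Rightarrow> 'a::euclidean_space set \<Rightarrow> ('a \<Rightarrow> real) \<Rightarrow> bool" where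
  "F_space q A f \<longleftrightarrow> f \<in> borel_measurable (lebesgue_on A) \<and> weakLq_pow q A f < \<infinity> \<and>
     (\<forall>\<epsilon>>0. \<exists>\<psi>. test_fun A \<psi> \<and> weakLq_pow q A (\<lambda>x. f x - \<psi> x) < ennreal \<epsilon>)"

definition weak_grad :: "'a::euclidean_space set \<Rightarrow> ('a \<Rightarrow> real) \<Rightarrow> ('a \<Rightarrow> 'a) \<Rightarrow> bool" where
  "weak_grad A u G \<longleftrightarrow> (\<forall>\<psi>. test_fun A \<psi> \<longrightarrow> (\<forall>i\<in>Basis.
     (LINT x|lebesgue_on A. u x * partial \<psi> i x) = - (LINT x|lebesgue_on A. (G x \<bullet> i) * \<psi> x)))"

definition W1p_grad :: "real \<Rightarrow> 'a::euclidean_space set \<Rightarrow> ('a \<Rightarrow> real) \<Rightarrow> ('a \<Rightarrow> 'a) \<Rightarrow> bool" where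
  "W1p_grad p A u G \<longleftrightarrow> Lp_on p A u \<and> weak_grad A u G \<and>
     G \<in> borel_measurable (lebesgue_on A) \<and>
     integrable (lebesgue_on A) (\<lambda>x. norm (G x) powr p)"

definition W1p :: "real \<Rightarrow> 'a::euclidean_space set \<Rightarrow> ('a \<Rightarrow> real) \<Rightarrow> bool" where
  "W1p p A u \<longleftrightarrow> (\<exists>G. W1p_grad p A u G)"

text \<open>Integral over the unit sphere w.r.t. surface measure, via the cone
  measure identity: int_{S^{N-1}} f d sigma = N * int_{B_1} f(x/|x|) dx.\<close>
definition sphere_int :: "('a::euclidean_space \<Rightarrow> real) \<Rightarrow> real" where
  "sphere_int f = real DIM('a) * (LINT x|lebesgue_on (ball 0 1). f (x /\<^sub>R norm x))"

definition sphere_integrable :: "('a::euclidean_space \<Rightarrow> real) \<Rightarrow> bool" where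
  "sphere_integrable f \<longleftrightarrow> integrable (lebesgue_on (ball 0 1)) (\<lambda>x. f (x /\<^sub>R norm x))"

definition divergence :: "('a::euclidean_space \<Rightarrow> 'a) \<Rightarrow> 'a \<Rightarrow> real" where
  "divergence \<Phi> x = (\<Sum>i\<in>Basis. partial (\<lambda>y. \<Phi> y \<bullet> i) i x)"

text \<open>T is the trace on the unit sphere of u (with weak gradient G) on B_1^c,
  characterized by the Gauss-Green formula with outward normal nu(x) = -x:
  int_{B_1^c} (u div Phi + grad u . Phi) = int_{dB_1} T (Phi . nu) d sigma
  for all smooth compactly supported vector fields Phi on R^N.\<close>
definition trace_ext :: "real \<Rightarrow> ('a::euclidean_space \<Rightarrow> real) \<Rightarrow> ('a \<Rightarrow> 'a) \<Rightarrow> ('a \<Rightarrow> real) \<Rightarrow> bool" where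
  "trace_ext p u G T \<longleftrightarrow> sphere_integrable (\<lambda>x. \<bar>T x\<bar> powr p) \<and>
     (\<lambda>x. T (x /\<^sub>R norm x)) \<in> borel_measurable (lebesgue_on (ball 0 1)) \<and>
     (\<forall>\<Phi>::'a \<Rightarrow> 'a. (\<forall>i\<in>Basis. test_fun UNIV (\<lambda>y. \<Phi> y \<bullet> i)) \<longrightarrow>
        (LINT x|lebesgue_on ext_ball. u x * divergence \<Phi> x + G x \<bullet> \<Phi> x)
          = sphere_int (\<lambda>x. T x * (\<Phi> x \<bullet> (- x))))"

definition robin_eigen :: "real \<Rightarrow> real \<Rightarrow> ('a::euclidean_space \<Rightarrow> real) \<Rightarrow> real \<Rightarrow> ('a \<Rightarrow> real) \<Rightarrow> bool" where
  "robin_eigen p \<beta> g lam u \<longleftrightarrow>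
     W1p p ext_ball u \<and> \<not> (AE x in lebesgue_on ext_ball. u x = 0) \<and>
     (\<exists>G T. W1p_grad p ext_ball u G \<and> trace_ext p u G T \<and>
       (\<forall>v Gv Tv. W1p_grad p ext_ball v Gv \<and> trace_ext p v Gv Tv \<longrightarrow>
          (LINT x|lebesgue_on ext_ball. norm (G x) powr (p - 2) * (G x \<bullet> Gv x))
          + \<beta> * sphere_int (\<lambda>x. \<bar>T x\<bar> powr (p - 2) * T x * Tv x)
          = lam * (LINT x|lebesgue_on ext_ball. g x * \<bar>u x\<bar> powr (p - 2) * u x * v x)))"

definition lambda1 :: "real \<Rightarrow> real \<Rightarrow> ('a::euclidean_space \<Rightarrow> real) \<Rightarrow> real" where
  "lambda1 p \<beta> g = Inf {(LINT x|lebesgue_on ext_ball. norm (G x) powr p)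
        + \<beta> * sphere_int (\<lambda>x. \<bar>T x\<bar> powr p) | \<phi> G T.
        W1p_grad p ext_ball \<phi> G \<and> trace_ext p \<phi> G T \<and>
        (LINT x|lebesgue_on ext_ball. g x * \<bar>\<phi> x\<bar> powr p) = 1}"

definition radial :: "('a::real_normed_vector \<Rightarrow> real) \<Rightarrow> 'a set \<Rightarrow> bool" where
  "radial f A \<longleftrightarrow> (\<forall>x\<in>A. \<forall>y\<in>A. norm x = norm y \<longrightarrow> f x = f y)"

definition hoelder_on :: "real \<Rightarrow> 'a::real_normed_vector set \<Rightarrow> ('a \<Rightarrow> 'b::real_normed_vector) \<Rightarrow> bool" where
  "hoelder_on \<alpha> S f \<longleftrightarrow> (\<exists>K. \<forall>x\<in>S. \<forall>y\<in>S. norm (f x - f y) \<le> K * norm (x - y) powr \<alpha>)"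

end

theory Submission
  imports Defs "HOL-Real_Asymp.Real_Asymp"
begin

text \<open>
  Write phi = f(|x|) and let k be, up to normalisation, the total Robin flux through the unit sphere minus
  lambda times the mass of g phi^(p-1) inside the sphere of radius r. Testing the equation with radial functions
  shows that the spherical means of the radial component of |G|^(p-2) G are given by k, where G is the weak gradient.
  Let V be the radial field with |V|^(p-2) V equal to the flux field of k. Testing the equation with phi times a radial
  cutoff, and the weak gradient of phi with the flux field, evaluates all terms in the integral of
  (|G|^(p-2) G - |V|^(p-2) V) . (G - V), and they cancel; hence G = V by strict monotonicity. So f is continuously
  differentiable with r^(N-1) |f'|^(p-2) f' = k / K, where K is the area of the sphere; the same monotonicity argument
  identifies the trace as f(1), that is, k(1) / K = beta f(1)^(p-1) > 0.
  Since k is strictly decreasing and f is not bounded away from zero, k has exactly one zero, the critical radius.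
  Beyond it |k| increases, which gives the lower bound; the decay of g with rate l > p gives, by a bootstrap between
  the decay of f and the growth of |k|, that k is bounded, which gives the upper bound.
\<close>

section \<open>Smooth functions\<close>

text \<open>The equation sees only traces, weak gradients and integrals, and \<open>G\<close> is not
  known to be radial: radial tests fix spherical means of the radial part of |G|^(p-2) G and leave
  tangential parts and oscillation free. The test with phi times a cutoff supplies the missing
  information, the energy, and equality in a strictly monotone pairing then gives G = V pointwise.
  The flux field of \<open>k\<close> is known only to be Lipschitz, so it is not a test field; but
  \<open>k\<close> is a cumulative integral, hence a superposition of jumps at the radii |y|. Each
  jump is tested through smooth steps in |x|^2, and Fubini recombines them. The cutoffs carry a
  weight r^N that absorbs the polar Jacobian. In the bootstrap an exponent zero would bring in a
  logarithm; with \<epsilon> = (N - p) / (J + 1/2) the exponents N - p - j \<epsilon> change sign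
  between j = J and j = J + 1 without vanishing. Since \<open>k\<close> is bounded, the upper bound
  in (b) is first obtained without a logarithm; the logarithmic factor is inserted at the end, where
  log |x| is at least log 2.\<close>

lemma partial_eq:
  assumes "(f has_derivative f') (at x)"
  shows "partial f i x = f' i"
  using frechet_derivative_at[OF assms] by (simp add: partial_def)

lemma smooth_fun_differentiable: "smooth_fun f \<Longrightarrow> f differentiable (at x)"
  by (erule smooth_fun.cases) auto

lemma smooth_fun_partial: "smooth_fun f \<Longrightarrow> i \<in> Basis \<Longrightarrow> smooth_fun (partial f i)"
  unfolding partial_def[abs_def] by (erule smooth_fun.cases) auto

lemma smooth_fun_continuous_on: "smooth_fun f \<Longrightarrow> continuous_on A f"
  by (meson continuous_at_imp_continuous_on differentiable_imp_continuous_within smooth_fun_differentiable)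

lemma smooth_fun_partial_continuous_on: "smooth_fun f \<Longrightarrow> i \<in> Basis \<Longrightarrow> continuous_on A (partial f i)"
  by (simp add: smooth_fun_continuous_on smooth_fun_partial)

text \<open>Coinduction with a whole set of candidates. Derivatives usually leave the shape of the
  given function, so \<open>X\<close> is taken as a family that already contains them all: the
  constants, an algebra of functions, the span of the bumps below.\<close>

lemma smooth_fun_coinduct_set:
  fixes f :: "'a::euclidean_space \<Rightarrow> real"
  assumes "f \<in> X" "\<And>h x. h \<in> X \<Longrightarrow> h differentiable (at x)"
    "\<And>h i. h \<in> X \<Longrightarrow> i \<in> Basis \<Longrightarrow> partial h i \<in> X"
  shows "smooth_fun f"
proof -
  have "\<forall>h. h \<in> X \<longrightarrow> smooth_fun h"
  proof (intro allI impI)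
    fix h :: "'a \<Rightarrow> real" assume "h \<in> X"
    then show "smooth_fun h"
    proof (coinduction arbitrary: h)
      case smooth_fun
      then show ?case using assms(2,3) unfolding partial_def[abs_def] by blast
    qed
  qed
  then show ?thesis using assms(1) by blast
qed

lemma smooth_fun_const: "smooth_fun (\<lambda>x::'a::euclidean_space. c)"
proof (rule smooth_fun_coinduct_set[of _ "{f. \<exists>c. f = (\<lambda>x::'a. c)}"])
  fix h :: "'a \<Rightarrow> real" and i assume "h \<in> {f. \<exists>c. f = (\<lambda>x::'a. c)}"
  then obtain c where h: "h = (\<lambda>x. c)" by auto
  have "partial h i = (\<lambda>x. 0)"
    by (rule ext, rule partial_eq[where f'="\<lambda>_. 0"]) (auto simp: h)
  then show "partial h i \<in> {f. \<exists>c. f = (\<lambda>x::'a. c)}" by auto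
qed auto

lemma smooth_fun_inner: "smooth_fun (\<lambda>x::'a::euclidean_space. x \<bullet> b)"
proof (rule smooth_fun.intros)
  show "\<forall>x. (\<lambda>x. x \<bullet> b) differentiable at x" by (auto intro: differentiable_inner)
  have "frechet_derivative (\<lambda>x. x \<bullet> b) (at x) i = i \<bullet> b" for x i
  proof -
    have "((\<lambda>x. x \<bullet> b) has_derivative (\<lambda>h. h \<bullet> b)) (at x)" by (auto intro!: derivative_eq_intros)
    then show ?thesis using partial_eq unfolding partial_def by blast
  qed
  then show "\<forall>i\<in>Basis. smooth_fun (\<lambda>x. frechet_derivative (\<lambda>x. x \<bullet> b) (at x) i)"
    by (simp add: smooth_fun_const)
qed

lemma has_derivative_partial:
  "smooth_fun f \<Longrightarrow> (f has_derivative frechet_derivative f (at x)) (at x)"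
  using frechet_derivative_works smooth_fun_differentiable by blast

text \<open>The derivative of a product or of a composite is a sum of products, so a single
  operation is not an invariant for coinduction. Closing the smooth functions under all three
  operations at once is.\<close>

inductive_set smooth_alg :: "('a::euclidean_space \<Rightarrow> real) set" where
  base: "smooth_fun f \<Longrightarrow> f \<in> smooth_alg"
| add: "f \<in> smooth_alg \<Longrightarrow> h \<in> smooth_alg \<Longrightarrow> (\<lambda>x. f x + h x) \<in> smooth_alg"
| mult: "f \<in> smooth_alg \<Longrightarrow> h \<in> smooth_alg \<Longrightarrow> (\<lambda>x. f x * h x) \<in> smooth_alg"
| comp: "smooth_fun (\<sigma>::real \<Rightarrow> real) \<Longrightarrow> f \<in> smooth_alg \<Longrightarrow> (\<lambda>x. \<sigma> (f x)) \<in> smooth_alg"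

lemma smooth_fun_real_has_derivative:
  fixes \<sigma> :: "real \<Rightarrow> real"
  assumes "smooth_fun \<sigma>"
  shows "(\<sigma> has_real_derivative partial \<sigma> 1 t) (at t)"
proof -
  obtain D where D: "(\<sigma> has_derivative D) (at t)"
    using smooth_fun_differentiable[OF assms] unfolding differentiable_def by blast
  then obtain c where "D = (\<lambda>x. x * c)"
    by (meson has_derivative_bounded_linear real_bounded_linear)
  then show ?thesis using D partial_eq[OF D, of 1]
    by (simp add: has_field_derivative_def mult_commute_abs)
qed

lemma smooth_alg_step:
  fixes f :: "'a::euclidean_space \<Rightarrow> real"
  assumes "f \<in> smooth_alg"
  shows "(\<forall>x. f differentiable (at x)) \<and> (\<forall>i\<in>Basis. partial f i \<in> smooth_alg)"
  using assms
proof induction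
  case (base f)
  then show ?case using smooth_fun_differentiable smooth_fun_partial smooth_alg.base by blast
next
  case (add f h)
  have D: "(f has_derivative frechet_derivative f (at x)) (at x)"
     "(h has_derivative frechet_derivative h (at x)) (at x)" for x
    using add.IH frechet_derivative_works by blast+
  have "partial (\<lambda>x. f x + h x) i = (\<lambda>x. partial f i x + partial h i x)" for i
    by (rule ext, subst partial_eq[OF has_derivative_add[OF D]]) (simp add: partial_def)
  then show ?case using add.IH smooth_alg.add[of "partial f _" "partial h _"]
    by (auto intro: differentiable_add)
next
  case (mult f h)
  have D: "(f has_derivative frechet_derivative f (at x)) (at x)"
     "(h has_derivative frechet_derivative h (at x)) (at x)" for x
    using mult.IH frechet_derivative_works by blast+
  have "partial (\<lambda>x. f x * h x) i = (\<lambda>x. f x * partial h i x + partial f i x * h x)" for i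
    by (rule ext, subst partial_eq[OF has_derivative_mult[OF D]]) (simp add: partial_def)
  moreover have "(\<lambda>x. f x * partial h i x + partial f i x * h x) \<in> smooth_alg" if "i \<in> Basis" for i
    by (intro smooth_alg.add smooth_alg.mult) (use mult that in auto)
  ultimately show ?case using mult by (auto intro: differentiable_mult)
next
  case (comp \<sigma> f)
  have D: "(f has_derivative frechet_derivative f (at x)) (at x)" for x
    using comp.IH frechet_derivative_works by blast
  have "((\<lambda>x. \<sigma> (f x)) has_derivative (\<lambda>h. frechet_derivative f (at x) h * partial \<sigma> 1 (f x))) (at x)" for x
    using has_derivative_compose[OF D[of x], of \<sigma> "\<lambda>h. h * partial \<sigma> 1 (f x)"]
      smooth_fun_real_has_derivative[OF comp.hyps(1)]
    by (auto simp: has_field_derivative_def mult_commute_abs)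
  note D' = this
  have "partial (\<lambda>x. \<sigma> (f x)) i = (\<lambda>x. partial f i x * partial \<sigma> 1 (f x))" for i
    by (rule ext, subst partial_eq[OF D']) (simp add: partial_def)
  moreover have "smooth_fun (partial \<sigma> 1)" using comp.hyps(1) by (intro smooth_fun_partial) auto
  ultimately show ?case using comp D' 
    by (auto intro: smooth_alg.mult smooth_alg.comp simp: differentiable_def)
qed

lemma smooth_alg_smooth: "f \<in> smooth_alg \<Longrightarrow> smooth_fun f"
  by (rule smooth_fun_coinduct_set[of f smooth_alg]) (use smooth_alg_step in auto)

lemma smooth_fun_add: "smooth_fun f \<Longrightarrow> smooth_fun h \<Longrightarrow> smooth_fun (\<lambda>x. f x + h x)"
  by (simp add: smooth_alg.add smooth_alg.base smooth_alg_smooth)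

lemma smooth_fun_mult: "smooth_fun f \<Longrightarrow> smooth_fun h \<Longrightarrow> smooth_fun (\<lambda>x. f x * h x)"
  by (simp add: smooth_alg.mult smooth_alg.base smooth_alg_smooth)

lemma smooth_fun_compose:
  "smooth_fun (\<sigma>::real \<Rightarrow> real) \<Longrightarrow> smooth_fun f \<Longrightarrow> smooth_fun (\<lambda>x. \<sigma> (f x))"
  by (simp add: smooth_alg.comp smooth_alg.base smooth_alg_smooth)

lemma smooth_fun_diff: "smooth_fun f \<Longrightarrow> smooth_fun h \<Longrightarrow> smooth_fun (\<lambda>x. f x - h x)"
  using smooth_fun_add[of f "\<lambda>x. (-1) * h x"] smooth_fun_mult[OF smooth_fun_const[of "-1"], of h] by simp

lemma smooth_fun_sum: "(\<And>i. i \<in> I \<Longrightarrow> smooth_fun (f i)) \<Longrightarrow> smooth_fun (\<lambda>x. \<Sum>i\<in>I. f i x)"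
  by (induction I rule: infinite_finite_induct) (auto intro: smooth_fun_const smooth_fun_add)

lemma smooth_fun_norm_sq: "smooth_fun (\<lambda>x::'a::euclidean_space. (norm x)\<^sup>2)"
proof -
  have "(\<lambda>x::'a. (norm x)\<^sup>2) = (\<lambda>x. \<Sum>i\<in>Basis. (x \<bullet> i) * (x \<bullet> i))"
    by (rule ext) (metis euclidean_inner power2_norm_eq_inner)
  then show ?thesis by (simp only:) (intro smooth_fun_sum smooth_fun_mult smooth_fun_inner)
qed

section \<open>A smooth step function on the line\<close>

lemma smooth_fun_realI:
  fixes f :: "real \<Rightarrow> real"
  assumes "\<And>t. (f has_real_derivative f' t) (at t)" "smooth_fun f'"
  shows "smooth_fun f"
proof (rule smooth_fun.intros)
  show "\<forall>x. f differentiable at x"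
    using assms(1) real_differentiable_def by (metis differentiableI has_field_derivative_imp_has_derivative)
  have "frechet_derivative f (at x) 1 = f' x" for x
    using partial_eq[OF has_field_derivative_imp_has_derivative[OF assms(1)], of 1] by (simp add: partial_def)
  then show "\<forall>i\<in>Basis. smooth_fun (\<lambda>x. frechet_derivative f (at x) i)"
    using assms(2) by simp
qed

text \<open>The real exponent a keeps the family closed under differentiation: the derivative of t^a
  exp(-1/t) combines the exponents a - 1 and a - 2. The case a = 0 is the classical flat function
  exp(-1/t).\<close>

definition exp_bump :: "real \<Rightarrow> real \<Rightarrow> real" where
  "exp_bump a t = (if t > 0 then t powr a * exp (- (1 / t)) else 0)"

lemma exp_bump_deriv:
  "(exp_bump a has_real_derivative a * exp_bump (a - 1) t + exp_bump (a - 2) t) (at t)"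
proof -
  consider "t > 0" | "t < 0" | "t = 0" by linarith
  then show ?thesis
  proof cases
    case 1
    have "((\<lambda>t. t powr a * exp (- (1 / t))) has_real_derivative
        a * (t powr (a-1) * exp (- (1 / t))) + t powr (a-2) * exp (- (1 / t))) (at t)"
      using 1 by (auto intro!: derivative_eq_intros simp: powr_diff power2_eq_square field_simps)
    then have "(exp_bump a has_real_derivative
        a * (t powr (a-1) * exp (- (1 / t))) + t powr (a-2) * exp (- (1 / t))) (at t)"
      by (rule has_field_derivative_transform_within_open[of _ _ _ "{0<..}"])
        (use 1 in \<open>auto simp: exp_bump_def\<close>)
    then show ?thesis using 1 by (simp add: exp_bump_def)
  next
    case 2
    have "(exp_bump a has_real_derivative 0) (at t)"
      by (rule has_field_derivative_transform_within_open[of "\<lambda>_. 0" _ _ "{..<0}"])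
        (use 2 in \<open>auto simp: exp_bump_def\<close>)
    then show ?thesis using 2 by (simp add: exp_bump_def)
  next
    case 3
    \<comment> \<open>The difference quotient at 0 is identically 0 on the left; on the right
      exp(-1/h) beats every power of h.\<close>
    have "((\<lambda>h. exp_bump a h / h) \<longlongrightarrow> 0) (at 0)"
    proof (rule filterlim_split_at)
      show "((\<lambda>h. exp_bump a h / h) \<longlongrightarrow> 0) (at_left 0)"
        by (rule Lim_transform_eventually[OF tendsto_const[of 0]])
          (auto simp: eventually_at_left_field exp_bump_def intro!: exI[of _ "-1"])
      have "((\<lambda>h::real. h powr a * exp (- (1 / h)) / h) \<longlongrightarrow> 0) (at_right 0)"
        by real_asymp
      then show "((\<lambda>h. exp_bump a h / h) \<longlongrightarrow> 0) (at_right 0)"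
        by (rule Lim_transform_eventually)
          (auto simp: eventually_at_right_field exp_bump_def intro!: exI[of _ "1"])
    qed
    then show ?thesis using 3 by (simp add: DERIV_def exp_bump_def)
  qed
qed

text \<open>The finite linear combinations of the functions \<open>exp_bump a\<close>, over all real
  a, are closed under differentiation and so serve as the invariant of the coinduction.\<close>

lemma exp_bump_smooth: "smooth_fun (exp_bump a)"
proof (rule smooth_fun_coinduct_set[of _ "{f. \<exists>I c. finite I \<and> f = (\<lambda>t. \<Sum>a\<in>I. c a * exp_bump a t)}"])
  show "exp_bump a \<in> {f. \<exists>I c. finite I \<and> f = (\<lambda>t. \<Sum>a\<in>I. c a * exp_bump a t)}"
    by (auto intro!: exI[of _ "{a}"] exI[of _ "\<lambda>_. 1"])
next
  fix h :: "real \<Rightarrow> real" and x assume "h \<in> {f. \<exists>I c. finite I \<and> f = (\<lambda>t. \<Sum>a\<in>I. c a * exp_bump a t)}"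
  then show "h differentiable at x"
    by (auto intro!: derivative_intros differentiableI[OF has_field_derivative_imp_has_derivative[OF exp_bump_deriv]] simp: differentiable_mult)
next
  fix h :: "real \<Rightarrow> real" and i :: real
  assume "h \<in> {f. \<exists>I c. finite I \<and> f = (\<lambda>t. \<Sum>a\<in>I. c a * exp_bump a t)}" and i: "i \<in> Basis"
  then obtain I c where I: "finite I" and h: "h = (\<lambda>t. \<Sum>a\<in>I. c a * exp_bump a t)" by auto
  let ?X = "{f. \<exists>I c. finite I \<and> f = (\<lambda>t. \<Sum>a\<in>I. c a * exp_bump a t)}"
  have add: "(\<lambda>t. u t + v t) \<in> ?X" if uv: "u \<in> ?X" "v \<in> ?X" for u v
  proof -
    obtain I c where 1: "finite I" "u = (\<lambda>t. \<Sum>a\<in>I. c a * exp_bump a t)" using uv by auto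
    obtain J d where 2: "finite J" "v = (\<lambda>t. \<Sum>a\<in>J. d a * exp_bump a t)" using uv by auto
    have "u t = (\<Sum>a\<in>I\<union>J. (if a \<in> I then c a else 0) * exp_bump a t)" for t
      unfolding 1 by (rule sum.mono_neutral_cong_left) (use 1 2 in auto)
    moreover have "v t = (\<Sum>a\<in>I\<union>J. (if a \<in> J then d a else 0) * exp_bump a t)" for t
      unfolding 2 by (rule sum.mono_neutral_cong_left) (use 1 2 in auto)
    ultimately have "(\<lambda>t. u t + v t) = (\<lambda>t. \<Sum>a\<in>I\<union>J. ((if a \<in> I then c a else 0) + (if a \<in> J then d a else 0)) * exp_bump a t)"
      by (simp add: distrib_right sum.distrib)
    moreover have "finite (I \<union> J)" using 1 2 by simp
    ultimately show ?thesis by (intro CollectI exI conjI)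
  qed
  have one: "(\<lambda>t. c * exp_bump a t) \<in> ?X" for c a
    by (auto intro!: exI[of _ "{a}"] exI[of _ "\<lambda>_. c"])
  have "(\<lambda>t. \<Sum>a\<in>I. c a * (a * exp_bump (a - 1) t + exp_bump (a - 2) t)) \<in> ?X"
    using I
  proof induction
    case empty
    then show ?case by (auto intro!: exI[of _ "{}"])
  next
    case (insert b F)
    have "(\<lambda>t. (c b * b * exp_bump (b - 1) t + c b * exp_bump (b - 2) t) + (\<Sum>a\<in>F. c a * (a * exp_bump (a - 1) t + exp_bump (a - 2) t))) \<in> ?X"
      by (intro add one insert.IH)
    then show ?case using insert.hyps by (simp add: distrib_left mult.assoc)
  qed
  moreover have "(h has_real_derivative (\<Sum>a\<in>I. c a * (a * exp_bump (a - 1) t + exp_bump (a - 2) t))) (at t)" for t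
    unfolding h by (intro DERIV_sum DERIV_cmult exp_bump_deriv)
  note dh = this
  have "partial h i = (\<lambda>t. \<Sum>a\<in>I. c a * (a * exp_bump (a - 1) t + exp_bump (a - 2) t))"
    using i partial_eq[OF has_field_derivative_imp_has_derivative[OF dh], of i] by (intro ext) simp
  ultimately show "partial h i \<in> ?X" by simp
qed

lemma exp_bump_nonneg: "exp_bump a t \<ge> 0" by (simp add: exp_bump_def)

text \<open>\<open>S\<close> is the normalised primitive of a bump that lives on the interval from 0
  to 1; the derivative \<open>s\<close> is listed separately because its rescalings later serve as
  kernels concentrating at a radius.\<close>

lemma smooth_step_exists:
  obtains S s :: "real \<Rightarrow> real" where "smooth_fun S" "smooth_fun s"
    "\<And>t. (S has_real_derivative s t) (at t)"
    "\<And>t. t \<le> 0 \<Longrightarrow> S t = 0" "\<And>t. t \<ge> 1 \<Longrightarrow> S t = 1" "\<And>t. 0 \<le> S t" "\<And>t. S t \<le> 1"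
    "\<And>t. s t \<ge> 0" "\<And>t. t \<le> 0 \<or> t \<ge> 1 \<Longrightarrow> s t = 0"
proof -
  define b where "b = (\<lambda>t. exp_bump 0 t * exp_bump 0 (1 - t))"
  have bs: "smooth_fun b" unfolding b_def
    using smooth_fun_inner[of "1::real"]
    by (intro smooth_fun_mult smooth_fun_compose[OF exp_bump_smooth] smooth_fun_diff smooth_fun_const exp_bump_smooth) simp
  have b0: "b t \<ge> 0" for t by (simp add: b_def exp_bump_nonneg)
  have bz: "t \<le> 0 \<or> t \<ge> 1 \<Longrightarrow> b t = 0" for t by (auto simp: b_def exp_bump_def)
  have cb: "continuous_on A b" for A using smooth_fun_continuous_on[OF bs] .
  \<comment> \<open>\<open>B\<close> is a primitive only to the right of its lower limit -2, so
    \<open>S0\<close> below switches to the constant 0 at -1. The bump vanishes around this seam,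
    and the two branches agree there.\<close>
  define B where "B = (\<lambda>t. integral {-2..t} b)"
  have B1: "(B has_real_derivative b t) (at t)" if t: "t > -2" for t
  proof -
    have "(B has_vector_derivative b t) (at t within {-2..t+1})"
      unfolding B_def using t by (intro integral_has_vector_derivative cb) auto
    then have "(B has_vector_derivative b t) (at t)"
      using t by (metis at_within_Icc_at less_add_one)
    then show ?thesis by (simp add: has_real_derivative_iff_has_vector_derivative)
  qed
  define S0 where "S0 = (\<lambda>t. if t > -1 then B t - B 0 else 0)"
  have Bz: "B t = 0" if "t \<le> 0" for t
    unfolding B_def by (rule integral_unique, rule has_integral_is_0) (use that bz in auto)
  have S1: "(S0 has_real_derivative b t) (at t)" for t
  proof (cases "t > -1")
    case True
    have "((\<lambda>t. B t - B 0) has_real_derivative b t) (at t)"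
      using B1[of t] True by (auto intro!: derivative_eq_intros)
    then show ?thesis
      by (rule has_field_derivative_transform_within_open[of _ _ _ "{-1<..}"]) (use True in \<open>auto simp: S0_def\<close>)
  next
    case False
    have "((\<lambda>_. 0) has_real_derivative b t) (at t)" using False bz[of t] by auto
    then show ?thesis
      by (rule has_field_derivative_transform_within_open[of _ _ _ "{..<-1/2}"])
       (use False Bz Bz[of 0] in \<open>auto simp: S0_def\<close>)
  qed
  have mono: "S0 x \<le> S0 y" if "x \<le> y" for x y
    by (rule DERIV_nonneg_imp_nondecreasing[OF that]) (use S1 b0 in blast)
  have S00: "S0 t = 0" if "t \<le> 0" for t using that Bz[of t] Bz[of 0] by (auto simp: S0_def)
  have S0c: "S0 t = S0 1" if "t \<ge> 1" for t
  proof (rule order_antisym[OF _ mono[OF that]])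
    show "S0 t \<le> S0 1"
      by (rule DERIV_nonpos_imp_nonincreasing[OF that]) (use S1 bz in force)
  qed
  \<comment> \<open>Were the total mass not positive, the monotone \<open>S0\<close> would be
    constant on the unit interval, although its slope b (1/2) is positive.\<close>
  have "S0 1 > 0"
  proof (rule ccontr)
    assume "\<not> ?thesis"
    then have z: "S0 t = 0" if "t > 0" "t < 1" for t using mono[of 0 t] mono[of t 1] S00 that by (simp add: order_antisym)
    have "((\<lambda>_. 0) has_real_derivative b (1/2)) (at (1/2))"
      by (rule has_field_derivative_transform_within_open[OF S1[of "1/2"], of "{0<..<1}"]) (use z in auto)
    then have "b (1/2) = 0" by (rule DERIV_unique) (rule DERIV_const)
    moreover have "b (1/2) > 0" by (simp add: b_def exp_bump_def)
    ultimately show False by simp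
  qed
  define S where "S = (\<lambda>t. (1 / S0 1) * S0 t)"
  define s where "s = (\<lambda>t. (1 / S0 1) * b t)"
  have Ss: "(S has_real_derivative s t) (at t)" for t
    unfolding S_def s_def by (intro DERIV_cmult S1)
  have ss: "smooth_fun s" unfolding s_def by (intro smooth_fun_mult smooth_fun_const bs)
  show ?thesis
  proof (rule that[of S s])
    show "S t \<le> 1" for t using mono[of t 1] S0c[of t] \<open>S0 1 > 0\<close> by (cases "t \<le> 1") (auto simp: S_def field_simps)
    show "S t \<ge> 0" for t using mono[of 0 t] S00[of t] S00[of 0] \<open>S0 1 > 0\<close> by (cases "t \<ge> 0") (auto simp: S_def field_simps)
    show "S t = 1" if "t \<ge> 1" for t using S0c[OF that] \<open>S0 1 > 0\<close> by (simp add: S_def)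
    show "smooth_fun S" using smooth_fun_realI[OF Ss ss] .
    show "smooth_fun s" by (rule ss)
    show "(S has_real_derivative s t) (at t)" for t by (rule Ss)
    show "S t = 0" if "t \<le> 0" for t using S00[OF that] by (simp add: S_def)
    show "s t \<ge> 0" for t using \<open>S0 1 > 0\<close> b0[of t] by (simp add: s_def)
    show "s t = 0" if "t \<le> 0 \<or> t \<ge> 1" for t using bz[OF that] by (simp add: s_def)
  qed
qed

section \<open>Integration in polar coordinates\<close>

lemma ext_ball_open: "open (ext_ball :: 'a::euclidean_space set)"
  unfolding ext_ball_def by (intro open_Collect_less continuous_intros)

lemma ext_ball_sets [measurable]: "(ext_ball :: 'a::euclidean_space set) \<in> sets borel"
  using ext_ball_open by (rule borel_open)

lemma ext_ball_lebesgue [simp]: "(ext_ball :: 'a::euclidean_space set) \<in> sets lebesgue"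
  using ext_ball_sets by (metis sets_completionI_sets sets_lborel)

lemma borel_measurable_ext_ball:
  "f \<in> borel_measurable borel \<Longrightarrow> f \<in> borel_measurable (lebesgue_on (ext_ball :: 'a::euclidean_space set))"
  by (intro measurable_restrict_space1 measurable_completion) auto

lemma sphere_area_pos: "sphere_int (\<lambda>_::'a::euclidean_space. 1) > 0"
proof -
  have "measure lebesgue (ball (0::'a) 1) > 0" using content_ball_pos[of 1 "0::'a"] by simp
  then show ?thesis by (simp add: sphere_int_def measure_restrict_space)
qed

text \<open>The measures to be compared may have infinite total mass, so agreement on the generating
  half-lines has to be combined with an exhaustion by half-lines of finite mass; the rational ones
  do it.\<close>

lemma real_measure_eqI_lessThan:
  fixes M N :: "real measure"
  assumes "sets M = sets borel" "sets N = sets borel"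
    and fin: "\<And>x. emeasure M {..<x} < \<infinity>"
    and eq: "\<And>x. emeasure M {..<x} = emeasure N {..<x}"
  shows "M = N"
proof (rule measure_eqI_generator_eq_countable)
  let ?LT = "\<lambda>a::real. {..<a}" let ?E = "range ?LT"
  have "{..<a} \<inter> {..<b} = {..<min a b}" for a b :: real by auto
  then show "Int_stable ?E" by (auto simp: Int_stable_def)
  show "?E \<subseteq> Pow UNIV" "sets M = sigma_sets UNIV ?E" "sets N = sigma_sets UNIV ?E"
    unfolding assms(1,2) borel_Iio by auto
  have "\<exists>q\<in>\<rat>. x < q" for x :: real using Rats_dense_in_real[of x "x + 1"] by auto
  then show "?LT`Rats \<subseteq> ?E" "(\<Union>i\<in>Rats. ?LT i) = UNIV" "\<And>a. a \<in> ?LT`Rats \<Longrightarrow> emeasure M a \<noteq> \<infinity>"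
    using fin by (auto simp: less_top)
qed (auto intro: eq countable_rat)

lemma nn_integral_lborel_scaleR:
  fixes f :: "'a::euclidean_space \<Rightarrow> ennreal"
  assumes [measurable]: "f \<in> borel_measurable borel" and c: "c > 0"
  shows "(\<integral>\<^sup>+x. f x \<partial>lborel) = ennreal (c ^ DIM('a)) * (\<integral>\<^sup>+x. f (c *\<^sub>R x) \<partial>lborel)"
  using c by (subst lborel_affine[of c 0]) (auto simp: nn_integral_density nn_integral_distr nn_integral_cmult)

text \<open>The push-forward of the measure with the degree-zero homogeneous density q is determined by
  its values on balls around the origin, which scale like the N-th power of the radius.\<close>
lemma distr_norm_eq:
  fixes q :: "'a::euclidean_space \<Rightarrow> real"
  assumes qm [measurable]: "(\<lambda>x. q (x /\<^sub>R norm x)) \<in> borel_measurable borel"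
    and q0: "\<And>x. q x \<ge> 0" and qi: "sphere_integrable q"
  shows "distr (density lborel (\<lambda>x. ennreal (q (x /\<^sub>R norm x)))) borel norm =
    density lborel (\<lambda>r. ennreal (sphere_int q * (indicator {0<..} r * r ^ (DIM('a) - 1))))"
proof (rule real_measure_eqI_lessThan)
  let ?N = "DIM('a)"
  define J where "J = (\<integral>\<^sup>+x. ennreal (q (x /\<^sub>R norm x)) * indicator (ball 0 1) x \<partial>(lborel :: 'a measure))"
  define I where "I = (LINT x|lebesgue_on (ball 0 1). q (x /\<^sub>R norm x))"
  have "(\<integral>\<^sup>+x. ennreal (q (x /\<^sub>R norm x)) \<partial>lebesgue_on (ball 0 1)) = ennreal I"
    unfolding I_def using qi q0 by (intro nn_integral_eq_integral) (auto simp: sphere_integrable_def)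
  then have J: "J = ennreal I"
    unfolding J_def by (subst (asm) nn_integral_restrict_space) (auto simp: nn_integral_completion)
  have I0: "I \<ge> 0" unfolding I_def using q0 by (intro integral_nonneg_AE) auto
  have KI: "sphere_int q = ?N * I" by (simp add: sphere_int_def I_def)
  have L: "emeasure (distr (density lborel (\<lambda>x. ennreal (q (x /\<^sub>R norm x)))) borel norm) {..<R} =
     (if R \<le> 0 then 0 else ennreal (I * R ^ ?N))" for R
  proof -
    have *: "emeasure (distr (density lborel (\<lambda>x. ennreal (q (x /\<^sub>R norm x)))) borel norm) {..<R} =
        (\<integral>\<^sup>+x. ennreal (q (x /\<^sub>R norm x)) * indicator (ball 0 R) x \<partial>(lborel :: 'a measure))"
    proof -
      have "norm -` {..<R} = ball (0::'a) R" by auto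
      then show ?thesis by (subst emeasure_distr) (auto simp: emeasure_density)
    qed
    show ?thesis
    proof (cases "R \<le> 0")
      case False
      have "(\<integral>\<^sup>+x. ennreal (q (x /\<^sub>R norm x)) * indicator (ball 0 R) x \<partial>(lborel :: 'a measure)) =
        ennreal (R ^ ?N) * (\<integral>\<^sup>+x. ennreal (q ((R *\<^sub>R x) /\<^sub>R norm (R *\<^sub>R x))) * indicator (ball 0 R) (R *\<^sub>R x) \<partial>(lborel :: 'a measure))"
        using False by (intro nn_integral_lborel_scaleR) (measurable, auto)
      also have "(\<integral>\<^sup>+x. ennreal (q ((R *\<^sub>R x) /\<^sub>R norm (R *\<^sub>R x))) * indicator (ball 0 R) (R *\<^sub>R x) \<partial>(lborel :: 'a measure)) = J"
        unfolding J_def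
      proof (rule nn_integral_cong)
        fix x :: 'a
        have "(R *\<^sub>R x) /\<^sub>R norm (R *\<^sub>R x) = x /\<^sub>R norm x" using False by (simp add: divide_simps)
        moreover have "indicator (ball 0 R) (R *\<^sub>R x) = (indicator (ball 0 1) x :: ennreal)"
          using False by (auto split: split_indicator)
        ultimately show "ennreal (q ((R *\<^sub>R x) /\<^sub>R norm (R *\<^sub>R x))) * indicator (ball 0 R) (R *\<^sub>R x) =
          ennreal (q (x /\<^sub>R norm x)) * indicator (ball 0 1) x" by (simp only:)
      qed
      finally show ?thesis using False * J I0 by (simp add: ennreal_mult' mult.commute)
    next
      case True
      then show ?thesis by (simp add: * ball_empty)
    qed
  qed
  show "emeasure (distr (density lborel (\<lambda>x. ennreal (q (x /\<^sub>R norm x)))) borel norm) {..<R} < \<infinity>" for R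
    unfolding L by auto
  show "emeasure (distr (density lborel (\<lambda>x. ennreal (q (x /\<^sub>R norm x)))) borel norm) {..<R} =
    emeasure (density lborel (\<lambda>r. ennreal (sphere_int q * (indicator {0<..} r * r ^ (?N - 1))))) {..<R}" for R
  proof (cases "R \<le> 0")
    case True
    have "(\<integral>\<^sup>+ r. ennreal (sphere_int q * (indicator {0<..} r * r ^ (?N - 1))) * indicator {..<R} r \<partial>lborel) =
      (\<integral>\<^sup>+ (r::real). 0 \<partial>lborel)"
      using True by (intro nn_integral_cong) (auto split: split_indicator)
    then show ?thesis using True by (simp add: L emeasure_density)
  next
    case False
    have "(\<integral>\<^sup>+ r. ennreal (sphere_int q * (indicator {0<..} r * r ^ (?N - 1))) * indicator {..<R} r \<partial>lborel) =
      (\<integral>\<^sup>+ r. ennreal (I * (?N * r ^ (?N - 1))) * indicator {0..R} r \<partial>lborel)"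
    proof (rule nn_integral_cong_AE, use AE_lborel_singleton[of 0] AE_lborel_singleton[of R] in eventually_elim)
      case (elim r)
      then show ?case by (auto simp: KI mult_ac split: split_indicator)
    qed
    \<comment> \<open>\<open>sphere_int q\<close> is N times the integral \<open>I\<close> over the
      unit ball, so the proposed density is the derivative of I r^N.\<close>
    also have "\<dots> = I * R ^ ?N - I * 0 ^ ?N"
      using False I0 by (intro nn_integral_FTC_Icc) (auto intro!: derivative_eq_intros)
    also have "I * R ^ ?N - I * 0 ^ ?N = I * R ^ ?N" by simp
    finally show ?thesis using False by (simp add: L emeasure_density)
  qed
qed auto

text \<open>A nonnegative angular factor can be read as a density. Pushing the resulting measure
  forward under the norm then leaves a one-dimensional integral, and both claims follow from the
  change of variables.\<close>

lemma lborel_polar_nonneg: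
  fixes q :: "'a::euclidean_space \<Rightarrow> real" and f :: "real \<Rightarrow> real"
  assumes qm [measurable]: "(\<lambda>x. q (x /\<^sub>R norm x)) \<in> borel_measurable borel"
    and q0: "\<And>x. q x \<ge> 0" and qi: "sphere_integrable q"
    and [measurable]: "f \<in> borel_measurable borel"
  shows "integrable lborel (\<lambda>x. q (x /\<^sub>R norm x) * f (norm x)) \<longleftrightarrow>
      integrable lborel (\<lambda>r. sphere_int q * (indicator {0<..} r * r ^ (DIM('a) - 1)) * f r)" (is ?A)
    and "(LINT x|lborel. q (x /\<^sub>R norm x) * f (norm x)) =
      sphere_int q * (LINT r:{0<..}|lborel. f r * r ^ (DIM('a) - 1))" (is ?B)
proof -
  have K0: "sphere_int q \<ge> 0"
    using q0 by (auto simp: sphere_int_def intro!: mult_nonneg_nonneg integral_nonneg_AE)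
  have d0: "sphere_int q * (indicator {0<..} r * r ^ (DIM('a) - 1)) \<ge> 0" for r :: real
    using K0 by (auto split: split_indicator)
  note eq = distr_norm_eq[OF qm q0 qi]
  have "integrable lborel (\<lambda>x. q (x /\<^sub>R norm x) *\<^sub>R f (norm x)) \<longleftrightarrow>
     integrable (density lborel (\<lambda>x. ennreal (q (x /\<^sub>R norm x)))) (\<lambda>x. f (norm x))"
    using q0 by (subst integrable_density) auto
  also have "\<dots> \<longleftrightarrow> integrable (distr (density lborel (\<lambda>x. ennreal (q (x /\<^sub>R norm x)))) borel norm) f"
    by (subst integrable_distr_eq) auto
  also have "\<dots> \<longleftrightarrow> integrable lborel (\<lambda>r. (sphere_int q * (indicator {0<..} r * r ^ (DIM('a) - 1))) *\<^sub>R f r)"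
    unfolding eq using d0 by (subst integrable_density) auto
  finally show ?A by simp
  have "(LINT x|lborel. q (x /\<^sub>R norm x) *\<^sub>R f (norm x)) =
     (LINT x|density lborel (\<lambda>x. ennreal (q (x /\<^sub>R norm x))). f (norm x))"
    using q0 by (subst integral_density) auto
  also have "\<dots> = (LINT x|distr (density lborel (\<lambda>x. ennreal (q (x /\<^sub>R norm x)))) borel norm. f x)"
    by (subst integral_distr) auto
  also have "\<dots> = (LINT r|lborel. (sphere_int q * (indicator {0<..} r * r ^ (DIM('a) - 1))) *\<^sub>R f r)"
    unfolding eq using d0 by (subst integral_density) auto
  also have "\<dots> = (LINT r|lborel. sphere_int q * (indicator {0<..} r *\<^sub>R (f r * r ^ (DIM('a) - 1))))"
    by (intro Bochner_Integration.integral_cong) auto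
  finally show ?B by (simp add: set_lebesgue_integral_def)
qed

lemma sphere_integrable_bounded:
  fixes q :: "'a::euclidean_space \<Rightarrow> real"
  assumes "(\<lambda>x. q (x /\<^sub>R norm x)) \<in> borel_measurable (lebesgue_on (ball 0 1))" "\<And>x. \<bar>q x\<bar> \<le> B"
  shows "sphere_integrable q"
  unfolding sphere_integrable_def
proof (rule integrableI_bounded_set)
  show "ball 0 1 \<in> sets (lebesgue_on (ball (0::'a) 1))" by (auto simp: sets_restrict_space_iff)
  show "emeasure (lebesgue_on (ball 0 1)) (ball (0::'a) 1) < \<infinity>"
    by (simp add: emeasure_restrict_space emeasure_ball)
qed (use assms in \<open>auto\<close>)

lemma
  fixes f :: "real \<Rightarrow> real"
  assumes fm: "set_borel_measurable borel {1<..} f"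
  shows ext_integrable_radial_iff: "integrable (lebesgue_on (ext_ball :: 'a::euclidean_space set)) (\<lambda>x. f (norm x)) \<longleftrightarrow>
      set_integrable lborel {1<..} (\<lambda>r. f r * r ^ (DIM('a) - 1))" (is ?A)
    and ext_integral_radial: "(LINT x|lebesgue_on (ext_ball :: 'a set). f (norm x)) =
      sphere_int (\<lambda>_::'a. 1) * (LINT r:{1<..}|lborel. f r * r ^ (DIM('a) - 1))" (is ?B)
    and ext_measurable_radial: "(\<lambda>x. f (norm x)) \<in> borel_measurable (lebesgue_on (ext_ball :: 'a set))" (is ?C)
proof -
  \<comment> \<open>\<open>f\<close> is measurable only beyond radius 1; cutting it off there gives
    a Borel function on the whole line, to which the polar formula on the full space
    applies.\<close>
  define F where "F = (\<lambda>r. indicator {1<..} r *\<^sub>R f r)"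
  have [measurable]: "F \<in> borel_measurable borel" using fm by (simp add: F_def set_borel_measurable_def)
  have F: "indicator ext_ball x *\<^sub>R f (norm x) = 1 * F (norm x)" for x :: 'a
    by (auto simp: F_def ext_ball_def split: split_indicator)
  have s1: "sphere_integrable (\<lambda>_::'a. 1)"
    by (rule sphere_integrable_bounded[of _ 1]) auto
  have F': "(\<lambda>x::'a. indicator ext_ball x *\<^sub>R f (norm x)) = (\<lambda>x. F (norm x))"
    by (rule ext) (use F in simp)
  have "?C \<longleftrightarrow> (\<lambda>x::'a. F (norm x)) \<in> borel_measurable lebesgue"
    by (subst borel_measurable_restrict_space_iff) (simp_all only: F', simp)
  then show ?C by (simp add: measurable_completion)
  have "integrable (lebesgue_on (ext_ball :: 'a set)) (\<lambda>x. f (norm x)) \<longleftrightarrow> integrable lborel (\<lambda>x::'a. 1 * F (norm x))"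
    by (subst integrable_restrict_space) (simp_all only: F', simp_all add: integrable_completion)
  also have "\<dots> \<longleftrightarrow> integrable lborel (\<lambda>r. sphere_int (\<lambda>_::'a. 1) * (indicator {0<..} r * r ^ (DIM('a) - 1)) * F r)"
    using lborel_polar_nonneg(1)[of "\<lambda>_::'a. 1" F] s1 by simp
  also have "(\<lambda>r. sphere_int (\<lambda>_::'a. 1) * (indicator {0<..} r * r ^ (DIM('a) - 1)) * F r) =
    (\<lambda>r. sphere_int (\<lambda>_::'a. 1) * (indicator {1<..} r *\<^sub>R (f r * r ^ (DIM('a) - 1))))"
    by (rule ext) (auto simp: F_def split: split_indicator)
  finally show ?A using sphere_area_pos[where 'a='a] by (simp add: set_integrable_def)
  have "(LINT x|lebesgue_on (ext_ball :: 'a set). f (norm x)) = (LINT x|lborel. 1 * F (norm (x::'a)))"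
    by (subst integral_restrict_space) (simp_all only: F', simp_all add: integral_completion)
  also have "\<dots> = sphere_int (\<lambda>_::'a. 1) * (LINT r:{0<..}|lborel. F r * r ^ (DIM('a) - 1))"
    by (rule lborel_polar_nonneg(2)[of "\<lambda>_::'a. 1" F]) (use s1 in auto)
  also have "(LINT r:{0<..}|lborel. F r * r ^ (DIM('a) - 1)) = (LINT r:{1<..}|lborel. f r * r ^ (DIM('a) - 1))"
    unfolding set_lebesgue_integral_def
    by (intro Bochner_Integration.integral_cong) (auto simp: F_def split: split_indicator)
  finally show ?B .
qed

text \<open>A bounded signed angular factor reduces to nonnegative ones by q = (q + B) - B.\<close>

lemma ext_integral_polar:
  fixes f :: "real \<Rightarrow> real" and q :: "'a::euclidean_space \<Rightarrow> real"
  assumes fm: "set_borel_measurable borel {1<..} f"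
    and qm [measurable]: "(\<lambda>x. q (x /\<^sub>R norm x)) \<in> borel_measurable borel" and B: "\<And>x. \<bar>q x\<bar> \<le> B"
    and fi: "set_integrable lborel {1<..} (\<lambda>r. f r * r ^ (DIM('a) - 1))"
  shows "(LINT x|lebesgue_on ext_ball. q (x /\<^sub>R norm x) * f (norm x)) =
      sphere_int q * (LINT r:{1<..}|lborel. f r * r ^ (DIM('a) - 1))"
proof -
  define F where "F = (\<lambda>r. indicator {1<..} r *\<^sub>R f r)"
  have [measurable]: "F \<in> borel_measurable borel" using fm by (simp add: F_def set_borel_measurable_def)
  have qL: "(\<lambda>x. q (x /\<^sub>R norm x)) \<in> borel_measurable (lebesgue_on (ball 0 1))"
    by (intro measurable_restrict_space1 measurable_completion) auto
  have Bs: "\<bar>q x + B\<bar> \<le> 2 * B" for x using B[of x] by linarith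
  have qi: "sphere_integrable (\<lambda>x. q x + B)"
    by (rule sphere_integrable_bounded[of _ "2 * B"]) (use qL Bs in auto)
  have ci: "sphere_integrable (\<lambda>_::'a. B)"
    by (rule sphere_integrable_bounded[of _ "\<bar>B\<bar>"]) auto
  have q0: "q x + B \<ge> 0" "B \<ge> 0" for x using B[of x] by linarith+
  have Fi: "integrable lborel (\<lambda>r. k * (indicator {0<..} r * r ^ (DIM('a) - 1)) * F r)" for k
  proof -
    have "(\<lambda>r. k * (indicator {0<..} r * r ^ (DIM('a) - 1)) * F r) =
      (\<lambda>r. k * (indicator {1<..} r *\<^sub>R (f r * r ^ (DIM('a) - 1))))"
      by (rule ext) (auto simp: F_def split: split_indicator)
    then show ?thesis using fi by (simp add: set_integrable_def)
  qed
  have 1: "integrable lborel (\<lambda>x::'a. (q (x /\<^sub>R norm x) + B) * F (norm x))"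
    "(LINT x|lborel. (q (x /\<^sub>R norm x) + B) * F (norm x)) = sphere_int (\<lambda>x. q x + B) * (LINT r:{0<..}|lborel. F r * r ^ (DIM('a) - 1))"
    using lborel_polar_nonneg[of "\<lambda>x. q x + B" F] qi q0 Fi by auto
  have 2: "integrable lborel (\<lambda>x::'a. B * F (norm x))"
    "(LINT x|lborel. B * F (norm (x::'a))) = sphere_int (\<lambda>_::'a. B) * (LINT r:{0<..}|lborel. F r * r ^ (DIM('a) - 1))"
    using lborel_polar_nonneg[of "\<lambda>_::'a. B" F] ci q0 Fi by auto
  have s: "sphere_int (\<lambda>x. q x + B) = sphere_int q + sphere_int (\<lambda>_::'a. B)"
  proof -
    have "sphere_integrable q"
      by (rule sphere_integrable_bounded[OF qL B])
    then show ?thesis using ci unfolding sphere_integrable_def sphere_int_def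
      by (simp add: Bochner_Integration.integral_add distrib_left)
  qed
  have "(LINT x|lebesgue_on ext_ball. q (x /\<^sub>R norm x) * f (norm x)) = (LINT x|lebesgue. q (x /\<^sub>R norm x) * F (norm (x::'a)))"
    by (subst integral_restrict_space) (auto simp: F_def ext_ball_def intro!: Bochner_Integration.integral_cong split: split_indicator)
  also have "\<dots> = (LINT x|lborel. q (x /\<^sub>R norm x) * F (norm (x::'a)))"
    by (rule integral_completion) auto
  also have "\<dots> = (LINT x|lborel. (q (x /\<^sub>R norm x) + B) * F (norm x) - B * F (norm (x::'a)))"
    by (simp add: algebra_simps)
  also have "\<dots> = sphere_int q * (LINT r:{0<..}|lborel. F r * r ^ (DIM('a) - 1))"
    by (simp only: Bochner_Integration.integral_diff[OF 1(1) 2(1)] 1(2) 2(2) s) (simp add: distrib_right)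
  also have "(LINT r:{0<..}|lborel. F r * r ^ (DIM('a) - 1)) = (LINT r:{1<..}|lborel. f r * r ^ (DIM('a) - 1))"
    unfolding set_lebesgue_integral_def
    by (intro Bochner_Integration.integral_cong) (auto simp: F_def split: split_indicator)
  finally show ?thesis .
qed

lemma ext_integrable_bounded:
  fixes f :: "'a::euclidean_space \<Rightarrow> real"
  assumes "f \<in> borel_measurable (lebesgue_on ext_ball)"
    "\<And>x. norm x > 1 \<Longrightarrow> \<bar>f x\<bar> \<le> B" "\<And>x. norm x > 1 \<Longrightarrow> norm x > R \<Longrightarrow> f x = 0"
  shows "integrable (lebesgue_on ext_ball) f"
proof (rule integrableI_bounded_set[where A="ext_ball \<inter> cball 0 R" and B=B])
  show "ext_ball \<inter> cball 0 R \<in> sets (lebesgue_on (ext_ball :: 'a set))"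
    by (auto simp: sets_restrict_space_iff)
  have "emeasure (lebesgue_on ext_ball) (ext_ball \<inter> cball (0::'a) R) = emeasure lebesgue (ext_ball \<inter> cball (0::'a) R)"
    by (rule emeasure_restrict_space) auto
  also have "\<dots> \<le> emeasure lebesgue (cball (0::'a) R)"
    by (rule emeasure_mono) auto
  also have "\<dots> < \<infinity>" using emeasure_bounded_finite[of "cball (0::'a) R"] by (simp add: less_top)
  finally show "emeasure (lebesgue_on ext_ball) (ext_ball \<inter> cball (0::'a) R) < \<infinity>" .
qed (use assms in \<open>auto simp: ext_ball_def\<close>)

section \<open>The Gauss--Green formula for radial functions on the exterior domain\<close>

lemma lborel_integral_translation:
  fixes f :: "'a::euclidean_space \<Rightarrow> real"
  assumes [measurable]: "f \<in> borel_measurable borel"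
  shows "(LINT x|lborel. f (x + c)) = (LINT x|lborel. f x)"
    and "integrable lborel (\<lambda>x. f (x + c)) \<longleftrightarrow> integrable lborel f"
proof -
  have "(LINT x|lborel. f x) = (LINT x|distr lborel borel ((+) c). f x)"
    by (simp add: lborel_distr_plus)
  also have "\<dots> = (LINT x|lborel. f (x + c))"
    by (subst integral_distr) (auto simp: add.commute)
  finally show "(LINT x|lborel. f (x + c)) = (LINT x|lborel. f x)" by simp
  have "integrable lborel f \<longleftrightarrow> integrable (distr lborel borel ((+) c)) f"
    by (simp add: lborel_distr_plus)
  also have "\<dots> \<longleftrightarrow> integrable lborel (\<lambda>x. f (x + c))"
    by (subst integrable_distr_eq) (auto simp: add.commute)
  finally show "integrable lborel (\<lambda>x. f (x + c)) \<longleftrightarrow> integrable lborel f" by simp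
qed

text \<open>By translation invariance all difference quotients have integral zero.\<close>
lemma integral_partial_eq_0:
  fixes F :: "'a::euclidean_space \<Rightarrow> real"
  assumes der: "\<And>x. (F has_derivative F' x) (at x)"
    and bnd: "\<And>x. \<bar>F' x i\<bar> \<le> B" and meas [measurable]: "(\<lambda>x. F' x i) \<in> borel_measurable borel"
    and supp: "\<And>x. norm x > R \<Longrightarrow> F x = 0" and i: "norm i = 1"
  shows "(LINT x|lborel. F' x i) = 0"
proof -
  have contF: "continuous_on UNIV F"
    using der by (meson continuous_at_imp_continuous_on has_derivative_continuous)
  have [measurable]: "F \<in> borel_measurable borel" using contF by (rule borel_measurable_continuous_onI)
  have line: "((\<lambda>t. F (x + t *\<^sub>R i)) has_real_derivative F' (x + t *\<^sub>R i) i) (at t)" for x t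
  proof -
    have "((\<lambda>t. F (x + t *\<^sub>R i)) has_derivative (\<lambda>h. F' (x + t *\<^sub>R i) (h *\<^sub>R i))) (at t)"
      by (rule has_derivative_compose[OF _ der]) (auto intro!: derivative_eq_intros)
    moreover have "F' (x + t *\<^sub>R i) (h *\<^sub>R i) = F' (x + t *\<^sub>R i) i * h" for h
      using linear_scale[OF has_derivative_linear[OF der]] by simp
    ultimately show ?thesis by (simp add: has_field_derivative_def)
  qed
  define t where "t = (\<lambda>n. inverse (real (Suc n)))"
  have t: "t n > 0" "t n \<le> 1" for n by (auto simp: t_def divide_simps)
  define D where "D = (\<lambda>n x. (F (x + t n *\<^sub>R i) - F x) / t n)"
  have Fi: "integrable lborel F"
  proof -
    have "integrable lborel (\<lambda>x. indicator (cball 0 R) x *\<^sub>R F x)"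
      by (rule borel_integrable_compact) (use contF in \<open>auto intro: continuous_on_subset\<close>)
    also have "(\<lambda>x. indicator (cball 0 R) x *\<^sub>R F x) = F"
      using supp by (intro ext) (auto simp: indicator_def not_le)
    finally show ?thesis .
  qed
  have int0: "(LINT x|lborel. D n x) = 0" for n
    unfolding D_def using Fi lborel_integral_translation[of F "t n *\<^sub>R i"] by simp
  have "(\<lambda>n. LINT x|lborel. D n x) \<longlonglongrightarrow> (LINT x|lborel. F' x i)"
  proof (rule integral_dominated_convergence[where w="\<lambda>x. B * indicator (cball 0 (R+1)) x"])
    show "integrable lborel (\<lambda>x::'a. B * indicator (cball 0 (R+1)) x)"
      using emeasure_bounded_finite[of "cball (0::'a) (R+1)"] by simp
    show "AE x in lborel. (\<lambda>n. D n x) \<longlonglongrightarrow> F' x i"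
    proof (rule AE_I2)
      fix x
      have "((\<lambda>h. (F (x + (0 + h) *\<^sub>R i) - F (x + 0 *\<^sub>R i)) / h) \<longlongrightarrow> F' (x + 0 *\<^sub>R i) i) (at 0)"
        using line[of x 0] unfolding DERIV_def .
      moreover have "filterlim t (at 0) sequentially"
        unfolding t_def filterlim_at using LIMSEQ_inverse_real_of_nat by auto
      ultimately show "(\<lambda>n. D n x) \<longlonglongrightarrow> F' x i"
        unfolding D_def by (auto dest: filterlim_compose)
    qed
    show "AE x in lborel. norm (D n x) \<le> B * indicator (cball 0 (R+1)) x" for n
    proof (rule AE_I2)
      fix x
      have "norm (t n *\<^sub>R i) \<le> 1" using t[of n] i by simp
      then have far: "norm (x + t n *\<^sub>R i) > R" "norm x > R" if "norm x > R + 1"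
        using that norm_triangle_ineq2[of x "- (t n *\<^sub>R i)"] by auto
      \<comment> \<open>The mean value theorem bounds the difference quotients by B, and shifts of
        length at most 1 keep them supported in the ball of radius R + 1. This is the integrable
        majorant for dominated convergence.\<close>
      obtain z where "F (x + t n *\<^sub>R i) - F (x + 0 *\<^sub>R i) = (t n - 0) * F' (x + z *\<^sub>R i) i"
        using MVT2[of 0 "t n" "\<lambda>t. F (x + t *\<^sub>R i)" "\<lambda>t. F' (x + t *\<^sub>R i) i"] t(1)[of n] line by blast
      then have "\<bar>D n x\<bar> \<le> B" using t(1)[of n] bnd by (simp add: D_def)
      then show "norm (D n x) \<le> B * indicator (cball 0 (R+1)) x"
        using far supp by (auto simp: D_def indicator_def)
    qed
  qed (auto simp: D_def)
  then show ?thesis by (simp add: int0 LIMSEQ_const_iff)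
qed

section \<open>Uniform bounds for test functions and test fields\<close>

lemma test_fun_bounds:
  fixes \<psi> :: "'a::euclidean_space \<Rightarrow> real"
  assumes "test_fun A \<psi>"
  obtains R B where "R > 0" "B > 0" "\<And>x. \<bar>\<psi> x\<bar> \<le> B" "\<And>i x. i \<in> Basis \<Longrightarrow> \<bar>partial \<psi> i x\<bar> \<le> B"
    "\<And>x. norm x > R \<Longrightarrow> \<psi> x = 0" "\<And>i x. norm x > R \<Longrightarrow> partial \<psi> i x = 0"
proof -
  have sm: "smooth_fun \<psi>" and cp: "compact (supp_closure \<psi>)" using assms by (auto simp: test_fun_def)
  obtain R where R: "R > 0" "\<And>x. x \<in> supp_closure \<psi> \<Longrightarrow> norm x \<le> R"
    using compact_imp_bounded[OF cp] by (meson bounded_pos)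
  have z: "\<psi> x = 0" if "norm x > R" for x
    using R(2)[of x] that closure_subset[of "{x. \<psi> x \<noteq> 0}"] by (auto simp: supp_closure_def)
  have pz: "partial \<psi> i x = 0" if "norm x > R" for i x
  proof (rule partial_eq)
    show "(\<psi> has_derivative (\<lambda>_. 0)) (at x)"
      by (rule has_derivative_transform_within_open[of "\<lambda>_. 0" _ _ UNIV "{x. norm x > R}"])
        (use that z in \<open>auto intro!: open_Collect_less continuous_intros\<close>)
  qed
  have "\<exists>B. \<forall>x\<in>cball 0 R. \<bar>f x\<bar> \<le> B" if "continuous_on (cball (0::'a) R) f" for f :: "'a \<Rightarrow> real"
    using compact_imp_bounded[OF compact_continuous_image[OF that compact_cball]]
    by (auto simp: bounded_iff)
  then have ex: "\<exists>B. \<forall>x\<in>cball 0 R. \<bar>\<psi> x\<bar> \<le> B" "\<forall>i\<in>Basis. \<exists>B. \<forall>x\<in>cball 0 R. \<bar>partial \<psi> i x\<bar> \<le> B"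
    using smooth_fun_continuous_on[OF sm] smooth_fun_partial_continuous_on[OF sm] by blast+
  obtain B0 where B0: "\<And>x. x \<in> cball 0 R \<Longrightarrow> \<bar>\<psi> x\<bar> \<le> B0" using ex(1) by blast
  obtain B1 where B1: "\<And>i x. i \<in> Basis \<Longrightarrow> x \<in> cball 0 R \<Longrightarrow> \<bar>partial \<psi> i x\<bar> \<le> B1 i"
    using bchoice[OF ex(2)] by blast
  define B where "B = 1 + \<bar>B0\<bar> + (\<Sum>i\<in>Basis. \<bar>B1 i\<bar>)"
  have b1: "\<bar>B1 i\<bar> \<le> (\<Sum>i\<in>Basis. \<bar>B1 i\<bar>)" if "i \<in> Basis" for i
    using that by (intro member_le_sum) auto
  have s0: "(\<Sum>i\<in>Basis. \<bar>B1 i\<bar>) \<ge> 0" by (intro sum_nonneg) auto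
  show ?thesis
  proof (rule that[of R B])
    show "\<bar>\<psi> x\<bar> \<le> B" for x
    proof (cases "norm x > R")
      case False
      then have "\<bar>\<psi> x\<bar> \<le> B0" using B0[of x] by simp
      then show ?thesis using s0 unfolding B_def by linarith
    qed (use z s0 in \<open>simp add: B_def\<close>)
    show "\<bar>partial \<psi> i x\<bar> \<le> B" if "i \<in> Basis" for i x
      using B1[OF that, of x] pz[of x i] b1[OF that] by (cases "norm x > R") (auto simp: B_def)
    show "B > 0" using s0 unfolding B_def by linarith
  qed (use R z pz in auto)
qed

lemma test_field_bounds:
  fixes \<Phi> :: "'a::euclidean_space \<Rightarrow> 'a"
  assumes "\<forall>i\<in>Basis. test_fun A (\<lambda>y. \<Phi> y \<bullet> i)"
  obtains R B where "R > 0" "B > 0" "\<And>i x. i \<in> Basis \<Longrightarrow> \<bar>\<Phi> x \<bullet> i\<bar> \<le> B"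
    "\<And>i j x. i \<in> Basis \<Longrightarrow> j \<in> Basis \<Longrightarrow> \<bar>partial (\<lambda>y. \<Phi> y \<bullet> i) j x\<bar> \<le> B"
    "\<And>i x. i \<in> Basis \<Longrightarrow> norm x > R \<Longrightarrow> \<Phi> x \<bullet> i = 0"
    "\<And>i j x. i \<in> Basis \<Longrightarrow> norm x > R \<Longrightarrow> partial (\<lambda>y. \<Phi> y \<bullet> i) j x = 0"
    "\<And>x. norm x > R \<Longrightarrow> \<Phi> x = 0" "\<And>x. norm x > R \<Longrightarrow> divergence \<Phi> x = 0"
    "\<And>x. norm (\<Phi> x) \<le> B" "\<And>x. \<bar>divergence \<Phi> x\<bar> \<le> B"
proof -
  define P where "P = (\<lambda>i R B. R > 0 \<and> B > 0 \<and> (\<forall>x. \<bar>\<Phi> x \<bullet> i\<bar> \<le> B) \<and> (\<forall>j\<in>Basis. \<forall>x. \<bar>partial (\<lambda>y. \<Phi> y \<bullet> i) j x\<bar> \<le> B) \<and>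
    (\<forall>x. norm x > R \<longrightarrow> \<Phi> x \<bullet> i = 0) \<and> (\<forall>j x. norm x > R \<longrightarrow> partial (\<lambda>y. \<Phi> y \<bullet> i) j x = 0))"
  have "\<forall>i\<in>Basis. \<exists>R B. P i R B"
  proof
    fix i :: 'a assume "i \<in> Basis"
    then obtain R B where "R > 0" "B > 0" "\<And>x. \<bar>\<Phi> x \<bullet> i\<bar> \<le> B" "\<And>j x. j \<in> Basis \<Longrightarrow> \<bar>partial (\<lambda>y. \<Phi> y \<bullet> i) j x\<bar> \<le> B"
      "\<And>x. norm x > R \<Longrightarrow> \<Phi> x \<bullet> i = 0" "\<And>j x. norm x > R \<Longrightarrow> partial (\<lambda>y. \<Phi> y \<bullet> i) j x = 0"
      by (rule test_fun_bounds[OF bspec[OF assms]]) (rule that)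
    then have "P i R B" by (simp add: P_def)
    then show "\<exists>R B. P i R B" by blast
  qed
  from bchoice[OF this] obtain Ri where "\<forall>i\<in>Basis. \<exists>B. P i (Ri i) B" by blast
  from bchoice[OF this] obtain Bi where PB: "\<forall>i\<in>Basis. P i (Ri i) (Bi i)" by blast
  then have pos: "Ri i > 0" "Bi i > 0" and bd: "\<bar>\<Phi> x \<bullet> i\<bar> \<le> Bi i" "j \<in> Basis \<Longrightarrow> \<bar>partial (\<lambda>y. \<Phi> y \<bullet> i) j x\<bar> \<le> Bi i"
    and zero: "norm x > Ri i \<Longrightarrow> \<Phi> x \<bullet> i = 0" "norm x > Ri i \<Longrightarrow> partial (\<lambda>y. \<Phi> y \<bullet> i) j x = 0"
    if "i \<in> Basis" for i j x using that by (simp_all add: P_def)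
  define R B where "R = sum Ri Basis" and "B = sum Bi Basis"
  have R: "Ri i \<le> R" if "i \<in> Basis" for i
    unfolding R_def using that pos(1) by (intro member_le_sum less_imp_le) simp_all
  have B: "Bi i \<le> B" if "i \<in> Basis" for i
    unfolding B_def using that pos(2) by (intro member_le_sum less_imp_le) simp_all
  have z: "\<Phi> x \<bullet> i = 0" "partial (\<lambda>y. \<Phi> y \<bullet> i) j x = 0" if "i \<in> Basis" "norm x > R" for i j x
    using zero[OF that(1)] order.strict_trans1[OF R[OF that(1)] that(2)] by simp_all
  show ?thesis
  proof (rule that[of R B])
    show "R > 0" "B > 0" unfolding R_def B_def using pos by (simp_all add: sum_pos)
    show "norm x > R \<Longrightarrow> \<Phi> x = 0" for x by (rule euclidean_eqI) (simp add: z)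
    show "norm x > R \<Longrightarrow> divergence \<Phi> x = 0" for x unfolding divergence_def by (rule sum.neutral) (simp add: z)
    have "norm (\<Phi> x) \<le> (\<Sum>i\<in>Basis. \<bar>\<Phi> x \<bullet> i\<bar>)" for x by (rule norm_le_l1)
    also have "\<dots> x \<le> B" for x unfolding B_def using bd(1) by (rule sum_mono)
    finally show "norm (\<Phi> x) \<le> B" for x .
    have "\<bar>divergence \<Phi> x\<bar> \<le> (\<Sum>i\<in>Basis. \<bar>partial (\<lambda>y. \<Phi> y \<bullet> i) i x\<bar>)" for x unfolding divergence_def by (rule sum_abs)
    also have "\<dots> x \<le> B" for x unfolding B_def by (rule sum_mono) (rule bd(2))
    finally show "\<bar>divergence \<Phi> x\<bar> \<le> B" for x .
    show "\<bar>\<Phi> x \<bullet> i\<bar> \<le> B" if "i \<in> Basis" for i x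
      using bd(1)[OF that] B[OF that] by (rule order_trans)
    show "\<bar>partial (\<lambda>y. \<Phi> y \<bullet> i) j x\<bar> \<le> B" if "i \<in> Basis" "j \<in> Basis" for i j x
      using bd(2)[OF that] B[OF that(1)] by (rule order_trans)
    show "\<Phi> x \<bullet> i = 0" "partial (\<lambda>y. \<Phi> y \<bullet> i) j x = 0" if "i \<in> Basis" "norm x > R" for i j x
      using z[OF that] by simp_all
  qed
qed

lemma test_fun_smooth: "test_fun A \<psi> \<Longrightarrow> smooth_fun \<psi>"
  by (simp add: test_fun_def)

lemma test_fun_borel: "test_fun A \<psi> \<Longrightarrow> \<psi> \<in> borel_measurable borel"
  by (intro borel_measurable_continuous_onI smooth_fun_continuous_on test_fun_smooth)

lemma test_fun_partial_borel: "test_fun A \<psi> \<Longrightarrow> i \<in> Basis \<Longrightarrow> partial \<psi> i \<in> borel_measurable borel"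
  by (intro borel_measurable_continuous_onI smooth_fun_partial_continuous_on test_fun_smooth)

lemma test_field_borel:
  fixes \<Phi> :: "'a::euclidean_space \<Rightarrow> 'a"
  assumes "\<forall>i\<in>Basis. test_fun A (\<lambda>y. \<Phi> y \<bullet> i)"
  shows "\<Phi> \<in> borel_measurable borel" "divergence \<Phi> \<in> borel_measurable borel" "continuous_on UNIV \<Phi>"
proof -
  show "\<Phi> \<in> borel_measurable borel"
    by (subst borel_measurable_euclidean_space) (use assms test_fun_borel in blast)
  show "divergence \<Phi> \<in> borel_measurable borel"
    unfolding divergence_def[abs_def] using assms test_fun_partial_borel by (intro borel_measurable_sum) blast
  show "continuous_on UNIV \<Phi>"
    by (subst continuous_on_componentwise) (use assms smooth_fun_continuous_on test_fun_smooth in blast)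
qed

lemma ext_integral_eq_lborel:
  fixes f :: "'a::euclidean_space \<Rightarrow> real"
  assumes "f \<in> borel_measurable borel" "\<And>x. norm x \<le> 1 \<Longrightarrow> f x = 0"
  shows "(LINT x|lebesgue_on ext_ball. f x) = (LINT x|lborel. f x)"
proof -
  have "(\<lambda>x. indicator ext_ball x *\<^sub>R f x) = f"
    using assms(2) by (intro ext) (auto simp: ext_ball_def indicator_def not_less)
  then show ?thesis using assms(1)
    by (subst integral_restrict_space) (auto simp: integral_completion)
qed

text \<open>As \<open>U\<close> vanishes up to radius 1, the field U(|x|) \<Phi>(x) extends by zero
  into the ball as a differentiable field; the kink of the norm at the origin is invisible. Its
  divergence then integrates to zero over the whole space.\<close>

lemma ext_divergence_vanishing:
  fixes \<Phi> :: "'a::euclidean_space \<Rightarrow> 'a"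
  assumes dU: "\<And>r. (U has_real_derivative U' r) (at r)" and cU: "continuous_on UNIV U'"
    and U0: "\<And>r. r \<le> 1 \<Longrightarrow> U r = 0" and \<Phi>: "\<forall>i\<in>Basis. test_fun UNIV (\<lambda>y. \<Phi> y \<bullet> i)"
  shows "(LINT x|lebesgue_on ext_ball. U (norm x) * divergence \<Phi> x + U' (norm x) * (sgn x \<bullet> \<Phi> x)) = 0"
proof -
  obtain R B where RB: "R > 0" "B > 0" "\<And>i x. i \<in> Basis \<Longrightarrow> \<bar>\<Phi> x \<bullet> i\<bar> \<le> B"
    "\<And>i j x. i \<in> Basis \<Longrightarrow> j \<in> Basis \<Longrightarrow> \<bar>partial (\<lambda>y. \<Phi> y \<bullet> i) j x\<bar> \<le> B"
    "\<And>i x. i \<in> Basis \<Longrightarrow> norm x > R \<Longrightarrow> \<Phi> x \<bullet> i = 0"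
    "\<And>i j x. i \<in> Basis \<Longrightarrow> norm x > R \<Longrightarrow> partial (\<lambda>y. \<Phi> y \<bullet> i) j x = 0"
    by (rule test_field_bounds[OF \<Phi>]) (rule that)
  have contU: "continuous_on UNIV U" using dU by (intro continuous_at_imp_continuous_on) (auto intro: DERIV_isCont)
  have lt: "U' r = 0" if "r < 1" for r
  proof -
    have "((\<lambda>_. 0) has_real_derivative U' r) (at r)"
      by (rule has_field_derivative_transform_within_open[OF dU, of "{..<1}"]) (use that U0 in auto)
    then show ?thesis by (rule DERIV_unique) (rule DERIV_const)
  qed
  have U'0: "U' r = 0" if "r \<le> 1" for r
  proof (cases "r < 1")
    case True
    then show ?thesis by (rule lt)
  next
    case False
    have "U' 1 = 0"
      by (rule continuous_constant_on_closure[of "{..<1}" U'])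
        (use lt cU in \<open>auto intro: continuous_on_subset\<close>)
    then show ?thesis using False that by simp
  qed
  have [measurable]: "U \<in> borel_measurable borel" "U' \<in> borel_measurable borel"
    using contU cU by (auto intro: borel_measurable_continuous_onI)
  obtain BU where BU: "\<And>r. r \<in> {0..R} \<Longrightarrow> \<bar>U r\<bar> \<le> BU" "\<And>r. r \<in> {0..R} \<Longrightarrow> \<bar>U' r\<bar> \<le> BU"
  proof -
    have "bounded (U ` {0..R})" "bounded (U' ` {0..R})"
      using contU cU by (auto intro!: compact_imp_bounded compact_continuous_image intro: continuous_on_subset)
    then obtain b1 b2 where b: "\<And>r. r \<in> {0..R} \<Longrightarrow> \<bar>U r\<bar> \<le> b1" "\<And>r. r \<in> {0..R} \<Longrightarrow> \<bar>U' r\<bar> \<le> b2"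
      unfolding bounded_iff by fastforce
    show ?thesis by (rule that[of "max b1 b2"]) (use b in \<open>auto simp: le_max_iff_disj\<close>)
  qed
  have BU0: "BU \<ge> 0" using BU(1)[of 0] RB(1) by auto
  \<comment> \<open>\<open>F' i x\<close> is the derivative at x of the i-th component of U(|x|)
    \<Phi>(x). The values \<open>F' i x i\<close> add up to the integrand.\<close>
  define F' where "F' = (\<lambda>i x h. U (norm x) * frechet_derivative (\<lambda>y. \<Phi> y \<bullet> i) (at x) h + U' (norm x) * (sgn x \<bullet> h) * (\<Phi> x \<bullet> i))"
  have F'i: "F' i x j = U (norm x) * partial (\<lambda>y. \<Phi> y \<bullet> i) j x + U' (norm x) * (sgn x \<bullet> j) * (\<Phi> x \<bullet> i)" for i x j
    by (simp add: F'_def partial_def)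
  have m [measurable]: "(\<lambda>x. F' i x i) \<in> borel_measurable borel" if i: "i \<in> Basis" for i
  proof -
    have [measurable]: "partial (\<lambda>y. \<Phi> y \<bullet> i) i \<in> borel_measurable borel" "(\<lambda>y. \<Phi> y \<bullet> i) \<in> borel_measurable borel"
      using \<Phi> i test_fun_partial_borel test_fun_borel by blast+
    show ?thesis unfolding F'i sgn_div_norm by measurable
  qed
  have b: "\<bar>F' i x i\<bar> \<le> BU * B + BU * B" and z: "norm x > R \<Longrightarrow> F' i x i = 0" if i: "i \<in> Basis" for i x
  proof -
    show zz: "norm x > R \<Longrightarrow> F' i x i = 0" using RB i by (simp add: F'i)
    show "\<bar>F' i x i\<bar> \<le> BU * B + BU * B"
    proof (cases "norm x > R")
      case False
      have "\<bar>sgn x \<bullet> i\<bar> \<le> 1"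
        using Basis_le_norm[OF i, of "sgn x"] by (auto simp: norm_sgn split: if_splits)
      then have "\<bar>U' (norm x)\<bar> * \<bar>sgn x \<bullet> i\<bar> * \<bar>\<Phi> x \<bullet> i\<bar> \<le> BU * 1 * B"
        using False i BU0 RB(2) by (intro mult_mono BU RB) auto
      moreover have "\<bar>U (norm x)\<bar> * \<bar>partial (\<lambda>y. \<Phi> y \<bullet> i) i x\<bar> \<le> BU * B"
        using False i BU0 by (intro mult_mono BU RB) auto
      ultimately show ?thesis unfolding F'i
        by (intro order_trans[OF abs_triangle_ineq] add_mono) (auto simp: abs_mult)
    qed (use zz BU0 RB(2) in auto)
  qed
  have int0: "(LINT x|lborel. F' i x i) = 0" if i: "i \<in> Basis" for i
  proof (rule integral_partial_eq_0[where F="\<lambda>x. U (norm x) * (\<Phi> x \<bullet> i)" and F'="F' i" and i=i and R=R])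
    fix x :: 'a
    show "((\<lambda>x. U (norm x) * (\<Phi> x \<bullet> i)) has_derivative F' i x) (at x)"
    proof (cases "x = 0")
      case True
      have "F' i x = (\<lambda>_. 0)" using True U0 U'0 by (auto simp: F'_def)
      moreover have "((\<lambda>x. U (norm x) * (\<Phi> x \<bullet> i)) has_derivative (\<lambda>_. 0)) (at x)"
        by (rule has_derivative_transform_within_open[of "\<lambda>_. 0" _ _ UNIV "ball 0 1"]) (use True U0 in auto)
      ultimately show ?thesis by simp
    next
      case False
      have "(norm has_derivative (\<lambda>h. sgn x \<bullet> h)) (at x)"
        using has_derivative_norm[of x] False by (simp add: inner_commute)
      then have 1: "((\<lambda>x. U (norm x)) has_derivative (\<lambda>h. U' (norm x) * (sgn x \<bullet> h))) (at x)"
        using has_derivative_compose[of norm _ x UNIV U "\<lambda>h. U' (norm x) * h"] dU[of "norm x"]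
        by (simp add: has_field_derivative_def)
      have 2: "((\<lambda>y. \<Phi> y \<bullet> i) has_derivative frechet_derivative (\<lambda>y. \<Phi> y \<bullet> i) (at x)) (at x)"
        using \<Phi> i by (intro has_derivative_partial test_fun_smooth) blast
      show ?thesis unfolding F'_def by (rule has_derivative_eq_rhs[OF has_derivative_mult[OF 1 2]]) auto
    qed
  qed (use b m i RB in auto)
  have Fint: "integrable lborel (\<lambda>x. F' i x i)" if i: "i \<in> Basis" for i
    by (rule integrableI_bounded_set[where A="cball 0 R" and B="BU * B + BU * B"])
      (use m[OF i] b[OF i] z[OF i] emeasure_bounded_finite[of "cball (0::'a) R"] in \<open>auto simp: not_le\<close>)
  have eq: "U (norm x) * divergence \<Phi> x + U' (norm x) * (sgn x \<bullet> \<Phi> x) = (\<Sum>i\<in>Basis. F' i x i)" for x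
    unfolding F'i divergence_def
    by (simp add: sum.distrib sum_distrib_left euclidean_inner[of "sgn x" "\<Phi> x"] mult.assoc)
  have "(LINT x|lebesgue_on ext_ball. (\<Sum>i\<in>Basis. F' i x i)) = (LINT x|lborel. (\<Sum>i\<in>Basis. F' i x i))"
    using m U0 U'0 by (intro ext_integral_eq_lborel borel_measurable_sum) (auto simp: F'i intro!: sum.neutral)
  also have "\<dots> = (\<Sum>i\<in>Basis. LINT x|lborel. F' i x i)"
    using Fint by (intro Bochner_Integration.integral_sum) auto
  finally show ?thesis unfolding eq using int0 by simp
qed

section \<open>Radial steps and the kernels they generate\<close>

locale smooth_step =
  fixes S s :: "real \<Rightarrow> real"
  assumes S_smooth: "smooth_fun S" and s_smooth: "smooth_fun s"
    and S_deriv: "\<And>t. (S has_real_derivative s t) (at t)"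
    and S_0: "\<And>t. t \<le> 0 \<Longrightarrow> S t = 0" and S_1: "\<And>t. t \<ge> 1 \<Longrightarrow> S t = 1"
    and S_nonneg: "\<And>t. 0 \<le> S t" and S_le_1: "\<And>t. S t \<le> 1"
    and s_nonneg: "\<And>t. s t \<ge> 0" and s_0: "\<And>t. t \<le> 0 \<or> t \<ge> 1 \<Longrightarrow> s t = 0"

lemma smooth_step_ex: "\<exists>S s. smooth_step S s"
proof -
  obtain S s :: "real \<Rightarrow> real" where "smooth_fun S" "smooth_fun s"
    "\<And>t. (S has_real_derivative s t) (at t)"
    "\<And>t. t \<le> 0 \<Longrightarrow> S t = 0" "\<And>t. t \<ge> 1 \<Longrightarrow> S t = 1" "\<And>t. 0 \<le> S t" "\<And>t. S t \<le> 1"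
    "\<And>t. s t \<ge> 0" "\<And>t. t \<le> 0 \<or> t \<ge> 1 \<Longrightarrow> s t = 0"
    by (rule smooth_step_exists) (rule that)
  then have "smooth_step S s" by unfold_locales
  then show ?thesis by blast
qed

lemma set_integrable_Ioi:
  fixes F :: "real \<Rightarrow> real"
  assumes "continuous_on {a..b} F" "\<And>r. r > b \<Longrightarrow> F r = 0"
  shows "set_integrable lborel {a<..} F"
proof -
  have "set_integrable lborel {a..b} F"
    unfolding set_integrable_def using assms(1) by (intro borel_integrable_compact) auto
  then have "set_integrable lborel {a<..b} F"
    by (rule set_integrable_subset) auto
  moreover have "(\<lambda>r. indicator {a<..b} r *\<^sub>R F r) = (\<lambda>r. indicator {a<..} r *\<^sub>R F r)"
    using assms(2) by (intro ext) (auto simp: indicator_def)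
  ultimately show ?thesis by (simp only: set_integrable_def)
qed

lemma set_borel_measurable_Ioi:
  fixes F :: "real \<Rightarrow> real"
  assumes "continuous_on {a<..} F"
  shows "set_borel_measurable borel {a<..} F"
  unfolding set_borel_measurable_def
  by (rule borel_measurable_continuous_on_indicator[OF _ assms]) auto

context smooth_step
begin

lemma S_cont: "continuous_on A S" and s_cont: "continuous_on A s"
  using S_smooth s_smooth by (auto intro: smooth_fun_continuous_on)

lemmas continuous_on_S [continuous_intros] = continuous_on_compose2[OF S_cont[of UNIV] _ subset_UNIV]
lemmas continuous_on_s [continuous_intros] = continuous_on_compose2[OF s_cont[of UNIV] _ subset_UNIV]

text \<open>The step is taken in the squared radius, so that its composition with the norm is smooth
  on the whole space, including the origin.\<close>

lemma radial_step_deriv: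
  "((\<lambda>r. S (c * (r\<^sup>2 - d))) has_real_derivative s (c * (r\<^sup>2 - d)) * (c * (2 * r))) (at r)"
  by (rule DERIV_chain2[OF S_deriv]) (auto intro!: derivative_eq_intros)

lemma kernel_0_right:
  fixes n :: nat
  assumes "a \<ge> 1" "r > a + 1" "n \<ge> 1"
  shows "s (real n * (r\<^sup>2 - a\<^sup>2)) = 0"
proof (rule s_0, rule disjI2)
  have "1 * 1 \<le> (r - a) * (r + a)" using assms by (intro mult_mono) auto
  also have "\<dots> = r\<^sup>2 - a\<^sup>2" by (simp add: power2_eq_square algebra_simps)
  finally have "1 * 1 \<le> real n * (r\<^sup>2 - a\<^sup>2)" using assms by (intro mult_mono) auto
  then show "1 \<le> real n * (r\<^sup>2 - a\<^sup>2)" by simp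
qed

lemma kernel_0_left:
  assumes "0 \<le> r" "r \<le> a"
  shows "s (real n * (r\<^sup>2 - a\<^sup>2)) = 0"
  using assms power_mono[of r a 2] by (intro s_0 disjI1 mult_nonneg_nonpos) auto

text \<open>The derivatives of the steps are an approximate identity concentrated to the right of the radius a.\<close>
lemma step_kernel_tendsto:
  assumes a: "a \<ge> 1" and f: "continuous_on {a..} f"
  shows "(\<lambda>n. LINT r:{1<..}|lborel. s (real n * (r\<^sup>2 - a\<^sup>2)) * (real n * (2 * r)) * f r) \<longlonglongrightarrow> f a"
proof (rule LIMSEQ_I)
  fix e :: real assume e: "e > 0"
  define \<kappa> where "\<kappa> = (\<lambda>n r. s (real n * (r\<^sup>2 - a\<^sup>2)) * (real n * (2 * r)))"
  obtain d where d: "d > 0" "\<And>r. r \<ge> a \<Longrightarrow> r - a < d \<Longrightarrow> \<bar>f r - f a\<bar> < e / 2"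
  proof -
    obtain d where "d > 0" "\<forall>r\<in>{a..}. dist r a < d \<longrightarrow> dist (f r) (f a) < e / 2"
      using f[unfolded continuous_on_iff, rule_format, of a "e / 2"] e by auto
    then show ?thesis by (intro that[of d]) (auto simp: dist_real_def)
  qed
  obtain n0 :: nat where n0: "n0 \<ge> 1" "1 / real n0 < d"
    using nat_approx_posE[OF d(1)] by (metis One_nat_def Suc_leI zero_less_Suc)
  show "\<exists>no. \<forall>n\<ge>no. norm ((LINT r:{1<..}|lborel. s (real n * (r\<^sup>2 - a\<^sup>2)) * (real n * (2 * r)) * f r) - f a) < e"
  proof (intro exI[of _ n0] allI impI)
    fix n assume n: "n \<ge> n0"
    have n1: "n \<ge> 1" using n n0(1) by simp
    have "1 / real n \<le> 1 / real n0" using n n0(1) by (intro divide_left_mono) auto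
    then have n2: "1 / real n < d" using n0(2) by simp
    have k0: "\<kappa> n r \<ge> 0" if "r \<ge> 0" for r unfolding \<kappa>_def using that s_nonneg by simp
    \<comment> \<open>Since r^2 - a^2 = (r - a) (r + a) and r + a is at least 1, the n-th kernel
      lives within distance 1/n of a, and 1/n is less than d.\<close>
    have far: "\<kappa> n r = 0" if "r \<ge> a + d" for r
    proof -
      have "1 / real n * 1 \<le> (r - a) * (r + a)" using a that d(1) n2 by (intro mult_mono) auto
      then have "1 \<le> real n * ((r - a) * (r + a))" using n1 by (simp add: field_simps)
      then have "s (real n * (r\<^sup>2 - a\<^sup>2)) = 0" by (intro s_0) (simp add: power2_eq_square algebra_simps)
      then show ?thesis by (simp add: \<kappa>_def)
    qed
    have kc: "continuous_on A (\<kappa> n)" for A unfolding \<kappa>_def by (intro continuous_intros)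
    have fc: "continuous_on {a..a+1} f" using f by (rule continuous_on_subset) auto
    have ik: "integrable lborel (\<lambda>r. indicator {a..a+1} r *\<^sub>R (\<kappa> n r * h r))" if "continuous_on {a..a+1} h" for h
      by (intro borel_integrable_compact continuous_intros kc that) auto
    have "((\<lambda>r. S (real n * (r\<^sup>2 - a\<^sup>2))) has_vector_derivative \<kappa> n r) (at r within {a..a+1})" for r
      using radial_step_deriv[of "real n" "a\<^sup>2" r] unfolding \<kappa>_def
      by (simp add: has_real_derivative_iff_has_vector_derivative has_vector_derivative_at_within)
    then have "(LINT r|lborel. indicator {a..a+1} r *\<^sub>R \<kappa> n r) = S (real n * ((a+1)\<^sup>2 - a\<^sup>2)) - S (real n * (a\<^sup>2 - a\<^sup>2))"
      by (intro integral_FTC_Icc kc) auto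
    also have "\<dots> = 1"
    proof -
      have "1 * 1 \<le> real n * ((a+1)\<^sup>2 - a\<^sup>2)" using a n1
        by (intro mult_mono) (auto simp: power2_eq_square algebra_simps)
      then show ?thesis using S_1 S_0[of 0] by simp
    qed
    finally have mass: "(LINT r|lborel. indicator {a..a+1} r *\<^sub>R \<kappa> n r) = 1" .
    have "(LINT r:{1<..}|lborel. \<kappa> n r * f r) = (LINT r|lborel. indicator {a..a+1} r *\<^sub>R (\<kappa> n r * f r))"
      unfolding set_lebesgue_integral_def
    proof (rule Bochner_Integration.integral_cong[OF refl])
      fix r
      have "r > a + 1 \<Longrightarrow> \<kappa> n r = 0" "0 \<le> r \<Longrightarrow> r \<le> a \<Longrightarrow> \<kappa> n r = 0"
        using kernel_0_right[OF a _ n1] kernel_0_left by (auto simp: \<kappa>_def)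
      then show "indicator {1<..} r *\<^sub>R (\<kappa> n r * f r) = indicator {a..a+1} r *\<^sub>R (\<kappa> n r * f r)"
        using a by (cases "r \<le> a"; cases "r > a + 1") (auto simp: indicator_def)
    qed
    moreover have "f a = (LINT r|lborel. indicator {a..a+1} r *\<^sub>R (\<kappa> n r * f a))"
    proof -
      have "(LINT r|lborel. indicator {a..a+1} r *\<^sub>R (\<kappa> n r * f a)) = (LINT r|lborel. (indicator {a..a+1} r *\<^sub>R \<kappa> n r) * f a)"
        by (intro Bochner_Integration.integral_cong) auto
      then show ?thesis using mass by simp
    qed
    ultimately have diff: "(LINT r:{1<..}|lborel. \<kappa> n r * f r) - f a =
       (LINT r|lborel. indicator {a..a+1} r *\<^sub>R (\<kappa> n r * f r) - indicator {a..a+1} r *\<^sub>R (\<kappa> n r * f a))"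
      by (subst Bochner_Integration.integral_diff[OF ik ik]) (auto intro: fc)
    have "norm ((LINT r:{1<..}|lborel. \<kappa> n r * f r) - f a) \<le> (LINT r|lborel. norm (indicator {a..a+1} r *\<^sub>R (\<kappa> n r * f r) - indicator {a..a+1} r *\<^sub>R (\<kappa> n r * f a)))"
      unfolding diff by (rule integral_norm_bound)
    also have "\<dots> \<le> (LINT r|lborel. indicator {a..a+1} r *\<^sub>R (\<kappa> n r * (e / 2)))"
    proof (rule integral_mono)
      show "integrable lborel (\<lambda>r. norm (indicator {a..a+1} r *\<^sub>R (\<kappa> n r * f r) - indicator {a..a+1} r *\<^sub>R (\<kappa> n r * f a)))"
        by (intro integrable_norm Bochner_Integration.integrable_diff ik fc continuous_on_const)
      show "integrable lborel (\<lambda>r. indicator {a..a+1} r *\<^sub>R (\<kappa> n r * (e / 2)))"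
        by (intro ik continuous_on_const)
      fix r
      have "\<kappa> n r * \<bar>f r - f a\<bar> \<le> \<kappa> n r * (e / 2)" if "a \<le> r"
      proof (cases "r \<ge> a + d")
        case False
        then show ?thesis using that d(2)[of r] k0[of r] a by (intro mult_left_mono) auto
      qed (simp add: far)
      moreover have "norm (\<kappa> n r * f r - \<kappa> n r * f a) = \<kappa> n r * \<bar>f r - f a\<bar>" if "a \<le> r"
        using k0[of r] that a by (simp add: right_diff_distrib[symmetric] abs_mult)
      ultimately show "norm (indicator {a..a+1} r *\<^sub>R (\<kappa> n r * f r) - indicator {a..a+1} r *\<^sub>R (\<kappa> n r * f a)) \<le>
          indicator {a..a+1} r *\<^sub>R (\<kappa> n r * (e / 2))"
        by (auto simp: indicator_def)
    qed
    also have "\<dots> = (LINT r|lborel. (indicator {a..a+1} r *\<^sub>R \<kappa> n r) * (e / 2))"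
      by (intro Bochner_Integration.integral_cong) auto
    also have "\<dots> = e / 2" using mass by simp
    finally show "norm ((LINT r:{1<..}|lborel. s (real n * (r\<^sup>2 - a\<^sup>2)) * (real n * (2 * r)) * f r) - f a) < e"
      using e by (simp add: \<kappa>_def mult.assoc)
  qed
qed

end

text \<open>Needed to replace \<Phi>(x) by its value at x/|x| near the unit sphere with an error
  proportional to |x| - 1. One factor N in the constant comes from the operator norm, the other from
  summing over the components.\<close>

lemma test_field_lipschitz:
  fixes \<Phi> :: "'a::euclidean_space \<Rightarrow> 'a"
  assumes "\<forall>i\<in>Basis. test_fun A (\<lambda>y. \<Phi> y \<bullet> i)"
  obtains L where "L \<ge> 0" "\<And>x y. norm (\<Phi> x - \<Phi> y) \<le> L * norm (x - y)"
proof -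
  obtain R B where RB: "R > 0" "B > 0" "\<And>i x. i \<in> Basis \<Longrightarrow> \<bar>\<Phi> x \<bullet> i\<bar> \<le> B"
    "\<And>i j x. i \<in> Basis \<Longrightarrow> j \<in> Basis \<Longrightarrow> \<bar>partial (\<lambda>y. \<Phi> y \<bullet> i) j x\<bar> \<le> B"
    "\<And>x. norm x > R \<Longrightarrow> \<Phi> x = 0"
    by (rule test_field_bounds[OF assms]) (rule that)
  have *: "\<bar>\<Phi> x \<bullet> i - \<Phi> y \<bullet> i\<bar> \<le> (real DIM('a) * B) * norm (x - y)" if i: "i \<in> Basis" for i x y
  proof -
    let ?f = "\<lambda>y. \<Phi> y \<bullet> i"
    have D: "(?f has_derivative frechet_derivative ?f (at z)) (at z)" for z
      using assms i by (intro has_derivative_partial test_fun_smooth) blast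
    have "norm (?f x - ?f y) \<le> (real DIM('a) * B) * norm (x - y)"
    proof (rule differentiable_bound[where S=UNIV and f'="\<lambda>z. frechet_derivative ?f (at z)"])
      fix z
      show "onorm (frechet_derivative ?f (at z)) \<le> real DIM('a) * B"
      proof (rule onorm_bound)
        fix h :: 'a
        have lin: "linear (frechet_derivative ?f (at z))" using D by (rule has_derivative_linear)
        have "frechet_derivative ?f (at z) h = frechet_derivative ?f (at z) (\<Sum>j\<in>Basis. (h \<bullet> j) *\<^sub>R j)"
          by (simp add: euclidean_representation)
        also have "\<dots> = (\<Sum>j\<in>Basis. (h \<bullet> j) * partial ?f j z)"
          by (simp add: linear_sum[OF lin] linear_scale[OF lin] partial_def)
        also have "norm \<dots> \<le> (\<Sum>j\<in>Basis. \<bar>(h \<bullet> j) * partial ?f j z\<bar>)" using sum_abs by simp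
        also have "\<dots> \<le> (\<Sum>j\<in>(Basis :: 'a set). norm h * B)"
          unfolding abs_mult using RB i by (intro sum_mono mult_mono) (auto simp: Basis_le_norm)
        finally show "norm (frechet_derivative ?f (at z) h) \<le> real DIM('a) * B * norm h" by (simp add: mult_ac)
      qed (use RB in simp)
    qed (use D in \<open>auto intro: has_derivative_at_withinI\<close>)
    then show ?thesis by simp
  qed
  show ?thesis
  proof (rule that[of "real DIM('a) * (real DIM('a) * B)"])
    fix x y
    have "norm (\<Phi> x - \<Phi> y) \<le> (\<Sum>i\<in>Basis. \<bar>(\<Phi> x - \<Phi> y) \<bullet> i\<bar>)" by (rule norm_le_l1)
    also have "\<dots> \<le> (\<Sum>i\<in>(Basis :: 'a set). (real DIM('a) * B) * norm (x - y))"
      using * by (intro sum_mono) (simp add: inner_diff_left)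
    finally show "norm (\<Phi> x - \<Phi> y) \<le> real DIM('a) * (real DIM('a) * B) * norm (x - y)" by (simp add: mult.assoc)
  qed (use RB in simp)
qed

lemma continuous_bounded_Icc:
  fixes f :: "real \<Rightarrow> real"
  assumes "continuous_on {a..b} f"
  obtains B where "B \<ge> 0" "\<And>r. a \<le> r \<Longrightarrow> r \<le> b \<Longrightarrow> \<bar>f r\<bar> \<le> B"
proof -
  have "bounded (f ` {a..b})"
    using assms by (intro compact_imp_bounded compact_continuous_image) auto
  then obtain B where "\<forall>y\<in>f ` {a..b}. norm y \<le> B" unfolding bounded_iff by blast
  then show ?thesis by (intro that[of "max B 0"]) (auto simp: le_max_iff_disj)
qed

lemma abs_inner_sgn_le: "\<bar>sgn x \<bullet> y\<bar> \<le> norm (y :: 'a::real_inner)"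
proof -
  have "\<bar>sgn x \<bullet> y\<bar> \<le> norm (sgn x) * norm y" by (rule Cauchy_Schwarz_ineq2)
  also have "\<dots> \<le> 1 * norm y" by (intro mult_right_mono) (auto simp: norm_sgn)
  finally show ?thesis by simp
qed

lemma ext_measurable_radial_continuous:
  fixes f :: "real \<Rightarrow> real"
  assumes "continuous_on {1<..} f"
  shows "(\<lambda>x. f (norm x)) \<in> borel_measurable (lebesgue_on (ext_ball :: 'a::euclidean_space set))"
  by (intro ext_measurable_radial set_borel_measurable_Ioi assms)

context smooth_step
begin

text \<open>The profile is multiplied by steps that vanish inside the unit ball, so that the
  vanishing case applies. As n grows the steps tend to 1 on the exterior domain, while the term with
  their derivative concentrates on the unit sphere and becomes the boundary integral.\<close>

lemma radial_gauss_green: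
  fixes \<Phi> :: "'a::euclidean_space \<Rightarrow> 'a"
  assumes du: "\<And>r. r > 0 \<Longrightarrow> (u has_real_derivative u' r) (at r)" and cu': "continuous_on {0<..} u'"
    and \<Phi>: "\<forall>i\<in>Basis. test_fun UNIV (\<lambda>y. \<Phi> y \<bullet> i)"
  shows "integrable (lebesgue_on ext_ball) (\<lambda>x. u (norm x) * divergence \<Phi> x + (u' (norm x) *\<^sub>R sgn x) \<bullet> \<Phi> x)"
    and "(LINT x|lebesgue_on ext_ball. u (norm x) * divergence \<Phi> x + (u' (norm x) *\<^sub>R sgn x) \<bullet> \<Phi> x)
      = sphere_int (\<lambda>x. u 1 * (\<Phi> x \<bullet> (- x)))"
proof -
  let ?M = "lebesgue_on (ext_ball :: 'a set)"
  obtain R B where RB: "R > 0" "B > 0" "\<And>i x. i \<in> Basis \<Longrightarrow> \<bar>\<Phi> x \<bullet> i\<bar> \<le> B"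
    "\<And>i j x. i \<in> Basis \<Longrightarrow> j \<in> Basis \<Longrightarrow> \<bar>partial (\<lambda>y. \<Phi> y \<bullet> i) j x\<bar> \<le> B"
    "\<And>i x. i \<in> Basis \<Longrightarrow> norm x > R \<Longrightarrow> \<Phi> x \<bullet> i = 0"
    "\<And>i j x. i \<in> Basis \<Longrightarrow> norm x > R \<Longrightarrow> partial (\<lambda>y. \<Phi> y \<bullet> i) j x = 0"
    "\<And>x. norm x > R \<Longrightarrow> \<Phi> x = 0" "\<And>x. norm x > R \<Longrightarrow> divergence \<Phi> x = 0"
    "\<And>x. norm (\<Phi> x) \<le> B" "\<And>x. \<bar>divergence \<Phi> x\<bar> \<le> B"
    by (rule test_field_bounds[OF \<Phi>]) (rule that)
  obtain L where L: "L \<ge> 0" "\<And>x y. norm (\<Phi> x - \<Phi> y) \<le> L * norm (x - y)"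
    by (rule test_field_lipschitz[OF \<Phi>]) (rule that)
  note [measurable] = test_field_borel(1,2)[OF \<Phi>]
  have cu: "continuous_on {0<..} u"
    using du by (intro continuous_at_imp_continuous_on ballI) (auto intro: DERIV_isCont)
  have cu1: "continuous_on {1<..} u" "continuous_on {1<..} u'" "continuous_on {1..} u" "continuous_on {1..} u'"
    "continuous_on {1..R} u" "continuous_on {1..R} u'"
    using cu cu' by (auto intro: continuous_on_subset)
  obtain b1 where b1: "b1 \<ge> 0" "\<And>r. 1 \<le> r \<Longrightarrow> r \<le> R \<Longrightarrow> \<bar>u r\<bar> \<le> b1"
    using continuous_bounded_Icc[OF cu1(5)] by metis
  obtain b2 where b2: "b2 \<ge> 0" "\<And>r. 1 \<le> r \<Longrightarrow> r \<le> R \<Longrightarrow> \<bar>u' r\<bar> \<le> b2"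
    using continuous_bounded_Icc[OF cu1(6)] by metis
  have mu [measurable]: "(\<lambda>x. u (norm x)) \<in> borel_measurable ?M" "(\<lambda>x. u' (norm x)) \<in> borel_measurable ?M"
    using cu1 by (auto intro: ext_measurable_radial_continuous)
  have md [measurable]: "divergence \<Phi> \<in> borel_measurable ?M" "(\<lambda>x. sgn x \<bullet> \<Phi> x) \<in> borel_measurable ?M"
  proof -
    show "divergence \<Phi> \<in> borel_measurable ?M" by (intro borel_measurable_ext_ball) measurable
    have "(\<lambda>x. (x /\<^sub>R norm x) \<bullet> \<Phi> x) \<in> borel_measurable borel" by measurable
    then show "(\<lambda>x. sgn x \<bullet> \<Phi> x) \<in> borel_measurable ?M"
      unfolding sgn_div_norm by (rule borel_measurable_ext_ball)
  qed
  define A where "A = (\<lambda>x. u (norm x) * divergence \<Phi> x + u' (norm x) * (sgn x \<bullet> \<Phi> x))"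
  have mA [measurable]: "A \<in> borel_measurable ?M" unfolding A_def by measurable
  have bA: "\<bar>A x\<bar> \<le> b1 * B + b2 * B" if "norm x > 1" for x
  proof (cases "norm x > R")
    case True
    then show ?thesis using RB b1(1) b2(1) by (simp add: A_def)
  next
    case False
    have "\<bar>u (norm x)\<bar> * \<bar>divergence \<Phi> x\<bar> \<le> b1 * B"
      using False that b1 RB by (intro mult_mono) auto
    moreover have "\<bar>u' (norm x)\<bar> * \<bar>sgn x \<bullet> \<Phi> x\<bar> \<le> b2 * B"
      using False that b2 RB order_trans[OF abs_inner_sgn_le RB(9)] by (intro mult_mono) auto
    ultimately show ?thesis unfolding A_def
      by (intro order_trans[OF abs_triangle_ineq] add_mono) (auto simp: abs_mult)
  qed
  have zA: "A x = 0" if "norm x > R" for x using RB that by (simp add: A_def)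
  have iA: "integrable ?M A" by (rule ext_integrable_bounded[OF mA bA zA])
  have A_eq: "(\<lambda>x. u (norm x) * divergence \<Phi> x + (u' (norm x) *\<^sub>R sgn x) \<bullet> \<Phi> x) = A"
    by (simp add: A_def fun_eq_iff)
  show "integrable ?M (\<lambda>x. u (norm x) * divergence \<Phi> x + (u' (norm x) *\<^sub>R sgn x) \<bullet> \<Phi> x)"
    unfolding A_eq by (rule iA)
  define X where "X = (\<lambda>(n::nat) r. S (real n * (r\<^sup>2 - 1\<^sup>2)))"
  define \<kappa> where "\<kappa> = (\<lambda>(n::nat) r. s (real n * (r\<^sup>2 - 1\<^sup>2)) * (real n * (2 * r)))"
  have Xc: "continuous_on Z (X n)" "continuous_on Z (\<kappa> n)" for n Z
    unfolding X_def \<kappa>_def by (intro continuous_intros)+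
  have [measurable]: "X n \<in> borel_measurable borel" "\<kappa> n \<in> borel_measurable borel" for n
    using Xc by (auto intro: borel_measurable_continuous_onI)
  have Xd: "(X n has_real_derivative \<kappa> n r) (at r)" for n r
    unfolding X_def \<kappa>_def by (rule radial_step_deriv)
  have X0: "X n r = 0" "\<kappa> n r = 0" if "-1 \<le> r" "r \<le> 1" for n r
  proof -
    have "r\<^sup>2 \<le> 1\<^sup>2" using that by (intro abs_le_square_iff[THEN iffD1]) auto
    then have "real n * (r\<^sup>2 - 1\<^sup>2) \<le> 0" by (intro mult_nonneg_nonpos) auto
    then show "X n r = 0" "\<kappa> n r = 0" using S_0 s_0 by (auto simp: X_def \<kappa>_def)
  qed
  \<comment> \<open>On the unit sphere \<open>q\<close> is the component of \<Phi> along x, that is,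
    minus its outward normal component.\<close>
  define q where "q = (\<lambda>y. y \<bullet> \<Phi> y)"
  have J: "(LINT x|?M. X n (norm x) * A x) + (LINT x|?M. \<kappa> n (norm x) * u (norm x) * (sgn x \<bullet> \<Phi> x)) = 0"
    and Ji: "integrable ?M (\<lambda>x. \<kappa> n (norm x) * u (norm x) * (sgn x \<bullet> \<Phi> x))" for n
  proof -
    \<comment> \<open>The cut at 1/2 removes the region where \<open>u\<close> is not known to be
      differentiable, and also the negative axis, where the step, a function of r^2, becomes nonzero
      again. Up to radius 1 the product is zero anyway, so the cut leaves no jump.\<close>
    define U where "U = (\<lambda>r. if r \<le> 1/2 then 0 else X n r * u r)"
    define U' where "U' = (\<lambda>r. if r \<le> 1/2 then 0 else \<kappa> n r * u r + X n r * u' r)"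
    have U0: "U r = 0" if "r \<le> 1" for r using that X0[of r n] by (auto simp: U_def)
    have U'0: "U' r = 0" if "r \<le> 1" for r using that X0[of r n] by (auto simp: U'_def)
    have dU: "(U has_real_derivative U' r) (at r)" for r
    proof (cases "r < 1")
      case True
      have "((\<lambda>_. 0) has_real_derivative U' r) (at r)" using U'0[of r] True by simp
      then show ?thesis
        by (rule has_field_derivative_transform_within_open[of _ _ _ "{..<1}"]) (use True U0 in auto)
    next
      case False
      have "((\<lambda>r. X n r * u r) has_real_derivative U' r) (at r)"
        using False DERIV_mult[OF Xd[of n r] du[of r]] by (simp add: U'_def mult.commute)
      then show ?thesis
        by (rule has_field_derivative_transform_within_open[of _ _ _ "{1/2<..}"]) (use False in \<open>auto simp: U_def\<close>)
    qed
    have "continuous_on ({..<1} \<union> {1/2<..}) U'"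
    proof (rule continuous_on_open_Un)
      show "continuous_on {..<1} U'"
        by (rule continuous_on_eq[of _ "\<lambda>_. 0"]) (use U'0 in auto)
      show "continuous_on {1/2<..} U'"
        by (rule continuous_on_eq[of _ "\<lambda>r. \<kappa> n r * u r + X n r * u' r"])
          (use cu cu' in \<open>auto simp: U'_def intro!: continuous_intros Xc intro: continuous_on_subset\<close>)
    qed auto
    moreover have "{..<1} \<union> {1/2<..} = (UNIV :: real set)" by auto
    ultimately have cU': "continuous_on UNIV U'" by simp
    have 0: "(LINT x|?M. U (norm x) * divergence \<Phi> x + U' (norm x) * (sgn x \<bullet> \<Phi> x)) = 0"
      by (rule ext_divergence_vanishing[OF dU cU' U0 \<Phi>])
    obtain b3 where b3: "b3 \<ge> 0" "\<And>r. 1 \<le> r \<Longrightarrow> r \<le> R \<Longrightarrow> \<bar>\<kappa> n r\<bar> \<le> b3"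
      using continuous_bounded_Icc[OF Xc(2)] by metis
    show i2: "integrable ?M (\<lambda>x. \<kappa> n (norm x) * u (norm x) * (sgn x \<bullet> \<Phi> x))"
    proof (rule ext_integrable_bounded[where R=R and B="b3 * b1 * B"])
      have [measurable]: "(\<lambda>x. \<kappa> n (norm x)) \<in> borel_measurable ?M"
        by (intro borel_measurable_ext_ball) measurable
      show "(\<lambda>x. \<kappa> n (norm x) * u (norm x) * (sgn x \<bullet> \<Phi> x)) \<in> borel_measurable ?M" by measurable
      fix x :: 'a assume x: "norm x > 1"
      show "\<bar>\<kappa> n (norm x) * u (norm x) * (sgn x \<bullet> \<Phi> x)\<bar> \<le> b3 * b1 * B"
      proof (cases "norm x > R")
        case False
        then show ?thesis unfolding abs_mult
          using x b1 b3 RB order_trans[OF abs_inner_sgn_le RB(9)] by (intro mult_mono mult_nonneg_nonneg) auto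
      qed (use RB b1 b3 in simp)
    qed (use RB in simp)
    have i1: "integrable ?M (\<lambda>x. X n (norm x) * A x)"
    proof (rule ext_integrable_bounded[where R=R and B="1 * (b1 * B + b2 * B)"])
      have [measurable]: "(\<lambda>x. X n (norm x)) \<in> borel_measurable ?M"
        by (intro borel_measurable_ext_ball) measurable
      show "(\<lambda>x. X n (norm x) * A x) \<in> borel_measurable ?M" by measurable
      show "\<bar>X n (norm x) * A x\<bar> \<le> 1 * (b1 * B + b2 * B)" if "norm x > 1" for x
        unfolding abs_mult using S_nonneg S_le_1 bA[OF that] by (intro mult_mono) (auto simp: X_def)
    qed (use zA in simp)
    have "(LINT x|?M. X n (norm x) * A x + \<kappa> n (norm x) * u (norm x) * (sgn x \<bullet> \<Phi> x)) =
      (LINT x|?M. U (norm x) * divergence \<Phi> x + U' (norm x) * (sgn x \<bullet> \<Phi> x))"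
      by (intro Bochner_Integration.integral_cong) (auto simp: A_def U_def U'_def ext_ball_def algebra_simps)
    then show "(LINT x|?M. X n (norm x) * A x) + (LINT x|?M. \<kappa> n (norm x) * u (norm x) * (sgn x \<bullet> \<Phi> x)) = 0"
      using Bochner_Integration.integral_add[OF i1 i2] 0 by simp
  qed
  have limA: "(\<lambda>n. LINT x|?M. X n (norm x) * A x) \<longlonglongrightarrow> (LINT x|?M. A x)"
  proof (rule integral_dominated_convergence[where w="\<lambda>x. norm (A x)"])
    show "(\<lambda>x. X n (norm x) * A x) \<in> borel_measurable ?M" for n
    proof -
      have [measurable]: "(\<lambda>x. X n (norm x)) \<in> borel_measurable ?M"
        by (intro borel_measurable_ext_ball) measurable
      show ?thesis by measurable
    qed
    show "AE x in ?M. (\<lambda>n. X n (norm x) * A x) \<longlonglongrightarrow> A x"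
    proof (rule AE_I2)
      fix x assume "x \<in> space ?M"
      then have x: "(norm x)\<^sup>2 - 1\<^sup>2 > 0" by (simp add: ext_ball_def)
      obtain m :: nat where m: "real m * ((norm x)\<^sup>2 - 1\<^sup>2) > 1" using reals_Archimedean3[OF x] by blast
      have "X n (norm x) * A x = A x" if "n \<ge> m" for n
      proof -
        have "real m * ((norm x)\<^sup>2 - 1\<^sup>2) \<le> real n * ((norm x)\<^sup>2 - 1\<^sup>2)"
          using that x by (intro mult_right_mono) auto
        then have "X n (norm x) = 1" unfolding X_def using m by (intro S_1) linarith
        then show ?thesis by simp
      qed
      then show "(\<lambda>n. X n (norm x) * A x) \<longlonglongrightarrow> A x"
        by (intro tendsto_eventually) (auto simp: eventually_sequentially)
    qed
    show "AE x in ?M. norm (X n (norm x) * A x) \<le> norm (A x)" for n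
      using S_nonneg S_le_1 by (auto simp: X_def abs_mult intro!: mult_left_le_one_le)
  qed (use iA in auto)
  have limJ: "(\<lambda>n. LINT x|?M. \<kappa> n (norm x) * u (norm x) * (sgn x \<bullet> \<Phi> x)) \<longlonglongrightarrow> sphere_int q * u 1"
  proof -
    let ?N = "DIM('a) - 1"
    have mq [measurable]: "(\<lambda>x. q (x /\<^sub>R norm x)) \<in> borel_measurable borel" unfolding q_def by measurable
    have qB: "\<bar>q x\<bar> \<le> R * B" for x
    proof (cases "norm x > R")
      case False
      have "\<bar>q x\<bar> \<le> norm x * norm (\<Phi> x)" unfolding q_def by (rule Cauchy_Schwarz_ineq2)
      also have "\<dots> \<le> R * B" using False RB by (intro mult_mono) auto
      finally show ?thesis .
    qed (use RB in \<open>simp add: q_def\<close>)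
    have si: "set_integrable lborel {1<..} (\<lambda>r. \<kappa> n r * h r)" if "continuous_on {1..} h" "n \<ge> 1" for n h
    proof (rule set_integrable_Ioi)
      show "continuous_on {1..2} (\<lambda>r. \<kappa> n r * h r)"
        using that by (intro continuous_intros Xc) (auto intro: continuous_on_subset)
      show "\<kappa> n r * h r = 0" if r: "r > 2" for r
        using kernel_0_right[of 1 r n] r \<open>n \<ge> 1\<close> by (simp add: \<kappa>_def)
    qed
    have sb: "set_borel_measurable borel {1<..} (\<lambda>r. \<kappa> n r * h r)" if "continuous_on {1..} h" for n h
      using that by (intro set_borel_measurable_Ioi continuous_intros Xc) (auto intro: continuous_on_subset)
    have lim: "(\<lambda>n. LINT r:{1<..}|lborel. \<kappa> n r * h r) \<longlonglongrightarrow> h 1" if "continuous_on {1..} h" for h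
      using step_kernel_tendsto[OF _ that] by (simp add: \<kappa>_def)
    have cN: "continuous_on {1..} (\<lambda>r. u r * r ^ ?N)" "continuous_on {1..} (\<lambda>r. \<bar>u r\<bar> * (L * (r - 1)))"
      "continuous_on {1..} (\<lambda>r. \<bar>u r\<bar> * (L * (r - 1)) * r ^ ?N)"
      by (intro continuous_intros cu1)+
    \<comment> \<open>\<open>D n\<close> freezes \<Phi> at the foot point x/|x|. The integrand then
      splits into an angular and a radial factor, and the kernel limit can be taken in the radial
      integral.\<close>
    define D where "D = (\<lambda>n. LINT x|?M. q (x /\<^sub>R norm x) * (\<kappa> n (norm x) * u (norm x)))"
    have D: "D n = sphere_int q * (LINT r:{1<..}|lborel. \<kappa> n r * (u r * r ^ ?N))" if "n \<ge> 1" for n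
      unfolding D_def using ext_integral_polar[OF sb[OF cu1(3)] mq qB, of n] si[OF cN(1) that]
      by (simp add: mult.assoc)
    have limD: "D \<longlonglongrightarrow> sphere_int q * u 1"
    proof -
      have "(\<lambda>n. sphere_int q * (LINT r:{1<..}|lborel. \<kappa> n r * (u r * r ^ ?N))) \<longlonglongrightarrow> sphere_int q * u 1"
        using tendsto_mult[OF tendsto_const lim[OF cN(1)], of "sphere_int q"] by simp
      then show ?thesis
        by (rule Lim_transform_eventually)
          (use D in \<open>auto simp: eventually_sequentially intro!: exI[of _ 1]\<close>)
    qed
    define K where "K = sphere_int (\<lambda>_::'a. 1)"
    \<comment> \<open>The cost of freezing: the foot point is at distance |x| - 1, so the Lipschitz
      bound puts the factor r - 1 under the kernel, and the limit at radius 1 is zero.\<close>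
    define E where "E = (\<lambda>n. K * (LINT r:{1<..}|lborel. \<kappa> n r * (\<bar>u r\<bar> * (L * (r - 1)) * r ^ ?N)))"
    have limE: "E \<longlonglongrightarrow> 0"
      unfolding E_def using tendsto_mult[OF tendsto_const lim[OF cN(3)]] by auto
    have diff: "\<bar>(LINT x|?M. \<kappa> n (norm x) * u (norm x) * (sgn x \<bullet> \<Phi> x)) - D n\<bar> \<le> E n" if n: "n \<ge> 1" for n
    proof -
      have si1: "set_integrable lborel {1<..} (\<lambda>r. (\<kappa> n r * (\<bar>u r\<bar> * (L * (r - 1)))) * r ^ ?N)"
        using si[OF cN(3) n] by (simp add: mult.assoc)
      have i3: "integrable ?M (\<lambda>x. \<kappa> n (norm x) * (\<bar>u (norm x)\<bar> * (L * (norm x - 1))))"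
        using ext_integrable_radial_iff[OF sb[OF cN(2)], of n, where 'a='a] si1 by simp
      have E: "E n = (LINT x|?M. \<kappa> n (norm x) * (\<bar>u (norm x)\<bar> * (L * (norm x - 1))))"
        using ext_integral_radial[OF sb[OF cN(2)], of n, where 'a='a] by (simp add: E_def K_def mult.assoc)
      have i4: "integrable ?M (\<lambda>x. q (x /\<^sub>R norm x) * (\<kappa> n (norm x) * u (norm x)))"
      proof (rule Bochner_Integration.integrable_bound)
        show "integrable ?M (\<lambda>x. (R * B) *\<^sub>R (\<kappa> n (norm x) * u (norm x)))"
          using ext_integrable_radial_iff[OF sb[OF cu1(3)], of n, where 'a='a] si[OF cN(1) n]
          by (intro integrable_scaleR_right) (simp add: mult.assoc)
        have "(\<lambda>x. \<kappa> n (norm x)) \<in> borel_measurable ?M" "(\<lambda>x. q (x /\<^sub>R norm x)) \<in> borel_measurable ?M"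
          by (intro borel_measurable_ext_ball; measurable)+
        then show "(\<lambda>x. q (x /\<^sub>R norm x) * (\<kappa> n (norm x) * u (norm x))) \<in> borel_measurable ?M"
          by (intro borel_measurable_times mu)
        show "AE x in ?M. norm (q (x /\<^sub>R norm x) * (\<kappa> n (norm x) * u (norm x))) \<le> norm ((R * B) *\<^sub>R (\<kappa> n (norm x) * u (norm x)))"
        proof (rule AE_I2)
          fix x
          have "\<bar>q (x /\<^sub>R norm x)\<bar> \<le> \<bar>R * B\<bar>" using qB[of "x /\<^sub>R norm x"] by linarith
          then show "norm (q (x /\<^sub>R norm x) * (\<kappa> n (norm x) * u (norm x))) \<le> norm ((R * B) *\<^sub>R (\<kappa> n (norm x) * u (norm x)))"
            using mult_right_mono[of "\<bar>q (x /\<^sub>R norm x)\<bar>" "\<bar>R * B\<bar>" "\<bar>\<kappa> n (norm x) * u (norm x)\<bar>"]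
            by (simp add: abs_mult)
        qed
      qed
      have "(LINT x|?M. \<kappa> n (norm x) * u (norm x) * (sgn x \<bullet> \<Phi> x)) - D n =
        (LINT x|?M. \<kappa> n (norm x) * u (norm x) * (sgn x \<bullet> \<Phi> x) - q (x /\<^sub>R norm x) * (\<kappa> n (norm x) * u (norm x)))"
        unfolding D_def by (rule Bochner_Integration.integral_diff[OF Ji i4, symmetric])
      moreover have "norm (LINT x|?M. \<kappa> n (norm x) * u (norm x) * (sgn x \<bullet> \<Phi> x) - q (x /\<^sub>R norm x) * (\<kappa> n (norm x) * u (norm x)))
        \<le> E n" unfolding E
      proof (rule order_trans[OF integral_norm_bound integral_mono])
        fix x assume "x \<in> space ?M"
        then have x: "norm x > 1" by (simp add: ext_ball_def)
        then have x0: "x \<noteq> 0" by auto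
        have sx: "x /\<^sub>R norm x = sgn x" by (simp add: sgn_div_norm)
        have "x - sgn x = (norm x - 1) *\<^sub>R sgn x"
        proof -
          have "norm x *\<^sub>R sgn x = x" using x0 by (simp add: sgn_div_norm)
          then show ?thesis by (simp add: scaleR_left_diff_distrib)
        qed
        then have nx: "norm (x - sgn x) = norm x - 1" using x x0 by (simp add: norm_sgn)
        have "\<kappa> n (norm x) * u (norm x) * (sgn x \<bullet> \<Phi> x) - q (x /\<^sub>R norm x) * (\<kappa> n (norm x) * u (norm x)) =
          \<kappa> n (norm x) * u (norm x) * (sgn x \<bullet> (\<Phi> x - \<Phi> (sgn x)))"
          unfolding sx q_def by (simp add: inner_diff_right algebra_simps)
        also have "norm (\<kappa> n (norm x) * u (norm x) * (sgn x \<bullet> (\<Phi> x - \<Phi> (sgn x)))) =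
           \<kappa> n (norm x) * (\<bar>u (norm x)\<bar> * \<bar>sgn x \<bullet> (\<Phi> x - \<Phi> (sgn x))\<bar>)"
          using s_nonneg by (simp add: abs_mult \<kappa>_def)
        also have "\<dots> \<le> \<kappa> n (norm x) * (\<bar>u (norm x)\<bar> * (L * (norm x - 1)))"
          using s_nonneg order_trans[OF abs_inner_sgn_le[of x "\<Phi> x - \<Phi> (sgn x)"] L(2)[of x "sgn x"]]
          by (intro mult_left_mono) (auto simp: \<kappa>_def nx)
        finally show "norm (\<kappa> n (norm x) * u (norm x) * (sgn x \<bullet> \<Phi> x) - q (x /\<^sub>R norm x) * (\<kappa> n (norm x) * u (norm x)))
          \<le> \<kappa> n (norm x) * (\<bar>u (norm x)\<bar> * (L * (norm x - 1)))" .
      qed (use Ji i4 i3 in \<open>auto intro!: integrable_norm Bochner_Integration.integrable_diff\<close>)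
      ultimately show ?thesis by simp
    qed
    have "(\<lambda>n. (LINT x|?M. \<kappa> n (norm x) * u (norm x) * (sgn x \<bullet> \<Phi> x)) - D n) \<longlonglongrightarrow> 0"
      by (rule Lim_null_comparison[OF _ limE]) (use diff in \<open>auto simp: eventually_sequentially intro!: exI[of _ 1]\<close>)
    from tendsto_add[OF this limD] show ?thesis by simp
  qed
  have "(\<lambda>n. LINT x|?M. X n (norm x) * A x) \<longlonglongrightarrow> - (sphere_int q * u 1)"
  proof -
    have "(\<lambda>n. LINT x|?M. X n (norm x) * A x) = (\<lambda>n. - (LINT x|?M. \<kappa> n (norm x) * u (norm x) * (sgn x \<bullet> \<Phi> x)))"
      using J by (simp add: fun_eq_iff eq_neg_iff_add_eq_0)
    then show ?thesis using tendsto_minus[OF limJ] by simp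
  qed
  then have "(LINT x|?M. A x) = - (sphere_int q * u 1)" using limA LIMSEQ_unique by blast
  moreover have "sphere_int (\<lambda>x. u 1 * (\<Phi> x \<bullet> (- x))) = - (sphere_int q * u 1)"
    by (simp add: sphere_int_def q_def inner_commute)
  ultimately show "(LINT x|?M. u (norm x) * divergence \<Phi> x + (u' (norm x) *\<^sub>R sgn x) \<bullet> \<Phi> x)
      = sphere_int (\<lambda>x. u 1 * (\<Phi> x \<bullet> (- x)))" unfolding A_eq by simp
qed

end

section \<open>Cutoffs and radial Sobolev functions as admissible tests\<close>

lemma test_fun_mono: "test_fun A \<psi> \<Longrightarrow> A \<subseteq> B \<Longrightarrow> test_fun B \<psi>"
  by (auto simp: test_fun_def)

lemma test_fun_mult:
  fixes \<psi> \<eta> :: "'a::euclidean_space \<Rightarrow> real"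
  assumes "test_fun A \<psi>" "smooth_fun \<eta>"
  shows "test_fun A (\<lambda>x. \<psi> x * \<eta> x)"
proof -
  have sub: "supp_closure (\<lambda>x. \<psi> x * \<eta> x) \<subseteq> supp_closure \<psi>"
    unfolding supp_closure_def by (rule closure_mono) auto
  have "closed (supp_closure (\<lambda>x. \<psi> x * \<eta> x))" by (simp add: supp_closure_def)
  then have "compact (supp_closure (\<lambda>x. \<psi> x * \<eta> x))"
    using assms(1) sub by (metis compact_Int_closed inf.absorb_iff2 test_fun_def)
  then show ?thesis using assms sub unfolding test_fun_def by (auto intro: smooth_fun_mult)
qed

lemma test_funI:
  fixes \<psi> :: "'a::euclidean_space \<Rightarrow> real"
  assumes "smooth_fun \<psi>" "closed C" "bounded C" "C \<subseteq> A" "\<And>x. x \<notin> C \<Longrightarrow> \<psi> x = 0"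
  shows "test_fun A \<psi>"
proof -
  have sub: "supp_closure \<psi> \<subseteq> C"
    unfolding supp_closure_def using assms(2,5) by (intro closure_minimal) auto
  moreover have "compact (supp_closure \<psi>)"
    using sub assms(2,3) by (metis bounded_subset closed_closure compact_eq_bounded_closed supp_closure_def)
  ultimately show ?thesis using assms(1,4) by (auto simp: test_fun_def)
qed

lemma test_fun_outside: "test_fun A \<psi> \<Longrightarrow> x \<notin> A \<Longrightarrow> \<psi> x = 0"
  using closure_subset[of "{x. \<psi> x \<noteq> 0}"] by (auto simp: test_fun_def supp_closure_def)

text \<open>Turns a scalar test function into a field pointing in one coordinate direction, so that
  the scalar definition of the weak gradient becomes a case of the Gauss--Green formula.\<close>

lemma test_field_basis:
  fixes \<psi> :: "'a::euclidean_space \<Rightarrow> real"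
  assumes \<psi>: "test_fun A \<psi>" and i: "i \<in> Basis"
  shows "\<forall>j\<in>Basis. test_fun A (\<lambda>y. (\<psi> y *\<^sub>R i) \<bullet> j)" "divergence (\<lambda>y. \<psi> y *\<^sub>R i) = partial \<psi> i"
proof -
  show "\<forall>j\<in>Basis. test_fun A (\<lambda>y. (\<psi> y *\<^sub>R i) \<bullet> j)"
    using test_fun_mult[OF \<psi> smooth_fun_const] by simp
  show "divergence (\<lambda>y. \<psi> y *\<^sub>R i) = partial \<psi> i"
  proof (rule ext)
    fix x
    have D: "(\<psi> has_derivative frechet_derivative \<psi> (at x)) (at x)"
      by (intro has_derivative_partial test_fun_smooth[OF \<psi>])
    have "partial (\<lambda>y. (\<psi> y *\<^sub>R i) \<bullet> j) j x = (if j = i then partial \<psi> i x else 0)" if "j \<in> Basis" for j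
    proof -
      have "((\<lambda>y. \<psi> y * (i \<bullet> j)) has_derivative (\<lambda>h. frechet_derivative \<psi> (at x) h * (i \<bullet> j))) (at x)"
        by (rule has_derivative_mult_left[OF D])
      then show ?thesis using partial_eq i that by (fastforce simp: partial_def inner_Basis)
    qed
    then have "divergence (\<lambda>y. \<psi> y *\<^sub>R i) x = (\<Sum>j\<in>Basis. if j = i then partial \<psi> i x else 0)"
      unfolding divergence_def by (intro sum.cong) auto
    then show "divergence (\<lambda>y. \<psi> y *\<^sub>R i) x = partial \<psi> i x" using i by simp
  qed
qed

lemma ext_integrable_dominated:
  fixes h w :: "'a::euclidean_space \<Rightarrow> real"
  assumes h: "h \<in> borel_measurable (lebesgue_on ext_ball)" and w: "integrable (lebesgue_on ext_ball) w"
    and b: "\<And>x. norm x > 1 \<Longrightarrow> \<bar>h x\<bar> \<le> B + w x" and z: "\<And>x. norm x > 1 \<Longrightarrow> norm x > R \<Longrightarrow> h x = 0"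
  shows "integrable (lebesgue_on ext_ball) h"
proof (rule Bochner_Integration.integrable_bound)
  show "integrable (lebesgue_on ext_ball) (\<lambda>x. \<bar>B\<bar> * indicator (cball 0 R) x + \<bar>w x\<bar>)"
  proof (intro Bochner_Integration.integrable_add integrable_abs w)
    show "integrable (lebesgue_on ext_ball) (\<lambda>x. \<bar>B\<bar> * indicator (cball (0::'a) R) x)"
      by (rule ext_integrable_bounded[where B="\<bar>B\<bar>" and R=R])
        (auto simp: indicator_def intro!: borel_measurable_ext_ball)
  qed
  show "AE x in lebesgue_on ext_ball. norm (h x) \<le> norm (\<bar>B\<bar> * indicator (cball 0 R) x + \<bar>w x\<bar>)"
  proof (rule AE_I2)
    fix x :: 'a assume "x \<in> space (lebesgue_on ext_ball)"
    then have x: "norm x > 1" by (simp add: ext_ball_def)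
    show "norm (h x) \<le> norm (\<bar>B\<bar> * indicator (cball 0 R) x + \<bar>w x\<bar>)"
      using b[OF x] z[OF x] by (cases "norm x > R") (auto simp: indicator_def)
  qed
qed (rule h)

context smooth_step
begin

text \<open>A test function supported in the open exterior domain vanishes on the unit sphere, so
  the boundary term of the Gauss--Green formula drops out.\<close>

lemma radial_weak_grad:
  assumes du: "\<And>r. r > 0 \<Longrightarrow> (u has_real_derivative u' r) (at r)" and cu': "continuous_on {0<..} u'"
  shows "weak_grad ext_ball (\<lambda>x::'a::euclidean_space. u (norm x)) (\<lambda>x. u' (norm x) *\<^sub>R sgn x)"
  unfolding weak_grad_def
proof (intro allI impI ballI)
  fix \<psi> :: "'a \<Rightarrow> real" and i :: 'a
  assume \<psi>: "test_fun ext_ball \<psi>" and i: "i \<in> Basis"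
  let ?M = "lebesgue_on (ext_ball :: 'a set)"
  let ?\<Phi> = "\<lambda>y. \<psi> y *\<^sub>R i"
  note \<psi>U = test_fun_mono[OF \<psi> subset_UNIV]
  have \<Phi>: "\<forall>j\<in>Basis. test_fun UNIV (\<lambda>y. ?\<Phi> y \<bullet> j)" using test_field_basis(1)[OF \<psi>U i] .
  note div = test_field_basis(2)[OF \<psi> i]
  obtain R B where RB: "R > 0" "B > 0" "\<And>x. \<bar>\<psi> x\<bar> \<le> B" "\<And>i x. i \<in> Basis \<Longrightarrow> \<bar>partial \<psi> i x\<bar> \<le> B"
    "\<And>x. norm x > R \<Longrightarrow> \<psi> x = 0" "\<And>i x. norm x > R \<Longrightarrow> partial \<psi> i x = 0"
    by (rule test_fun_bounds[OF \<psi>]) (rule that)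
  have cu: "continuous_on {0<..} u"
    using du by (intro continuous_at_imp_continuous_on ballI) (auto intro: DERIV_isCont)
  have cu1: "continuous_on {1<..} u" "continuous_on {1..R} u"
    using cu by (auto intro: continuous_on_subset)
  obtain b1 where b1: "b1 \<ge> 0" "\<And>r. 1 \<le> r \<Longrightarrow> r \<le> R \<Longrightarrow> \<bar>u r\<bar> \<le> b1"
    using continuous_bounded_Icc[OF cu1(2)] by metis
  have i1: "integrable ?M (\<lambda>x. u (norm x) * partial \<psi> i x)"
  proof (rule ext_integrable_bounded[where R=R and B="b1 * B"])
    show "(\<lambda>x. u (norm x) * partial \<psi> i x) \<in> borel_measurable ?M"
      by (intro borel_measurable_times ext_measurable_radial_continuous cu1 borel_measurable_ext_ball test_fun_partial_borel[OF \<psi> i])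
    show "\<bar>u (norm x) * partial \<psi> i x\<bar> \<le> b1 * B" if "norm x > 1" for x
      using that RB i b1 by (cases "norm x > R") (auto simp: abs_mult intro!: mult_mono)
  qed (use RB in simp)
  have eq: "(LINT x|?M. u (norm x) * partial \<psi> i x + (u' (norm x) *\<^sub>R sgn x) \<bullet> (\<psi> x *\<^sub>R i)) = 0"
    and i2: "integrable ?M (\<lambda>x. u (norm x) * partial \<psi> i x + (u' (norm x) *\<^sub>R sgn x) \<bullet> (\<psi> x *\<^sub>R i))"
  proof -
    have "\<psi> (x /\<^sub>R norm x) = 0" for x
      using test_fun_outside[OF \<psi>, of "x /\<^sub>R norm x"] by (cases "x = 0") (auto simp: ext_ball_def)
    then have "sphere_int (\<lambda>x. u 1 * ((\<psi> x *\<^sub>R i) \<bullet> (- x))) = 0"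
      by (simp add: sphere_int_def)
    then show "(LINT x|?M. u (norm x) * partial \<psi> i x + (u' (norm x) *\<^sub>R sgn x) \<bullet> (\<psi> x *\<^sub>R i)) = 0"
      using radial_gauss_green(2)[OF du cu' \<Phi>] by (simp add: div)
    show "integrable ?M (\<lambda>x. u (norm x) * partial \<psi> i x + (u' (norm x) *\<^sub>R sgn x) \<bullet> (\<psi> x *\<^sub>R i))"
      using radial_gauss_green(1)[OF du cu' \<Phi>] by (simp add: div)
  qed
  have "(LINT x|?M. (u' (norm x) *\<^sub>R sgn x) \<bullet> i * \<psi> x) =
    (LINT x|?M. (u (norm x) * partial \<psi> i x + (u' (norm x) *\<^sub>R sgn x) \<bullet> (\<psi> x *\<^sub>R i)) - u (norm x) * partial \<psi> i x)"
    by (intro Bochner_Integration.integral_cong) auto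
  also have "\<dots> = - (LINT x|?M. u (norm x) * partial \<psi> i x)"
    using Bochner_Integration.integral_diff[OF i2 i1] eq by simp
  finally show "(LINT x|?M. u (norm x) * partial \<psi> i x) = - (LINT x|?M. (u' (norm x) *\<^sub>R sgn x) \<bullet> i * \<psi> x)" by simp
qed

lemma radial_trace_ext:
  assumes du: "\<And>r. r > 0 \<Longrightarrow> (u has_real_derivative u' r) (at r)" and cu': "continuous_on {0<..} u'"
  shows "trace_ext q (\<lambda>x::'a::euclidean_space. u (norm x)) (\<lambda>x. u' (norm x) *\<^sub>R sgn x) (\<lambda>_. u 1)"
  unfolding trace_ext_def
  using radial_gauss_green(2)[OF du cu', where 'a='a] 
    sphere_integrable_bounded[of "\<lambda>_::'a. \<bar>u 1\<bar> powr q" "\<bar>u 1\<bar> powr q"] by simp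

lemma radial_W1p_grad:
  assumes du: "\<And>r. r > 0 \<Longrightarrow> (u has_real_derivative u' r) (at r)" and cu': "continuous_on {0<..} u'"
    and z: "\<And>r. r > b \<Longrightarrow> u r = 0" "\<And>r. r > b \<Longrightarrow> u' r = 0" and q: "q > 0"
  shows "W1p_grad q ext_ball (\<lambda>x::'a::euclidean_space. u (norm x)) (\<lambda>x. u' (norm x) *\<^sub>R sgn x)"
proof -
  let ?M = "lebesgue_on (ext_ball :: 'a set)"
  have cu: "continuous_on {0<..} u"
    using du by (intro continuous_at_imp_continuous_on ballI) (auto intro: DERIV_isCont)
  have c: "continuous_on {1<..} u" "continuous_on {1<..} u'" "continuous_on {1..b} u" "continuous_on {1..b} u'"
    using cu cu' by (auto intro: continuous_on_subset)
  have m [measurable]: "(\<lambda>x. u (norm x)) \<in> borel_measurable ?M" "(\<lambda>x. u' (norm x)) \<in> borel_measurable ?M"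
    using c by (auto intro: ext_measurable_radial_continuous)
  obtain b1 where b1: "b1 \<ge> 0" "\<And>r. 1 \<le> r \<Longrightarrow> r \<le> b \<Longrightarrow> \<bar>u r\<bar> \<le> b1"
    using continuous_bounded_Icc[OF c(3)] by metis
  obtain b2 where b2: "b2 \<ge> 0" "\<And>r. 1 \<le> r \<Longrightarrow> r \<le> b \<Longrightarrow> \<bar>u' r\<bar> \<le> b2"
    using continuous_bounded_Icc[OF c(4)] by metis
  have sg: "(\<lambda>x::'a. sgn x) \<in> borel_measurable ?M"
    unfolding sgn_div_norm by (intro borel_measurable_ext_ball) measurable
  have "integrable ?M (\<lambda>x. \<bar>u (norm x)\<bar> powr q)"
  proof (rule ext_integrable_bounded[where R=b and B="b1 powr q"])
    show "\<bar>\<bar>u (norm x)\<bar> powr q\<bar> \<le> b1 powr q" if "norm x > 1" for x :: 'a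
      using that b1 q z by (cases "norm x > b") (auto intro!: powr_mono2)
  qed (use z q in auto)
  moreover have "integrable ?M (\<lambda>x. norm (u' (norm x) *\<^sub>R sgn x) powr q)"
  proof (rule ext_integrable_bounded[where R=b and B="b2 powr q"])
    show "(\<lambda>x. norm (u' (norm x) *\<^sub>R sgn x) powr q) \<in> borel_measurable ?M" using sg by measurable
    show "\<bar>norm (u' (norm x) *\<^sub>R sgn x) powr q\<bar> \<le> b2 powr q" if "norm x > 1" for x :: 'a
      using that b2 q z by (cases "norm x > b") (auto intro!: powr_mono2 simp: norm_sgn)
  qed (use z q in auto)
  moreover have "(\<lambda>x. u' (norm x) *\<^sub>R sgn x) \<in> borel_measurable ?M" using sg by measurable
  ultimately show ?thesis
    unfolding W1p_grad_def Lp_on_def using radial_weak_grad[OF du cu'] m(1) by simp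
qed

end

text \<open>Fubini for the kernel that is 1 where \<alpha> x < \<gamma> y and 0 elsewhere. This is
  how the mass inside a radius, and with it \<open>k\<close>, is exchanged with integrals over the
  part outside a radius.\<close>

lemma fubini_level_sets:
  fixes F :: "'a \<Rightarrow> real" and H :: "'b \<Rightarrow> real" and \<alpha> :: "'a \<Rightarrow> real" and \<gamma> :: "'b \<Rightarrow> real"
  assumes "sigma_finite_measure M" "sigma_finite_measure N"
    and F: "integrable M F" and H: "integrable N H"
    and [measurable]: "\<alpha> \<in> borel_measurable M" "\<gamma> \<in> borel_measurable N"
  shows "(LINT x|M. F x * (LINT y|N. indicator {\<alpha> x<..} (\<gamma> y) * H y)) =
         (LINT y|N. H y * (LINT x|M. indicator {..<\<gamma> y} (\<alpha> x) * F x))"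
proof -
  interpret M: sigma_finite_measure M by fact
  interpret N: sigma_finite_measure N by fact
  interpret pair_sigma_finite M N ..
  have [measurable]: "F \<in> borel_measurable M" "H \<in> borel_measurable N" using F H by auto
  \<comment> \<open>The kernel is written as a set indicator of the difference \<gamma> y - \<alpha>
    x, which makes its joint measurability evident.\<close>
  define E where "E = (\<lambda>x y. indicator {z. 0 < z} (\<gamma> y - \<alpha> x) * (F x * H y))"
  have mE [measurable]: "case_prod E \<in> borel_measurable (M \<Otimes>\<^sub>M N)"
    unfolding E_def by measurable
  have "integrable (M \<Otimes>\<^sub>M N) (case_prod E)"
  proof (rule Bochner_Integration.integrable_bound)
    show "integrable (M \<Otimes>\<^sub>M N) (\<lambda>(x, y). F x * H y)"
    proof (rule Fubini_integrable)
      show "integrable M (\<lambda>x. LINT y|N. norm (case (x, y) of (x, y) \<Rightarrow> F x * H y))"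
        using F H by (simp add: abs_mult)
    qed (use H in auto)
    show "AE z in M \<Otimes>\<^sub>M N. norm (case_prod E z) \<le> norm (case z of (x, y) \<Rightarrow> F x * H y)"
      by (auto simp: E_def indicator_def abs_mult)
  qed measurable
  then have "(LINT y|N. LINT x|M. E x y) = (LINT x|M. LINT y|N. E x y)" by (rule Fubini_integral)
  moreover have "(LINT y|N. E x y) = F x * (LINT y|N. indicator {\<alpha> x<..} (\<gamma> y) * H y)" for x
  proof -
    have "(LINT y|N. E x y) = (LINT y|N. F x * (indicator {\<alpha> x<..} (\<gamma> y) * H y))"
      by (intro Bochner_Integration.integral_cong) (auto simp: E_def indicator_def)
    then show ?thesis by simp
  qed
  moreover have "(LINT x|M. E x y) = H y * (LINT x|M. indicator {..<\<gamma> y} (\<alpha> x) * F x)" for y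
  proof -
    have "(LINT x|M. E x y) = (LINT x|M. H y * (indicator {..<\<gamma> y} (\<alpha> x) * F x))"
      by (intro Bochner_Integration.integral_cong) (auto simp: E_def indicator_def)
    then show ?thesis by simp
  qed
  ultimately show ?thesis by simp
qed

lemma sigma_finite_ext_ball: "sigma_finite_measure (lebesgue_on (ext_ball :: 'a::euclidean_space set))"
proof
  let ?A = "range (\<lambda>n. ext_ball \<inter> cball (0::'a) (real n))"
  have "emeasure (lebesgue_on ext_ball) (ext_ball \<inter> cball (0::'a) R) \<noteq> \<infinity>" for R
  proof -
    have "emeasure (lebesgue_on ext_ball) (ext_ball \<inter> cball (0::'a) R) = emeasure lebesgue (ext_ball \<inter> cball (0::'a) R)"
      by (rule emeasure_restrict_space) auto
    also have "\<dots> \<le> emeasure lebesgue (cball (0::'a) R)"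
      by (rule emeasure_mono) auto
    also have "\<dots> < \<infinity>" using emeasure_bounded_finite[of "cball (0::'a) R"] by (simp add: less_top)
    finally show ?thesis by simp
  qed
  moreover have "\<Union>?A = space (lebesgue_on ext_ball)"
    using real_arch_simple by auto
  moreover have "?A \<subseteq> sets (lebesgue_on ext_ball)" by (auto simp: sets_restrict_space_iff)
  ultimately show "\<exists>A. countable A \<and> A \<subseteq> sets (lebesgue_on (ext_ball :: 'a set)) \<and> \<Union>A = space (lebesgue_on ext_ball) \<and>
      (\<forall>a\<in>A. emeasure (lebesgue_on ext_ball) a \<noteq> \<infinity>)"
    by (intro exI[of _ ?A]) auto
qed

text \<open>At x = 0 both sides are 0 because \<open>powr\<close> with base 0 gives 0 for every
  exponent. With this default the field |x|^(p-2) x takes the right value at the origin also for p <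
  2.\<close>

lemma norm_powr_mult_self:
  assumes "(p::real) > 1"
  shows "norm x powr (p - 2) * norm x = norm (x::'a::real_normed_vector) powr (p - 1)"
    "norm x powr (p - 2) * (norm x)\<^sup>2 = norm x powr p"
proof -
  show 1: "norm x powr (p - 2) * norm x = norm x powr (p - 1)"
    by (cases "x = 0") (auto simp: powr_diff power2_eq_square)
  have "norm x powr (p - 1) * norm x = norm x powr p"
    by (cases "x = 0") (use assms in \<open>auto simp: powr_diff\<close>)
  then show "norm x powr (p - 2) * (norm x)\<^sup>2 = norm x powr p"
    using 1 by (simp add: power2_eq_square mult.assoc[symmetric])
qed

text \<open>By Cauchy--Schwarz the product is at least the product of the differences of the (p - 1)-st and the first
  powers of the norms.\<close>
lemma p_monotone:
  fixes x y :: "'a::real_inner"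
  assumes p: "p > 1"
  shows "((norm x powr (p - 2)) *\<^sub>R x - (norm y powr (p - 2)) *\<^sub>R y) \<bullet> (x - y) \<ge> 0" (is "?L \<ge> 0")
    and "((norm x powr (p - 2)) *\<^sub>R x - (norm y powr (p - 2)) *\<^sub>R y) \<bullet> (x - y) = 0 \<Longrightarrow> x = y"
proof -
  define a b where "a = norm x" and "b = norm y"
  \<comment> \<open>The inner product splits as c + d, where c carries the defect in Cauchy--Schwarz
    and d expresses that t^(p-1) is increasing in t. Both are nonnegative.\<close>
  define c where "c = (a powr (p-2) + b powr (p-2)) * (a * b - x \<bullet> y)"
  define d where "d = (a powr (p-1) - b powr (p-1)) * (a - b)"
  have a: "a powr (p-2) * a = a powr (p-1)" "a powr (p-2) * (x \<bullet> x) = a powr (p-1) * a"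
    using norm_powr_mult_self(1)[OF p, of x] by (simp_all add: a_def dot_square_norm power2_eq_square mult.assoc[symmetric])
  have b: "b powr (p-2) * b = b powr (p-1)" "b powr (p-2) * (y \<bullet> y) = b powr (p-1) * b"
    using norm_powr_mult_self(1)[OF p, of y] by (simp_all add: b_def dot_square_norm power2_eq_square mult.assoc[symmetric])
  have "?L = a powr (p-2) * (x \<bullet> x) + b powr (p-2) * (y \<bullet> y) - (a powr (p-2) + b powr (p-2)) * (x \<bullet> y)"
    by (simp add: a_def b_def inner_diff_left inner_diff_right inner_commute algebra_simps)
  also have "\<dots> = c + (a powr (p-1) * a + b powr (p-1) * b - (a powr (p-2) * a) * b - (b powr (p-2) * b) * a)"
    unfolding a(2) b(2) c_def by (simp add: algebra_simps)
  also have "\<dots> = c + d" unfolding a(1) b(1) d_def by (simp add: algebra_simps)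
  finally have L: "?L = c + d" .
  have c0: "c \<ge> 0" unfolding c_def using norm_cauchy_schwarz[of x y] by (simp add: a_def b_def)
  have d0: "d \<ge> 0" and d1: "d = 0 \<Longrightarrow> a = b"
  proof -
    have "a = b \<or> d > 0"
    proof (cases a b rule: linorder_cases)
      case less
      then have "a powr (p-1) < b powr (p-1)" using p by (intro powr_less_mono2) (auto simp: a_def)
      then show ?thesis using less by (simp add: d_def mult_neg_neg)
    next
      case greater
      then have "b powr (p-1) < a powr (p-1)" using p by (intro powr_less_mono2) (auto simp: b_def)
      then show ?thesis using greater by (simp add: d_def)
    qed auto
    then show "d \<ge> 0" "d = 0 \<Longrightarrow> a = b" by (auto simp: d_def)
  qed
  show "?L \<ge> 0" using L c0 d0 by simp
  assume "?L = 0"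
  then have "c = 0" "d = 0" using L c0 d0 by linarith+
  then have ab: "a = b" using d1 by simp
  show "x = y"
  proof (cases "x = 0")
    case True
    then show ?thesis using ab by (simp add: a_def b_def)
  next
    case False
    then have "a powr (p-2) > 0" by (simp add: a_def)
    \<comment> \<open>Equality in Cauchy--Schwarz together with equal norms forces the vectors to
      coincide.\<close>
    then have "x \<bullet> y = a * b" using \<open>c = 0\<close> unfolding c_def ab by simp
    then have "(norm (x - y))\<^sup>2 = 0"
      using ab by (simp add: power2_norm_eq_inner inner_diff_left inner_diff_right inner_commute)
        (simp add: dot_square_norm a_def b_def power2_eq_square)
    then show ?thesis by simp
  qed
qed

section \<open>Reduction of the eigenvalue problem to an ordinary differential equation\<close>

lemma antiderivative_exists:
  fixes h :: "real \<Rightarrow> real"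
  assumes "continuous_on UNIV h"
  obtains W where "\<And>t. t > 0 \<Longrightarrow> (W has_real_derivative h t) (at t)"
proof -
  have "((\<lambda>t. integral {0..t} h) has_real_derivative h t) (at t)" if t: "t > 0" for t
  proof -
    have "((\<lambda>t. integral {0..t} h) has_vector_derivative h t) (at t within {0..t+1})"
      using t by (intro integral_has_vector_derivative continuous_on_subset[OF assms]) auto
    then have "((\<lambda>t. integral {0..t} h) has_vector_derivative h t) (at t)"
      using t by (metis at_within_Icc_at less_add_one)
    then show ?thesis by (simp add: has_real_derivative_iff_has_vector_derivative)
  qed
  then show ?thesis by (rule that)
qed

text \<open>Only the function \<phi> is assumed to have a radial profile; its weak gradient
  \<open>G\<close> and its trace \<open>T\<close> are arbitrary representatives for which the weak
  equation holds. \<open>lam\<close> is any real number here: its sign is a consequence of the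
  equation, derived further below.\<close>

locale radial_robin = smooth_step S s for S s +
  fixes p \<beta> lam C\<^sub>0 :: real and g \<phi> :: "'a::euclidean_space \<Rightarrow> real" and f :: "real \<Rightarrow> real"
    and G :: "'a \<Rightarrow> 'a" and T :: "'a \<Rightarrow> real"
  assumes p1: "1 < p"
    and g_meas: "g \<in> borel_measurable (lebesgue_on ext_ball)"
    and g_pos: "\<And>x. norm x > 1 \<Longrightarrow> 0 < g x" and g_le: "\<And>x. norm x > 1 \<Longrightarrow> g x \<le> C\<^sub>0"
    and W1p: "W1p_grad p ext_ball \<phi> G" and trace: "trace_ext p \<phi> G T"
    and weak: "\<And>v Gv Tv. W1p_grad p ext_ball v Gv \<Longrightarrow> trace_ext p v Gv Tv \<Longrightarrow>
          (LINT x|lebesgue_on ext_ball. norm (G x) powr (p - 2) * (G x \<bullet> Gv x))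
          + \<beta> * sphere_int (\<lambda>x. \<bar>T x\<bar> powr (p - 2) * T x * Tv x)
          = lam * (LINT x|lebesgue_on ext_ball. g x * \<bar>\<phi> x\<bar> powr (p - 2) * \<phi> x * v x)"
    and f_cont: "continuous_on {1..} f" and f_pos: "\<And>r. r > 1 \<Longrightarrow> f r > 0"
    and phi_eq: "\<And>x. norm x > 1 \<Longrightarrow> \<phi> x = f (norm x)"
begin

abbreviation M :: "'a measure" where "M \<equiv> lebesgue_on ext_ball"

definition K :: real where "K = sphere_int (\<lambda>_::'a. 1)"
text \<open>A radial test function has a constant trace, so the Robin term sees the trace of \<phi>
  only through this single number.\<close>

definition \<tau> :: real where "\<tau> = sphere_int (\<lambda>x. \<bar>T x\<bar> powr (p - 2) * T x)"
definition Q :: "'a \<Rightarrow> real" where "Q x = g x * \<bar>\<phi> x\<bar> powr (p - 2) * \<phi> x"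

text \<open>Up to the factor K, the radial flux through the sphere of radius t.\<close>
definition k :: "real \<Rightarrow> real" where "k t = \<beta> * \<tau> - lam * (LINT x|M. indicator {..<t} (norm x) * Q x)"

lemma K_pos: "K > 0" unfolding K_def by (rule sphere_area_pos)

lemma f_nonneg: "r \<ge> 1 \<Longrightarrow> f r \<ge> 0"
proof -
  have "f r \<ge> 0" if "r \<in> closure {1<..}" for r
    by (rule continuous_ge_on_closure[OF _ that]) (use f_cont f_pos in \<open>auto intro: less_imp_le\<close>)
  then show "r \<ge> 1 \<Longrightarrow> f r \<ge> 0" by simp
qed

lemma f_cont_subset: "A \<subseteq> {1..} \<Longrightarrow> continuous_on A f"
  using f_cont by (rule continuous_on_subset)

text \<open>Freezing the profile at radius 1 gives functions continuous on the whole line, the form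
  in which radial weights are fed into \<open>radial_flux\<close> and into the fundamental theorem
  of calculus.\<close>

lemma f_max_cont: "continuous_on A (\<lambda>r. f (max 1 r))"
  by (rule continuous_on_compose2[OF f_cont]) (auto intro!: continuous_intros)

lemma phi_meas: "\<phi> \<in> borel_measurable M" and G_meas: "G \<in> borel_measurable M"
  and phi_int: "integrable M (\<lambda>x. \<bar>\<phi> x\<bar> powr p)" and G_int: "integrable M (\<lambda>x. norm (G x) powr p)"
  using W1p unfolding W1p_grad_def Lp_on_def by auto

lemma phi_bounded:
  obtains B where "B \<ge> 0" "\<And>x. norm x > 1 \<Longrightarrow> norm x \<le> b \<Longrightarrow> \<bar>\<phi> x\<bar> \<le> B"
proof -
  obtain B where "B \<ge> 0" "\<And>r. 1 \<le> r \<Longrightarrow> r \<le> b \<Longrightarrow> \<bar>f r\<bar> \<le> B"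
    using continuous_bounded_Icc[OF f_cont_subset[of "{1..b}"]] by auto
  then show ?thesis by (intro that[of B]) (auto simp: phi_eq)
qed

lemma Q_eq: "norm x > 1 \<Longrightarrow> Q x = g x * f (norm x) powr (p - 1)"
  using f_pos[of "norm x"] by (simp add: Q_def phi_eq powr_diff power2_eq_square)

lemma Q_pos: "norm x > 1 \<Longrightarrow> Q x > 0"
  using Q_eq[of x] g_pos[of x] f_pos[of "norm x"] by simp

lemma Q_meas [measurable]: "Q \<in> borel_measurable M"
  unfolding Q_def[abs_def] using g_meas phi_meas by measurable

lemma Q_bounded:
  obtains B where "B \<ge> 0" "\<And>x. norm x > 1 \<Longrightarrow> norm x \<le> b \<Longrightarrow> \<bar>Q x\<bar> \<le> B"
proof -
  obtain B where B: "B \<ge> 0" "\<And>x. norm x > 1 \<Longrightarrow> norm x \<le> b \<Longrightarrow> \<bar>\<phi> x\<bar> \<le> B" by (rule phi_bounded[of b]) (rule that)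
  show ?thesis
  proof (rule that[of "\<bar>C\<^sub>0\<bar> * B powr (p - 1)"])
    show "\<bar>Q x\<bar> \<le> \<bar>C\<^sub>0\<bar> * B powr (p - 1)" if "norm x > 1" "norm x \<le> b" for x
    proof -
      have "\<bar>f (norm x)\<bar> \<le> B" using B(2)[OF that] phi_eq[OF that(1)] by simp
      then have "f (norm x) powr (p - 1) \<le> B powr (p - 1)"
        using f_pos[OF that(1)] p1 by (intro powr_mono2) auto
      moreover have "\<bar>g x\<bar> \<le> \<bar>C\<^sub>0\<bar>" using g_pos[OF that(1)] g_le[OF that(1)] by simp
      ultimately show ?thesis unfolding Q_eq[OF that(1)] abs_mult by (intro mult_mono) auto
    qed
  qed simp
qed

lemma norm_meas [measurable]: "norm \<in> borel_measurable M"
  by (intro borel_measurable_ext_ball) measurable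

lemma sgn_meas: "(\<lambda>x::'a. sgn x) \<in> borel_measurable M"
  unfolding sgn_div_norm by (intro borel_measurable_ext_ball) measurable

lemma ident_meas: "(\<lambda>x::'a. x) \<in> borel_measurable M"
  by (intro borel_measurable_ext_ball) measurable

lemma Q_int: 
  assumes "A \<subseteq> {..b}" and [measurable]: "A \<in> sets borel"
  shows "integrable M (\<lambda>x. indicator A (norm x) * Q x)"
proof -
  obtain B where B: "B \<ge> 0" "\<And>x. norm x > 1 \<Longrightarrow> norm x \<le> b \<Longrightarrow> \<bar>Q x\<bar> \<le> B" by (rule Q_bounded[of b]) (rule that)
  show ?thesis
  proof (rule ext_integrable_bounded[where R=b and B=B])
    show "\<bar>indicator A (norm x) * Q x\<bar> \<le> B" if "norm x > 1" for x
      using assms B that by (auto simp: indicator_def)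
    show "indicator A (norm x) * Q x = 0" if "norm x > b" for x
      using assms(1) that by (auto simp: indicator_def)
  qed measurable
qed

lemma Q_int_less: "integrable M (\<lambda>x. indicator {..<t} (norm x) * Q x)"
  by (rule Q_int[of _ t]) auto

lemma k_diff:
  assumes "a \<le> b"
  shows "k a - k b = lam * (LINT x|M. indicator {a..<b} (norm x) * Q x)"
proof -
  have "(LINT x|M. indicator {a..<b} (norm x) * Q x) =
    (LINT x|M. indicator {..<b} (norm x) * Q x - indicator {..<a} (norm x) * Q x)"
    using assms by (intro Bochner_Integration.integral_cong) (auto simp: indicator_def)
  also have "\<dots> = (LINT x|M. indicator {..<b} (norm x) * Q x) - (LINT x|M. indicator {..<a} (norm x) * Q x)"
    by (rule Bochner_Integration.integral_diff[OF Q_int_less Q_int_less])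
  finally show ?thesis by (simp add: k_def right_diff_distrib)
qed

lemma k_1: "k 1 = \<beta> * \<tau>"
proof -
  have "(LINT x|M. indicator {..<1} (norm x) * Q x) = (LINT x|M. 0)"
    by (intro Bochner_Integration.integral_cong) (auto simp: indicator_def ext_ball_def)
  then show ?thesis by (simp add: k_def)
qed

lemma radial_interval:
  assumes h: "continuous_on {1..} h" and ab: "1 \<le> a" "a \<le> b"
  shows "(LINT x|M. indicator {a..<b} (norm x) * h (norm x)) = K * (LINT r:{a..b}|lborel. h r * r ^ (DIM('a) - 1))"
    and "integrable M (\<lambda>x. indicator {a..<b} (norm x) * h (norm x))"
proof -
  have c: "continuous_on {1<..} h" using h by (rule continuous_on_subset) auto
  have "(\<lambda>r. indicator {1<..} r *\<^sub>R h r) \<in> borel_measurable borel"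
    using set_borel_measurable_Ioi[OF c] by (simp add: set_borel_measurable_def)
  then have "(\<lambda>r. indicator {a..<b} r * (indicator {1<..} r *\<^sub>R h r)) \<in> borel_measurable borel"
    by (intro borel_measurable_times) auto
  also have "(\<lambda>r. indicator {a..<b} r * (indicator {1<..} r *\<^sub>R h r)) = (\<lambda>r. indicator {1<..} r *\<^sub>R (indicator {a..<b} r * h r))"
    by (auto simp: indicator_def)
  finally have m: "set_borel_measurable borel {1<..} (\<lambda>r. indicator {a..<b} r * h r)"
    by (simp add: set_borel_measurable_def)
  \<comment> \<open>Half-open shells fit the differences of \<open>k\<close>, closed intervals fit
    the fundamental theorem; only the endpoints distinguish them.\<close>
  have "AE r in lborel. indicator {1<..} r *\<^sub>R (indicator {a..<b} r * h r * r ^ (DIM('a) - 1)) =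
     indicator {a..b} r *\<^sub>R (h r * r ^ (DIM('a) - 1))"
    using AE_lborel_singleton[of a] AE_lborel_singleton[of b] by eventually_elim (use ab in \<open>auto simp: indicator_def\<close>)
  note ae = this
  have mm: "(\<lambda>r. indicator {1<..} r *\<^sub>R (indicator {a..<b} r * h r * r ^ (DIM('a) - 1))) \<in> borel_measurable lborel"
  proof -
    have "(\<lambda>r. (indicator {1<..} r *\<^sub>R (indicator {a..<b} r * h r)) * r ^ (DIM('a) - 1)) \<in> borel_measurable borel"
      using m unfolding set_borel_measurable_def by measurable
    then show ?thesis by (simp add: mult.assoc)
  qed
  have i: "integrable lborel (\<lambda>r. indicator {a..b} r *\<^sub>R (h r * r ^ (DIM('a) - 1)))"
    using ab by (intro borel_integrable_compact continuous_intros continuous_on_subset[OF h]) auto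
  have "set_integrable lborel {1<..} (\<lambda>r. indicator {a..<b} r * h r * r ^ (DIM('a) - 1))"
    unfolding set_integrable_def using integrable_cong_AE[OF mm borel_measurable_integrable[OF i] ae] i by blast
  then show "integrable M (\<lambda>x. indicator {a..<b} (norm x) * h (norm x))"
    using ext_integrable_radial_iff[OF m, where 'a='a] by simp
  show "(LINT x|M. indicator {a..<b} (norm x) * h (norm x)) = K * (LINT r:{a..b}|lborel. h r * r ^ (DIM('a) - 1))"
    using ext_integral_radial[OF m, where 'a='a] integral_cong_AE[OF mm borel_measurable_integrable[OF i] ae]
    by (simp add: K_def set_lebesgue_integral_def)
qed

text \<open>On a bounded shell \<open>Q\<close> is bounded, so an increment of \<open>k\<close> is
  at most a multiple of the volume of the shell. The range up to t + 1 leaves room on both sides for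
  continuity at t, and with t = 1 it covers the radii used for the gradient near the
  boundary.\<close>

lemma k_lipschitz:
  assumes t: "t \<ge> 1"
  obtains L where "L \<ge> 0" "\<And>a b. 1 \<le> a \<Longrightarrow> a \<le> b \<Longrightarrow> b \<le> t + 1 \<Longrightarrow> \<bar>k a - k b\<bar> \<le> L * (b - a)"
proof -
  obtain B where B: "B \<ge> 0" "\<And>x. norm x > 1 \<Longrightarrow> norm x \<le> t + 1 \<Longrightarrow> \<bar>Q x\<bar> \<le> B" by (rule Q_bounded[of "t + 1"]) (rule that)
  define L where "L = \<bar>lam\<bar> * (B * (K * (t + 1) ^ (DIM('a) - 1)))"
  have L0: "L \<ge> 0" unfolding L_def using B K_pos t by auto
  have lip: "\<bar>k a - k b\<bar> \<le> L * (b - a)" if ab: "1 \<le> a" "a \<le> b" "b \<le> t + 1" for a b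
  proof -
    have "\<bar>LINT x|M. indicator {a..<b} (norm x) * Q x\<bar> \<le> (LINT x|M. indicator {a..<b} (norm x) * B)"
    proof -
      have "norm (LINT x|M. indicator {a..<b} (norm x) * Q x) \<le> (LINT x|M. indicator {a..<b} (norm x) * B)"
      proof (rule order_trans[OF integral_norm_bound integral_mono])
        show "integrable M (\<lambda>x. norm (indicator {a..<b} (norm x) * Q x))"
          by (intro integrable_norm Q_int[of _ b]) auto
        show "integrable M (\<lambda>x. indicator {a..<b} (norm x) * B)"
          by (rule radial_interval(2)[OF continuous_on_const ab(1,2)])
        show "norm (indicator {a..<b} (norm x) * Q x) \<le> indicator {a..<b} (norm x) * B" if "x \<in> space M" for x
          using B(2)[of x] that ab by (auto simp: indicator_def ext_ball_def)
      qed
      then show ?thesis by simp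
    qed
    also have "\<dots> = K * (LINT r:{a..b}|lborel. B * r ^ (DIM('a) - 1))"
      by (rule radial_interval(1)[OF continuous_on_const ab(1,2)])
    also have "(LINT r:{a..b}|lborel. B * r ^ (DIM('a) - 1)) \<le> (LINT r:{a..b}|lborel. B * (t + 1) ^ (DIM('a) - 1))"
      unfolding set_lebesgue_integral_def
    proof (rule integral_mono)
      show "integrable lborel (\<lambda>r. indicator {a..b} r *\<^sub>R (B * r ^ (DIM('a) - 1)))"
        by (intro borel_integrable_compact continuous_intros) auto
      show "integrable lborel (\<lambda>r. indicator {a..b} r *\<^sub>R (B * (t + 1) ^ (DIM('a) - 1)))"
        by (intro borel_integrable_compact continuous_intros) auto
      show "indicator {a..b} r *\<^sub>R (B * r ^ (DIM('a) - 1)) \<le> indicator {a..b} r *\<^sub>R (B * (t + 1) ^ (DIM('a) - 1))" for r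
        using ab B by (auto simp: indicator_def intro!: mult_left_mono power_mono)
    qed
    also have "\<dots> = (b - a) * (B * (t + 1) ^ (DIM('a) - 1))"
      using ab by (simp add: set_lebesgue_integral_def)
    finally have "\<bar>LINT x|M. indicator {a..<b} (norm x) * Q x\<bar> \<le> K * ((b - a) * (B * (t + 1) ^ (DIM('a) - 1)))"
      using K_pos by (simp add: mult_left_mono)
    then have "\<bar>lam\<bar> * \<bar>LINT x|M. indicator {a..<b} (norm x) * Q x\<bar> \<le> \<bar>lam\<bar> * (K * ((b - a) * (B * (t + 1) ^ (DIM('a) - 1))))"
      by (rule mult_left_mono) simp
    then show ?thesis unfolding k_diff[OF ab(2)] abs_mult L_def by (simp add: mult_ac)
  qed
  show ?thesis by (rule that[OF L0 lip])
qed

lemma k_cont: "continuous_on {1..} k"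
  unfolding continuous_on_iff
proof (intro ballI allI impI)
  fix t e :: real assume t: "t \<in> {1..}" and e: "e > 0"
  then have "t \<ge> 1" by simp
  then obtain L where L0: "L \<ge> 0" and lip: "\<And>a b. 1 \<le> a \<Longrightarrow> a \<le> b \<Longrightarrow> b \<le> t + 1 \<Longrightarrow> \<bar>k a - k b\<bar> \<le> L * (b - a)"
    by (rule k_lipschitz) (rule that)
  define d where "d = min 1 (e / (L + 1))"
  have d: "d > 0" using e L0 by (simp add: d_def)
  show "\<exists>d>0. \<forall>t'\<in>{1..}. dist t' t < d \<longrightarrow> dist (k t') (k t) < e"
  proof (intro exI[of _ d] conjI d ballI impI)
    fix t' assume t': "t' \<in> {1..}" "dist t' t < d"
    then have "\<bar>t' - t\<bar> < 1" "\<bar>t' - t\<bar> < e / (L + 1)" by (auto simp: dist_real_def d_def)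
    have "\<bar>k t' - k t\<bar> \<le> L * \<bar>t' - t\<bar>"
    proof (cases "t' \<le> t")
      case True
      then show ?thesis using lip[of t' t] t t' by (simp add: abs_minus_commute)
    next
      case False
      then show ?thesis using lip[of t t'] t t' \<open>\<bar>t' - t\<bar> < 1\<close> by (simp add: abs_minus_commute)
    qed
    also have "\<dots> \<le> (L + 1) * \<bar>t' - t\<bar>" by (simp add: mult_right_mono)
    also have "\<dots> < e" using \<open>\<bar>t' - t\<bar> < e / (L + 1)\<close> L0 by (simp add: field_simps)
    finally show "dist (k t') (k t) < e" by (simp add: dist_real_def)
  qed
qed

lemma continuous_cutoff_integrable:
  fixes h :: "real \<Rightarrow> real"
  assumes "continuous_on {1..} h" "\<And>r. r \<ge> b \<Longrightarrow> h r = 0"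
  shows "set_integrable lborel {1<..} h"
  by (rule set_integrable_Ioi[where b=b]) (use assms in \<open>auto intro: continuous_on_subset\<close>)

text \<open>Testing with a primitive of h identifies the radial flux of G.\<close>
lemma radial_flux:
  assumes h: "continuous_on UNIV h" and hz: "\<And>r. r \<ge> b \<Longrightarrow> h r = 0"
  shows "(LINT x|M. norm (G x) powr (p - 2) * (G x \<bullet> (h (norm x) *\<^sub>R sgn x))) = (LINT t:{1<..}|lborel. h t * k t)"
proof -
  define b' where "b' = max b 1"
  have hz': "h r = 0" if "r \<ge> b'" for r using that hz by (simp add: b'_def)
  have b1: "b' \<ge> 1" by (simp add: b'_def)
  obtain W where W: "\<And>t. t > 0 \<Longrightarrow> (W has_real_derivative h t) (at t)"
    by (rule antiderivative_exists[OF h]) (rule that)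
  \<comment> \<open>The primitive is normalised to vanish from b' on, which makes the radial test
    function compactly supported and hence admissible.\<close>
  define u where "u = (\<lambda>r. W r - W b')"
  have du: "(u has_real_derivative h r) (at r)" if "r > 0" for r
    unfolding u_def using W[OF that] by (auto intro!: derivative_eq_intros)
  have [measurable]: "h \<in> borel_measurable borel" using h by (rule borel_measurable_continuous_onI)
  have hc: "continuous_on A h" for A using h by (rule continuous_on_subset) auto
  have ftc: "(LINT t|lborel. indicator {a..c} t *\<^sub>R h t) = W c - W a" if "1 \<le> a" "a \<le> c" for a c
    using that hc by (intro integral_FTC_Icc) (auto simp: has_real_derivative_iff_has_vector_derivative[symmetric] intro!: has_field_derivative_at_within W)
  \<comment> \<open>Writing \<open>u\<close> as minus a tail integral of \<open>h\<close> prepares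
    the exchange of integrals: the tail beyond |x| turns into the mass of \<open>Q\<close> inside
    radius t.\<close>
  have u_eq: "u r = - (LINT t|lborel. indicator {r<..} t * h t)" if r: "r \<ge> 1" for r
  proof (cases "r \<le> b'")
    case True
    have "(LINT t|lborel. indicator {r<..} t * h t) = (LINT t|lborel. indicator {r..b'} t *\<^sub>R h t)"
    proof (rule integral_cong_AE)
      show "(\<lambda>t. indicator {r<..} t * h t) \<in> borel_measurable lborel" "(\<lambda>t. indicator {r..b'} t *\<^sub>R h t) \<in> borel_measurable lborel"
        by measurable
      show "AE t in lborel. indicator {r<..} t * h t = indicator {r..b'} t *\<^sub>R h t"
        using AE_lborel_singleton[of r] by eventually_elim (use hz' True in \<open>auto simp: indicator_def\<close>)
    qed
    then show ?thesis using ftc[OF r True] by (simp add: u_def)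
  next
    case False
    have "(LINT t|lborel. indicator {b'..r} t *\<^sub>R h t) = (LINT t::real|lborel. 0)"
      by (rule Bochner_Integration.integral_cong) (use hz' in \<open>auto simp: indicator_def\<close>)
    then have "u r = 0" using ftc[OF b1, of r] False by (simp add: u_def)
    moreover have "(LINT t|lborel. indicator {r<..} t * h t) = (LINT t::real|lborel. 0)"
      by (rule Bochner_Integration.integral_cong) (use hz' False in \<open>auto simp: indicator_def\<close>)
    ultimately show ?thesis by simp
  qed
  have uz: "u r = 0" if "r > b'" for r
  proof -
    have "(LINT t|lborel. indicator {r<..} t * h t) = (LINT t::real|lborel. 0)"
      by (rule Bochner_Integration.integral_cong) (use hz' that in \<open>auto simp: indicator_def\<close>)
    then show ?thesis using u_eq[of r] that b1 by simp
  qed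
  have Wu: "W1p_grad p ext_ball (\<lambda>x::'a. u (norm x)) (\<lambda>x. h (norm x) *\<^sub>R sgn x)"
    by (rule radial_W1p_grad[OF du hc uz]) (use hz' p1 in auto)
  have E: "(LINT x|M. norm (G x) powr (p - 2) * (G x \<bullet> (h (norm x) *\<^sub>R sgn x))) + \<beta> * (\<tau> * u 1)
     = lam * (LINT x|M. Q x * u (norm x))"
    using weak[OF Wu radial_trace_ext[OF du hc]] by (simp add: \<tau>_def Q_def sphere_int_def)
  define H where "H = (\<lambda>t. indicator {1<..} t * h t)"
  have Hi: "integrable lborel H"
    using continuous_cutoff_integrable[OF hc hz'] by (simp add: H_def set_integrable_def)
  \<comment> \<open>\<open>Q\<close> itself need not be integrable at infinity. Nothing changes by
    cutting it at b', since \<open>h\<close> vanishes from there on.\<close>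
  define F where "F = (\<lambda>x::'a. indicator {..<b'} (norm x) * Q x)"
  have Fi: "integrable M F" unfolding F_def by (rule Q_int_less)
  have fub: "(LINT x|M. F x * (LINT t|lborel. indicator {norm x<..} t * H t)) =
     (LINT t|lborel. H t * (LINT x|M. indicator {..<t} (norm x) * F x))"
    by (rule fubini_level_sets[OF sigma_finite_ext_ball sigma_finite_lborel Fi Hi]) measurable
  have 1: "(LINT x|M. Q x * u (norm x)) = - (LINT x|M. F x * (LINT t|lborel. indicator {norm x<..} t * H t))"
  proof -
    have "(LINT x|M. Q x * u (norm x)) = (LINT x|M. - (F x * (LINT t|lborel. indicator {norm x<..} t * H t)))"
    proof (rule Bochner_Integration.integral_cong[OF refl])
      fix x assume "x \<in> space M"
      then have x: "norm x > 1" by (simp add: ext_ball_def)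
      then have "(LINT t|lborel. indicator {norm x<..} t * H t) = (LINT t|lborel. indicator {norm x<..} t * h t)"
        by (intro Bochner_Integration.integral_cong) (auto simp: H_def indicator_def)
      then have "u (norm x) = - (LINT t|lborel. indicator {norm x<..} t * H t)" using u_eq[of "norm x"] x by simp
      moreover have "u (norm x) = 0" if "norm x \<ge> b'"
        using that uz[of "norm x"] by (cases "norm x = b'") (auto simp: u_def)
      ultimately show "Q x * u (norm x) = - (F x * (LINT t|lborel. indicator {norm x<..} t * H t))"
        by (auto simp: F_def indicator_def)
    qed
    then show ?thesis by simp
  qed
  have u1: "u 1 = - (LINT t|lborel. H t)" using u_eq[of 1] by (simp add: H_def)
  have inner: "H t * (LINT x|M. indicator {..<t} (norm x) * F x) = H t * (LINT x|M. indicator {..<t} (norm x) * Q x)" for t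
  proof (cases "t \<le> b'")
    case True
    then have "(LINT x|M. indicator {..<t} (norm x) * F x) = (LINT x|M. indicator {..<t} (norm x) * Q x)"
      by (intro Bochner_Integration.integral_cong) (auto simp: F_def indicator_def)
    then show ?thesis by simp
  qed (use hz' in \<open>auto simp: H_def\<close>)
  have Hk: "integrable lborel (\<lambda>t. H t * k t)"
    using continuous_cutoff_integrable[of "\<lambda>t. h t * k t" b'] hz' 
    by (auto simp: H_def set_integrable_def mult.assoc intro!: continuous_intros hc k_cont)
  have "lam * (LINT t|lborel. H t * (LINT x|M. indicator {..<t} (norm x) * Q x)) = (LINT t|lborel. \<beta> * \<tau> * H t - H t * k t)"
    by (simp add: k_def algebra_simps flip: integral_mult_right_zero)
  also have "\<dots> = \<beta> * \<tau> * (LINT t|lborel. H t) - (LINT t|lborel. H t * k t)"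
    using Hi Hk by (subst Bochner_Integration.integral_diff) auto
  finally have "(LINT x|M. norm (G x) powr (p - 2) * (G x \<bullet> (h (norm x) *\<^sub>R sgn x))) = (LINT t|lborel. H t * k t)"
    using E unfolding 1 fub inner u1 by (simp add: algebra_simps)
  then show ?thesis by (simp add: H_def set_lebesgue_integral_def mult.assoc)
qed

end

section \<open>Radial fields and annular cutoffs\<close>

lemma radial_has_derivative:
  fixes x :: "'a::real_inner"
  assumes "x \<noteq> 0" "(u has_real_derivative u') (at (norm x))"
  shows "((\<lambda>x. u (norm x)) has_derivative (\<lambda>h. u' * (sgn x \<bullet> h))) (at x)"
proof -
  have "(norm has_derivative (\<lambda>h. sgn x \<bullet> h)) (at x)"
    using has_derivative_norm[of x] assms(1) by (simp add: inner_commute)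
  then show ?thesis
    using has_derivative_compose[of norm _ x UNIV u "\<lambda>h. u' * h"] assms(2)
    by (simp add: has_field_derivative_def)
qed

lemma divergence_radial_times:
  fixes \<Phi> :: "'a::euclidean_space \<Rightarrow> 'a"
  assumes x: "x \<noteq> 0" and u: "(u has_real_derivative u') (at (norm x))"
    and \<Phi>: "\<And>i. i \<in> Basis \<Longrightarrow> smooth_fun (\<lambda>y. \<Phi> y \<bullet> i)"
  shows "divergence (\<lambda>y. u (norm y) *\<^sub>R \<Phi> y) x = u (norm x) * divergence \<Phi> x + u' * (sgn x \<bullet> \<Phi> x)"
proof -
  have "partial (\<lambda>y. (u (norm y) *\<^sub>R \<Phi> y) \<bullet> i) i x = u (norm x) * partial (\<lambda>y. \<Phi> y \<bullet> i) i x + u' * ((sgn x \<bullet> i) * (\<Phi> x \<bullet> i))"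
    if i: "i \<in> Basis" for i
    unfolding inner_scaleR_left
    by (subst partial_eq[OF has_derivative_mult[OF radial_has_derivative[OF x u] has_derivative_partial[OF \<Phi>[OF i]]]])
      (simp add: partial_def mult_ac)
  then show ?thesis unfolding divergence_def
    by (simp add: sum.distrib sum_distrib_left euclidean_inner[of "sgn x" "\<Phi> x"])
qed

lemma divergence_ident: "divergence (\<lambda>y::'a::euclidean_space. y) x = real DIM('a)"
proof -
  have "partial (\<lambda>y. y \<bullet> i) i x = 1" if "i \<in> Basis" for i :: 'a
  proof -
    have "((\<lambda>y. y \<bullet> i) has_derivative (\<lambda>h. h \<bullet> i)) (at x)" by (auto intro!: derivative_eq_intros)
    from partial_eq[OF this, of i] that show ?thesis by simp
  qed
  then show ?thesis by (simp add: divergence_def)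
qed

text \<open>A smooth bump on the annulus between a and b in the variable r^2, multiplied by the
  weight r^(2c). The weight comes with the fixed factor exp(-1/r^2), which is common to all values
  of c and keeps the function smooth through r = 0.\<close>

definition annular :: "real \<Rightarrow> real \<Rightarrow> real \<Rightarrow> real \<Rightarrow> real" where
  "annular c a b r = exp_bump c (r\<^sup>2) * exp_bump 0 (r\<^sup>2 - a\<^sup>2) * exp_bump 0 (b\<^sup>2 - r\<^sup>2)"

definition annular' :: "real \<Rightarrow> real \<Rightarrow> real \<Rightarrow> real \<Rightarrow> real" where
  "annular' c a b = partial (annular c a b) 1"

lemma annular_smooth_norm: "smooth_fun (\<lambda>x::'a::euclidean_space. annular c a b (norm x))"
  unfolding annular_def
  by (intro smooth_fun_mult smooth_fun_compose[OF exp_bump_smooth] smooth_fun_diff smooth_fun_const smooth_fun_norm_sq)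

lemma annular_smooth: "smooth_fun (annular c a b)"
proof -
  have "annular c a b = (\<lambda>r. annular c a b (norm r))" by (rule ext) (simp add: annular_def)
  then show ?thesis using annular_smooth_norm[of c a b, where 'a=real] by simp
qed

lemma annular_deriv: "(annular c a b has_real_derivative annular' c a b r) (at r)"
  unfolding annular'_def by (rule smooth_fun_real_has_derivative[OF annular_smooth])

lemma annular_cont: "continuous_on A (annular c a b)" and annular'_cont: "continuous_on A (annular' c a b)"
  unfolding annular'_def by (auto intro!: smooth_fun_continuous_on smooth_fun_partial annular_smooth)

lemmas continuous_on_annular [continuous_intros] = continuous_on_compose2[OF annular_cont[of UNIV] _ subset_UNIV]
lemmas continuous_on_annular' [continuous_intros] = continuous_on_compose2[OF annular'_cont[of UNIV] _ subset_UNIV]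

lemma annular_nonneg: "annular c a b r \<ge> 0"
  by (simp add: annular_def exp_bump_nonneg)

lemma annular_zero:
  assumes "0 < a" "a < b" "0 \<le> r" "r \<le> a \<or> r \<ge> b"
  shows "annular c a b r = 0" "annular' c a b r = 0"
proof -
  show z: "annular c a b r = 0"
    using assms(4)
  proof
    assume "r \<le> a"
    then have "r\<^sup>2 \<le> a\<^sup>2" using assms by (intro power_mono) auto
    then show ?thesis by (simp add: annular_def exp_bump_def)
  next
    assume "r \<ge> b"
    then have "b\<^sup>2 \<le> r\<^sup>2" using assms by (intro power_mono) auto
    then show ?thesis by (simp add: annular_def exp_bump_def)
  qed
  \<comment> \<open>A nonnegative function has a minimum wherever it vanishes, so its derivative is
    zero there.\<close>
  show "annular' c a b r = 0"
    by (rule DERIV_local_min[OF annular_deriv, of 1]) (auto simp: z annular_nonneg)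
qed

lemma annular_pos:
  assumes "0 < a" "a < r" "r < b"
  shows "annular c a b r > 0"
proof -
  have "a\<^sup>2 < r\<^sup>2" "r\<^sup>2 < b\<^sup>2" using assms by (intro power_strict_mono; simp)+
  then show ?thesis using assms by (simp add: annular_def exp_bump_def)
qed

text \<open>Passing from exponent 0 to n/2 multiplies by r^n. With n = N this is the polar Jacobian
  r^(N-1) times the factor r from the field x, so that test fields carry the exponent 0 and radial
  integrals the exponent N/2.\<close>

lemma annular_shift:
  assumes "r > 0"
  shows "annular (real n / 2) a b r = r ^ n * annular 0 a b r"
    "annular' (real n / 2) a b r = real n * r ^ (n - 1) * annular 0 a b r + r ^ n * annular' 0 a b r"
proof -
  have *: "annular (real n / 2) a b r = r ^ n * annular 0 a b r" if "r > 0" for r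
  proof -
    have "(r\<^sup>2) powr (real n / 2) = r ^ n"
      using that by (simp add: powr_powr powr_realpow[symmetric] flip: powr_numeral)
    then show ?thesis using that by (simp add: annular_def exp_bump_def)
  qed
  then show "annular (real n / 2) a b r = r ^ n * annular 0 a b r" using assms .
  have "((\<lambda>r. r ^ n * annular 0 a b r) has_real_derivative real n * r ^ (n - 1) * annular 0 a b r + r ^ n * annular' 0 a b r) (at r)"
    by (auto intro!: derivative_eq_intros annular_deriv simp: mult_ac)
  then have "(annular (real n / 2) a b has_real_derivative real n * r ^ (n - 1) * annular 0 a b r + r ^ n * annular' 0 a b r) (at r)"
    by (rule has_field_derivative_transform_within_open[of _ _ _ "{0<..}"]) (use * assms in auto)
  then show "annular' (real n / 2) a b r = real n * r ^ (n - 1) * annular 0 a b r + r ^ n * annular' 0 a b r"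
    using annular_deriv DERIV_unique by blast
qed

lemma annular_test:
  assumes "1 < a" "a < b"
  shows "test_fun ext_ball (\<lambda>x::'a::euclidean_space. annular c a b (norm x))"
proof (rule test_funI[where C="cball 0 b - ball 0 a"])
  show "annular c a b (norm x) = 0" if "x \<notin> cball 0 b - ball 0 a" for x :: 'a
    using that assms by (intro annular_zero) auto
qed (use assms in \<open>auto simp: annular_smooth_norm ext_ball_def closed_Diff intro: bounded_subset[OF bounded_cball]\<close>)

lemma le_one_plus_powr: "(0::real) \<le> y \<Longrightarrow> 1 \<le> q \<Longrightarrow> y \<le> 1 + y powr q"
proof -
  assume y: "0 \<le> y" "1 \<le> q"
  show ?thesis
  proof (cases "y \<le> 1")
    case False
    then have "y powr 1 \<le> y powr q" using y by (intro powr_mono) auto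
    then show ?thesis using False by simp
  qed (use y in \<open>auto intro: order_trans\<close>)
qed

lemma add_powr_le: "(0::real) \<le> x \<Longrightarrow> 0 \<le> y \<Longrightarrow> 0 \<le> q \<Longrightarrow> (x + y) powr q \<le> 2 powr q * (x powr q + y powr q)"
proof -
  assume xy: "0 \<le> x" "0 \<le> y" "0 \<le> q"
  have "(x + y) powr q \<le> (2 * max x y) powr q" using xy by (intro powr_mono2) auto
  also have "\<dots> = 2 powr q * (max x y) powr q" using xy by (simp add: powr_mult)
  also have "\<dots> \<le> 2 powr q * (x powr q + y powr q)" by (intro mult_left_mono) (auto simp: max_def)
  finally show ?thesis .
qed

section \<open>The weak equation and the weak gradient tested on annuli\<close>

context radial_robin
begin

lemma dominated_by_G:
  assumes h: "h \<in> borel_measurable M" and b: "\<And>x. norm x > 1 \<Longrightarrow> norm x \<le> R \<Longrightarrow> \<bar>h x\<bar> \<le> B + C * norm (G x) powr p"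
    and z: "\<And>x. norm x > 1 \<Longrightarrow> norm x > R \<Longrightarrow> h x = 0" and "B \<ge> 0" "C \<ge> 0"
  shows "integrable M h"
proof (rule ext_integrable_dominated[OF h _ _ z])
  show "integrable M (\<lambda>x. C * norm (G x) powr p)" using G_int by simp
  show "\<bar>h x\<bar> \<le> B + C * norm (G x) powr p" if "norm x > 1" for x
    using b[OF that] z[OF that] assms(4,5) by (cases "norm x \<le> R") auto
qed

text \<open>Sums the componentwise definition of the weak gradient over the coordinates. Local
  integrability of \<open>G\<close> follows from that of |G|^p through y <= 1 + y^p.\<close>

lemma weak_gradient_field:
  assumes \<Phi>: "\<forall>i\<in>Basis. test_fun ext_ball (\<lambda>y. \<Phi> y \<bullet> i)"
  shows "integrable M (\<lambda>x. \<phi> x * divergence \<Phi> x)" "integrable M (\<lambda>x. G x \<bullet> \<Phi> x)"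
    "(LINT x|M. \<phi> x * divergence \<Phi> x) = - (LINT x|M. G x \<bullet> \<Phi> x)"
proof -
  obtain R B where RB: "R > 0" "B > 0" "\<And>i x. i \<in> Basis \<Longrightarrow> \<bar>\<Phi> x \<bullet> i\<bar> \<le> B"
    "\<And>i j x. i \<in> Basis \<Longrightarrow> j \<in> Basis \<Longrightarrow> \<bar>partial (\<lambda>y. \<Phi> y \<bullet> i) j x\<bar> \<le> B"
    "\<And>i x. i \<in> Basis \<Longrightarrow> norm x > R \<Longrightarrow> \<Phi> x \<bullet> i = 0"
    "\<And>i j x. i \<in> Basis \<Longrightarrow> norm x > R \<Longrightarrow> partial (\<lambda>y. \<Phi> y \<bullet> i) j x = 0"
    by (rule test_field_bounds[OF \<Phi>]) (rule that)
  obtain P where P: "P \<ge> 0" "\<And>x. norm x > 1 \<Longrightarrow> norm x \<le> R \<Longrightarrow> \<bar>\<phi> x\<bar> \<le> P" by (rule phi_bounded[of R]) (rule that)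
  have i1: "integrable M (\<lambda>x. \<phi> x * partial (\<lambda>y. \<Phi> y \<bullet> i) i x)" if i: "i \<in> Basis" for i
  proof (rule ext_integrable_bounded[where R=R and B="P * B"])
    show "(\<lambda>x. \<phi> x * partial (\<lambda>y. \<Phi> y \<bullet> i) i x) \<in> borel_measurable M"
      using \<Phi> i by (intro borel_measurable_times phi_meas borel_measurable_ext_ball test_fun_partial_borel) auto
    show "\<bar>\<phi> x * partial (\<lambda>y. \<Phi> y \<bullet> i) i x\<bar> \<le> P * B" if "norm x > 1" for x
      using that RB i P by (cases "norm x > R") (auto simp: abs_mult intro!: mult_mono)
  qed (use RB i in auto)
  have i2: "integrable M (\<lambda>x. (G x \<bullet> i) * (\<Phi> x \<bullet> i))" if i: "i \<in> Basis" for i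
  proof (rule dominated_by_G[where R=R and B=B and C=B])
    show "(\<lambda>x. (G x \<bullet> i) * (\<Phi> x \<bullet> i)) \<in> borel_measurable M"
      using \<Phi> i by (intro borel_measurable_times borel_measurable_inner G_meas borel_measurable_const borel_measurable_ext_ball test_fun_borel) auto
    fix x
    have "\<bar>G x \<bullet> i\<bar> * \<bar>\<Phi> x \<bullet> i\<bar> \<le> (1 + norm (G x) powr p) * B"
      using RB i p1 by (intro mult_mono order_trans[OF Basis_le_norm[OF i] le_one_plus_powr]) auto
    then show "\<bar>(G x \<bullet> i) * (\<Phi> x \<bullet> i)\<bar> \<le> B + B * norm (G x) powr p" by (simp add: abs_mult algebra_simps)
  qed (use RB i in auto)
  show "integrable M (\<lambda>x. \<phi> x * divergence \<Phi> x)"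
    unfolding divergence_def sum_distrib_left using i1 by (intro Bochner_Integration.integrable_sum) auto
  have inner: "(\<lambda>x. G x \<bullet> \<Phi> x) = (\<lambda>x. \<Sum>i\<in>Basis. (G x \<bullet> i) * (\<Phi> x \<bullet> i))"
    by (rule ext) (rule euclidean_inner)
  show "integrable M (\<lambda>x. G x \<bullet> \<Phi> x)"
    unfolding inner using i2 by (intro Bochner_Integration.integrable_sum) auto
  have "(LINT x|M. \<phi> x * divergence \<Phi> x) = (\<Sum>i\<in>Basis. LINT x|M. \<phi> x * partial (\<lambda>y. \<Phi> y \<bullet> i) i x)"
    unfolding divergence_def sum_distrib_left using i1 by (intro Bochner_Integration.integral_sum) auto
  also have "\<dots> = (\<Sum>i\<in>Basis. - (LINT x|M. (G x \<bullet> i) * (\<Phi> x \<bullet> i)))"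
    using W1p \<Phi> unfolding W1p_grad_def weak_grad_def by (intro sum.cong) auto
  also have "\<dots> = - (LINT x|M. G x \<bullet> \<Phi> x)"
    unfolding inner using i2 by (subst Bochner_Integration.integral_sum) (auto simp: sum_negf)
  finally show "(LINT x|M. \<phi> x * divergence \<Phi> x) = - (LINT x|M. G x \<bullet> \<Phi> x)" .
qed

lemma ext_radial_integral:
  assumes h: "continuous_on {1..} h" and z: "\<And>r. r \<ge> b \<Longrightarrow> h r = 0"
  shows "(LINT x|M. h (norm x)) = K * (LINT r:{1<..}|lborel. h r * r ^ (DIM('a) - 1))"
    and "integrable M (\<lambda>x. h (norm x))"
proof -
  have m: "set_borel_measurable borel {1<..} h"
    by (intro set_borel_measurable_Ioi continuous_on_subset[OF h]) auto
  show "(LINT x|M. h (norm x)) = K * (LINT r:{1<..}|lborel. h r * r ^ (DIM('a) - 1))"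
    unfolding K_def by (rule ext_integral_radial[OF m])
  have "set_integrable lborel {1<..} (\<lambda>r. h r * r ^ (DIM('a) - 1))"
    by (rule continuous_cutoff_integrable[where b=b]) (use z in \<open>auto intro!: continuous_intros h\<close>)
  then show "integrable M (\<lambda>x. h (norm x))" using ext_integrable_radial_iff[OF m, where 'a='a] by simp
qed

lemma step_tendsto:
  assumes "0 \<le> r" "0 \<le> d"
  shows "(\<lambda>n. S (real n * (r\<^sup>2 - d\<^sup>2))) \<longlonglongrightarrow> indicator {d<..} r"
proof (cases "r > d")
  case True
  then have x: "r\<^sup>2 - d\<^sup>2 > 0" using assms by (simp add: power_strict_mono)
  obtain m :: nat where m: "real m * (r\<^sup>2 - d\<^sup>2) > 1" using reals_Archimedean3[OF x] by blast
  have "S (real n * (r\<^sup>2 - d\<^sup>2)) = 1" if "n \<ge> m" for n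
  proof -
    have "real m * (r\<^sup>2 - d\<^sup>2) \<le> real n * (r\<^sup>2 - d\<^sup>2)"
      using that x by (intro mult_right_mono) auto
    then show ?thesis using m by (intro S_1) linarith
  qed
  then show ?thesis using True by (intro tendsto_eventually) (auto simp: eventually_sequentially)
next
  case False
  then have "r\<^sup>2 \<le> d\<^sup>2" using assms by (intro power_mono) auto
  then have "S (real n * (r\<^sup>2 - d\<^sup>2)) = 0" for n by (intro S_0 mult_nonneg_nonpos) auto
  then show ?thesis using False by simp
qed

text \<open>The weak gradient tested with smooth approximations of a radial field jumping at the radius d.\<close>
lemma sphere_jump:
  assumes ab: "1 < a" "a < b" and d: "d \<ge> 1"
  shows "(LINT x|M. indicator {d<..} (norm x) * (annular 0 a b (norm x) * (G x \<bullet> x))) =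
     - K * ((LINT r:{1<..}|lborel. indicator {d<..} r * (f r * annular' (real DIM('a) / 2) a b r)) + f d * annular (real DIM('a) / 2) a b d)"
    and "integrable M (\<lambda>x. annular 0 a b (norm x) * (G x \<bullet> x))"
proof -
  let ?N = "DIM('a)"
  define e where "e = annular 0 a b"
  define e' where "e' = annular' 0 a b"
  define E where "E = annular (real ?N / 2) a b"
  define E' where "E' = annular' (real ?N / 2) a b"
  have a0: "0 < a" using ab by simp
  have z: "e r = 0" "e' r = 0" "E r = 0" "E' r = 0" if "0 \<le> r" "r \<le> a \<or> r \<ge> b" for r
    using annular_zero[OF a0 ab(2) that] by (simp_all add: e_def e'_def E_def E'_def)
  have c: "continuous_on A e" "continuous_on A e'" "continuous_on A E" "continuous_on A E'" for A
    unfolding e_def e'_def E_def E'_def by (rule annular_cont annular'_cont)+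
  obtain B where B: "B \<ge> 0" "\<And>r. 0 \<le> r \<Longrightarrow> r \<le> b \<Longrightarrow> \<bar>e r\<bar> \<le> B"
    using continuous_bounded_Icc[OF c(1)[of "{0..b}"]] by metis
  have Mcomp: "(\<lambda>x. h (norm x)) \<in> borel_measurable M" if "continuous_on UNIV h" for h :: "real \<Rightarrow> real"
    using that by (intro ext_measurable_radial_continuous) (auto intro: continuous_on_subset)
  have eG: "integrable M (\<lambda>x. e (norm x) * (G x \<bullet> x))"
  proof (rule dominated_by_G[where R=b and B="B * b" and C="B * b"])
    show "(\<lambda>x. e (norm x) * (G x \<bullet> x)) \<in> borel_measurable M"
      by (intro borel_measurable_times borel_measurable_inner G_meas ident_meas Mcomp c)
    fix x :: 'a
    assume x: "norm x \<le> b"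
    have "\<bar>G x \<bullet> x\<bar> \<le> norm (G x) * norm x" by (rule Cauchy_Schwarz_ineq2)
    also have "\<dots> \<le> (1 + norm (G x) powr p) * b" using x p1 by (intro mult_mono le_one_plus_powr) auto
    finally have "\<bar>e (norm x)\<bar> * \<bar>G x \<bullet> x\<bar> \<le> B * ((1 + norm (G x) powr p) * b)" using B x by (intro mult_mono) auto
    then show "\<bar>e (norm x) * (G x \<bullet> x)\<bar> \<le> B * b + B * b * norm (G x) powr p" by (simp add: abs_mult algebra_simps)
  qed (use z B ab in auto)
  then show "integrable M (\<lambda>x. annular 0 a b (norm x) * (G x \<bullet> x))" by (simp add: e_def)
  define X where "X = (\<lambda>(n::nat) r. S (real n * (r\<^sup>2 - d\<^sup>2)))"
  define \<kappa> where "\<kappa> = (\<lambda>(n::nat) r. s (real n * (r\<^sup>2 - d\<^sup>2)) * (real n * (2 * r)))"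
  have Xc: "continuous_on Z (X n)" "continuous_on Z (\<kappa> n)" for n Z
    unfolding X_def \<kappa>_def by (intro continuous_intros)+
  have Xd: "(X n has_real_derivative \<kappa> n r) (at r)" for n r
    unfolding X_def \<kappa>_def by (rule radial_step_deriv)
  define A where "A = (\<lambda>n. (LINT r:{1<..}|lborel. X n r * (f r * E' r)) + (LINT r:{1<..}|lborel. \<kappa> n r * (f r * E r)))"
  have step: "(LINT x|M. X n (norm x) * (e (norm x) * (G x \<bullet> x))) = - K * A n" for n
  proof -
    \<comment> \<open>The field \<theta>(|x|) x is smooth because bump and step depend on |x|^2. Its
      divergence N \<theta> + r \<theta>', multiplied by r^(N-1), is the derivative of r^N \<theta>
      = E X_n; the product rule splits it into the two radial integrals in
      \<open>A n\<close>.\<close>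
    define \<theta> where "\<theta> = (\<lambda>r. e r * X n r)"
    define \<theta>' where "\<theta>' = (\<lambda>r. e' r * X n r + e r * \<kappa> n r)"
    have d\<theta>: "(\<theta> has_real_derivative \<theta>' r) (at r)" for r
      unfolding \<theta>_def \<theta>'_def e_def e'_def by (auto intro!: derivative_eq_intros annular_deriv Xd)
    have test: "\<forall>i\<in>Basis. test_fun ext_ball (\<lambda>y::'a. (\<theta> (norm y) *\<^sub>R y) \<bullet> i)"
    proof
      fix i :: 'a
      have "smooth_fun (\<lambda>y::'a. X n (norm y) * (y \<bullet> i))"
        unfolding X_def
        by (intro smooth_fun_mult smooth_fun_compose[OF S_smooth] smooth_fun_diff smooth_fun_const smooth_fun_norm_sq smooth_fun_inner)
      from test_fun_mult[OF annular_test[OF ab, of 0] this]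
      show "test_fun ext_ball (\<lambda>y::'a. (\<theta> (norm y) *\<^sub>R y) \<bullet> i)"
        by (simp add: \<theta>_def e_def mult.assoc)
    qed
    have div: "divergence (\<lambda>y::'a. \<theta> (norm y) *\<^sub>R y) x = real ?N * \<theta> (norm x) + norm x * \<theta>' (norm x)" if "norm x > 1" for x
    proof -
      have x0: "x \<noteq> 0" using that by auto
      have "sgn x \<bullet> x = norm x" using x0 by (simp add: sgn_div_norm dot_square_norm power2_eq_square)
      then show ?thesis using divergence_radial_times[OF x0 d\<theta>, of "\<lambda>y. y"]
        by (simp add: smooth_fun_inner divergence_ident mult.commute)
    qed
    have "(LINT x|M. X n (norm x) * (e (norm x) * (G x \<bullet> x))) = (LINT x|M. G x \<bullet> (\<theta> (norm x) *\<^sub>R x))"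
      by (rule Bochner_Integration.integral_cong) (auto simp: \<theta>_def)
    also have "\<dots> = - (LINT x|M. \<phi> x * divergence (\<lambda>y. \<theta> (norm y) *\<^sub>R y) x)"
      using weak_gradient_field(3)[OF test] by simp
    also have "(LINT x|M. \<phi> x * divergence (\<lambda>y. \<theta> (norm y) *\<^sub>R y) x) =
      (LINT x|M. (\<lambda>r. f r * (real ?N * \<theta> r + r * \<theta>' r)) (norm x))"
      by (rule Bochner_Integration.integral_cong) (auto simp: div phi_eq ext_ball_def)
    also have "\<dots> = K * (LINT r:{1<..}|lborel. f r * (real ?N * \<theta> r + r * \<theta>' r) * r ^ (?N - 1))"
      by (rule ext_radial_integral(1)[where b=b])
        (use ab z in \<open>auto simp: \<theta>_def \<theta>'_def intro!: continuous_intros f_cont c Xc\<close>)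
    also have "(LINT r:{1<..}|lborel. f r * (real ?N * \<theta> r + r * \<theta>' r) * r ^ (?N - 1)) =
      (LINT r:{1<..}|lborel. X n r * (f r * E' r) + \<kappa> n r * (f r * E r))"
    proof (rule set_lebesgue_integral_cong)
      show "\<forall>r. r \<in> {1<..} \<longrightarrow> f r * (real ?N * \<theta> r + r * \<theta>' r) * r ^ (?N - 1) = X n r * (f r * E' r) + \<kappa> n r * (f r * E r)"
      proof (intro allI impI)
        fix r :: real assume "r \<in> {1<..}"
        then have r: "r > 0" by simp
        have rN: "r ^ ?N = r * r ^ (?N - 1)" by (metis DIM_positive power_minus_mult mult.commute)
        show "f r * (real ?N * \<theta> r + r * \<theta>' r) * r ^ (?N - 1) = X n r * (f r * E' r) + \<kappa> n r * (f r * E r)"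
          unfolding E_def E'_def annular_shift[OF r] e_def[symmetric] e'_def[symmetric] rN \<theta>_def \<theta>'_def
          by (simp add: algebra_simps)
      qed
    qed simp
    also have "\<dots> = A n" unfolding A_def
    proof (rule set_integral_add)
      show "set_integrable lborel {1<..} (\<lambda>r. X n r * (f r * E' r))" "set_integrable lborel {1<..} (\<lambda>r. \<kappa> n r * (f r * E r))"
        by (rule continuous_cutoff_integrable[where b=b], use ab z in \<open>auto intro!: continuous_intros f_cont c Xc\<close>)+
    qed
    finally show ?thesis by simp
  qed
  have lim1: "(\<lambda>n. LINT x|M. X n (norm x) * (e (norm x) * (G x \<bullet> x))) \<longlonglongrightarrow> (LINT x|M. indicator {d<..} (norm x) * (e (norm x) * (G x \<bullet> x)))"
  proof (rule integral_dominated_convergence[where w="\<lambda>x. norm (e (norm x) * (G x \<bullet> x))"])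
    show "(\<lambda>x. X n (norm x) * (e (norm x) * (G x \<bullet> x))) \<in> borel_measurable M" for n
      using eG by (intro borel_measurable_times[OF Mcomp] borel_measurable_integrable Xc)
    show "(\<lambda>x. indicator {d<..} (norm x) * (e (norm x) * (G x \<bullet> x))) \<in> borel_measurable M"
      by (rule borel_measurable_times[OF _ borel_measurable_integrable[OF eG]]) measurable
    show "AE x in M. (\<lambda>n. X n (norm x) * (e (norm x) * (G x \<bullet> x))) \<longlonglongrightarrow> indicator {d<..} (norm x) * (e (norm x) * (G x \<bullet> x))"
      unfolding X_def using d by (intro AE_I2 tendsto_mult tendsto_const step_tendsto) auto
    show "AE x in M. norm (X n (norm x) * (e (norm x) * (G x \<bullet> x))) \<le> norm (e (norm x) * (G x \<bullet> x))" for n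
      using S_nonneg S_le_1 by (auto simp: X_def abs_mult intro!: mult_left_le_one_le)
  qed (use eG in auto)
  have lim2: "(\<lambda>n. LINT r:{1<..}|lborel. X n r * (f r * E' r)) \<longlonglongrightarrow> (LINT r:{1<..}|lborel. indicator {d<..} r * (f r * E' r))"
    unfolding set_lebesgue_integral_def
  proof (rule integral_dominated_convergence[where w="\<lambda>r. norm (indicator {1<..} r *\<^sub>R (f r * E' r))"])
    have i: "integrable lborel (\<lambda>r. indicator {1<..} r *\<^sub>R (f r * E' r))"
      using continuous_cutoff_integrable[of "\<lambda>r. f r * E' r" b] z ab
      by (auto simp: set_integrable_def intro!: continuous_intros f_cont c)
    then show "integrable lborel (\<lambda>r. norm (indicator {1<..} r *\<^sub>R (f r * E' r)))" by (rule integrable_norm)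
    have m: "(\<lambda>r. h r * (indicator {1<..} r *\<^sub>R (f r * E' r))) \<in> borel_measurable lborel" if "h \<in> borel_measurable borel" for h
      using that borel_measurable_integrable[OF i] by (intro borel_measurable_times) auto
    show "(\<lambda>r. indicator {1<..} r *\<^sub>R (X n r * (f r * E' r))) \<in> borel_measurable lborel" for n
      using m[of "X n"] Xc(1)[of UNIV n] by (auto simp: mult_ac borel_measurable_continuous_onI)
    show "(\<lambda>r. indicator {1<..} r *\<^sub>R (indicator {d<..} r * (f r * E' r))) \<in> borel_measurable lborel"
      using m[of "indicator {d<..}"] by (auto simp: mult_ac)
    show "AE r in lborel. (\<lambda>n. indicator {1<..} r *\<^sub>R (X n r * (f r * E' r))) \<longlonglongrightarrow> indicator {1<..} r *\<^sub>R (indicator {d<..} r * (f r * E' r))"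
    proof (rule AE_I2)
      fix r :: real
      show "(\<lambda>n. indicator {1<..} r *\<^sub>R (X n r * (f r * E' r))) \<longlonglongrightarrow> indicator {1<..} r *\<^sub>R (indicator {d<..} r * (f r * E' r))"
      proof (cases "r > 1")
        case True
        then show ?thesis unfolding X_def using d by (intro tendsto_scaleR tendsto_mult tendsto_const step_tendsto) auto
      qed simp
    qed
    show "AE r in lborel. norm (indicator {1<..} r *\<^sub>R (X n r * (f r * E' r))) \<le> norm (indicator {1<..} r *\<^sub>R (f r * E' r))" for n
      using S_nonneg S_le_1 by (auto simp: X_def abs_mult indicator_def intro!: mult_left_le_one_le)
  qed
  \<comment> \<open>The derivative of the step concentrates at radius d and leaves the contribution
    of the jump.\<close>
  have lim3: "(\<lambda>n. LINT r:{1<..}|lborel. \<kappa> n r * (f r * E r)) \<longlonglongrightarrow> f d * E d"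
    unfolding \<kappa>_def using d by (intro step_kernel_tendsto continuous_intros f_cont_subset c) auto
  have "(\<lambda>n. - K * A n) \<longlonglongrightarrow> - K * ((LINT r:{1<..}|lborel. indicator {d<..} r * (f r * E' r)) + f d * E d)"
    unfolding A_def by (intro tendsto_mult tendsto_const tendsto_add lim2 lim3)
  then show "(LINT x|M. indicator {d<..} (norm x) * (annular 0 a b (norm x) * (G x \<bullet> x))) =
     - K * ((LINT r:{1<..}|lborel. indicator {d<..} r * (f r * annular' (real DIM('a) / 2) a b r)) + f d * annular (real DIM('a) / 2) a b d)"
    using LIMSEQ_unique[OF lim1] unfolding step by (simp add: e_def E_def E'_def)
qed

end

context radial_robin
begin

text \<open>\<phi> times an annular cutoff is supported away from the unit sphere, so it is
  admissible with trace zero. Its gradient consists of \<eta> G, which produces the energy, and of a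
  radial field, whose pairing with the flux of \<open>G\<close> is known from
  \<open>radial_flux\<close>.\<close>

lemma energy_identity:
  assumes ab: "1 < a" "a < b"
  shows "(LINT x|M. annular c a b (norm x) * norm (G x) powr p) =
     lam * (LINT x|M. Q x * (f (norm x) * annular c a b (norm x))) - (LINT t:{1<..}|lborel. f t * annular' c a b t * k t)"
    and "integrable M (\<lambda>x. annular c a b (norm x) * norm (G x) powr p)"
    and "\<And>h. continuous_on UNIV h \<Longrightarrow> (\<And>r. r \<ge> b \<Longrightarrow> h r = 0) \<Longrightarrow>
       integrable M (\<lambda>x. norm (G x) powr (p - 2) * (G x \<bullet> (h (norm x) *\<^sub>R sgn x)))"
proof -
  have a0: "0 < a" using ab by simp
  note z = annular_zero[OF a0 ab(2), of _ c]
  obtain B where B: "B \<ge> 0" "\<And>r. 0 \<le> r \<Longrightarrow> r \<le> b \<Longrightarrow> \<bar>annular c a b r\<bar> \<le> B"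
    using continuous_bounded_Icc[OF annular_cont[of "{0..b}" c a b]] by metis
  obtain B' where B': "B' \<ge> 0" "\<And>r. 0 \<le> r \<Longrightarrow> r \<le> b \<Longrightarrow> \<bar>annular' c a b r\<bar> \<le> B'"
    using continuous_bounded_Icc[OF annular'_cont[of "{0..b}" c a b]] by metis
  obtain P where P: "P \<ge> 0" "\<And>x. norm x > 1 \<Longrightarrow> norm x \<le> b \<Longrightarrow> \<bar>\<phi> x\<bar> \<le> P" by (rule phi_bounded[of b]) (rule that)
  have Mcomp: "(\<lambda>x. h (norm x)) \<in> borel_measurable M" if "continuous_on UNIV h" for h :: "real \<Rightarrow> real"
    using that by (intro ext_measurable_radial_continuous) (auto intro: continuous_on_subset)
  note Gm [measurable] = G_meas
  have [measurable]: "(\<lambda>x. annular c a b (norm x)) \<in> borel_measurable M" "(\<lambda>x. annular' c a b (norm x)) \<in> borel_measurable M"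
    by (intro Mcomp annular_cont annular'_cont)+
  note [measurable] = phi_meas sgn_meas
  define \<eta> where "\<eta> = (\<lambda>x::'a. annular c a b (norm x))"
  have \<eta>: "test_fun ext_ball \<eta>" unfolding \<eta>_def by (rule annular_test[OF ab])
  define u where "u = (\<lambda>x. \<phi> x * \<eta> x)"
  define H where "H = (\<lambda>x. \<eta> x *\<^sub>R G x + (\<phi> x * annular' c a b (norm x)) *\<^sub>R sgn x)"
  have um: "u \<in> borel_measurable M" unfolding u_def \<eta>_def by measurable
  have Hm: "H \<in> borel_measurable M" unfolding H_def \<eta>_def by measurable
  \<comment> \<open>One identity yields both the weak gradient and the zero trace: whatever \<Phi>
    does at the sphere, \<eta> \<Phi> is a test field inside the exterior domain.\<close>
  have green: "integrable M (\<lambda>x. u x * divergence \<Phi> x)" "(LINT x|M. u x * divergence \<Phi> x + H x \<bullet> \<Phi> x) = 0"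
    "integrable M (\<lambda>x. u x * divergence \<Phi> x + H x \<bullet> \<Phi> x)"
    if \<Phi>: "\<forall>i\<in>Basis. test_fun UNIV (\<lambda>y. \<Phi> y \<bullet> i)" for \<Phi> :: "'a \<Rightarrow> 'a"
  proof -
    obtain R D where RD: "R > 0" "D > 0" "\<And>i x. i \<in> Basis \<Longrightarrow> \<bar>\<Phi> x \<bullet> i\<bar> \<le> D"
      "\<And>i j x. i \<in> Basis \<Longrightarrow> j \<in> Basis \<Longrightarrow> \<bar>partial (\<lambda>y. \<Phi> y \<bullet> i) j x\<bar> \<le> D"
      "\<And>i x. i \<in> Basis \<Longrightarrow> norm x > R \<Longrightarrow> \<Phi> x \<bullet> i = 0"
      "\<And>i j x. i \<in> Basis \<Longrightarrow> norm x > R \<Longrightarrow> partial (\<lambda>y. \<Phi> y \<bullet> i) j x = 0"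
      "\<And>x. norm x > R \<Longrightarrow> \<Phi> x = 0" "\<And>x. norm x > R \<Longrightarrow> divergence \<Phi> x = 0"
      "\<And>x. norm (\<Phi> x) \<le> D" "\<And>x. \<bar>divergence \<Phi> x\<bar> \<le> D"
      by (rule test_field_bounds[OF \<Phi>]) (rule that)
    have \<eta>\<Phi>: "\<forall>i\<in>Basis. test_fun ext_ball (\<lambda>y. (\<eta> y *\<^sub>R \<Phi> y) \<bullet> i)"
      using test_fun_mult[OF \<eta> test_fun_smooth] \<Phi> by auto
    note W = weak_gradient_field[OF \<eta>\<Phi>]
    show i1: "integrable M (\<lambda>x. u x * divergence \<Phi> x)"
    proof (rule ext_integrable_bounded[where R=b and B="P * B * D"])
      show "(\<lambda>x. u x * divergence \<Phi> x) \<in> borel_measurable M"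
        by (intro borel_measurable_times um borel_measurable_ext_ball test_field_borel[OF \<Phi>])
      fix x :: 'a assume x: "norm x > 1"
      show "\<bar>u x * divergence \<Phi> x\<bar> \<le> P * B * D"
      proof (cases "norm x \<le> b")
        case True
        then show ?thesis unfolding u_def \<eta>_def abs_mult using x P B RD by (intro mult_mono mult_nonneg_nonneg) auto
      qed (use z[of "norm x"] P B RD in \<open>simp add: u_def \<eta>_def\<close>)
    qed (use z in \<open>simp add: u_def \<eta>_def\<close>)
    have eq: "u x * divergence \<Phi> x + H x \<bullet> \<Phi> x = \<phi> x * divergence (\<lambda>y. \<eta> y *\<^sub>R \<Phi> y) x + G x \<bullet> (\<eta> x *\<^sub>R \<Phi> x)"
      if "norm x > 1" for x
    proof -
      have x0: "x \<noteq> 0" using that by auto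
      have "divergence (\<lambda>y. annular c a b (norm y) *\<^sub>R \<Phi> y) x = annular c a b (norm x) * divergence \<Phi> x + annular' c a b (norm x) * (sgn x \<bullet> \<Phi> x)"
        by (rule divergence_radial_times[OF x0 annular_deriv]) (use \<Phi> in \<open>auto intro: test_fun_smooth\<close>)
      then show ?thesis by (simp add: u_def H_def \<eta>_def inner_add_left algebra_simps)
    qed
    have "integrable M (\<lambda>x. \<phi> x * divergence (\<lambda>y. \<eta> y *\<^sub>R \<Phi> y) x + G x \<bullet> (\<eta> x *\<^sub>R \<Phi> x))"
      by (intro Bochner_Integration.integrable_add W)
    then show "integrable M (\<lambda>x. u x * divergence \<Phi> x + H x \<bullet> \<Phi> x)"
      by (subst Bochner_Integration.integrable_cong[OF refl eq]) (auto simp: ext_ball_def)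
    have "(LINT x|M. u x * divergence \<Phi> x + H x \<bullet> \<Phi> x) =
      (LINT x|M. \<phi> x * divergence (\<lambda>y. \<eta> y *\<^sub>R \<Phi> y) x + G x \<bullet> (\<eta> x *\<^sub>R \<Phi> x))"
      by (rule Bochner_Integration.integral_cong[OF refl eq]) (simp add: ext_ball_def)
    also have "\<dots> = 0" using W by (subst Bochner_Integration.integral_add) auto
    finally show "(LINT x|M. u x * divergence \<Phi> x + H x \<bullet> \<Phi> x) = 0" .
  qed
  have wg: "weak_grad ext_ball u H"
    unfolding weak_grad_def
  proof (intro allI impI ballI)
    fix \<psi> :: "'a \<Rightarrow> real" and i :: 'a
    assume \<psi>: "test_fun ext_ball \<psi>" and i: "i \<in> Basis"
    have \<Psi>: "\<forall>j\<in>Basis. test_fun UNIV (\<lambda>y. (\<psi> y *\<^sub>R i) \<bullet> j)"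
      by (rule test_field_basis(1)[OF test_fun_mono[OF \<psi> subset_UNIV] i])
    note gr = green[OF \<Psi>, unfolded test_field_basis(2)[OF \<psi> i]]
    have "(LINT x|M. (H x \<bullet> i) * \<psi> x) = (LINT x|M. (u x * partial \<psi> i x + H x \<bullet> (\<psi> x *\<^sub>R i)) - u x * partial \<psi> i x)"
      by (intro Bochner_Integration.integral_cong) auto
    also have "\<dots> = - (LINT x|M. u x * partial \<psi> i x)"
      using Bochner_Integration.integral_diff[OF gr(3,1)] gr(2) by simp
    finally show "(LINT x|M. u x * partial \<psi> i x) = - (LINT x|M. (H x \<bullet> i) * \<psi> x)" by simp
  qed
  have Wp: "W1p_grad p ext_ball u H"
    unfolding W1p_grad_def Lp_on_def
  proof (intro conjI um wg Hm)
    show "integrable M (\<lambda>x. \<bar>u x\<bar> powr p)"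
    proof (rule ext_integrable_bounded[where R=b and B="(P * B) powr p"])
      show "(\<lambda>x. \<bar>u x\<bar> powr p) \<in> borel_measurable M" using um by measurable
      fix x :: 'a assume x: "norm x > 1"
      show "\<bar>\<bar>u x\<bar> powr p\<bar> \<le> (P * B) powr p"
      proof (cases "norm x \<le> b")
        case True
        then have "\<bar>u x\<bar> \<le> P * B" unfolding u_def \<eta>_def abs_mult using x P B by (intro mult_mono) auto
        then show ?thesis using p1 by (auto intro!: powr_mono2)
      qed (use z[of "norm x"] p1 in \<open>simp add: u_def \<eta>_def\<close>)
    qed (use z p1 in \<open>simp add: u_def \<eta>_def\<close>)
    show "integrable M (\<lambda>x. norm (H x) powr p)"
    proof (rule dominated_by_G[where R=b and B="2 powr p * (P * B') powr p" and C="2 powr p * B powr p"])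
      show "(\<lambda>x. norm (H x) powr p) \<in> borel_measurable M" using Hm by measurable
      fix x :: 'a assume x: "norm x > 1"
      show "norm (H x) powr p = 0" if "norm x > b"
        using z[of "norm x"] that p1 by (simp add: H_def \<eta>_def)
      assume xb: "norm x \<le> b"
      have "norm (H x) \<le> B * norm (G x) + P * B'"
      proof -
        have "norm (\<eta> x *\<^sub>R G x) \<le> B * norm (G x)" using B x xb by (auto simp: \<eta>_def intro!: mult_right_mono)
        moreover have "norm ((\<phi> x * annular' c a b (norm x)) *\<^sub>R sgn x) \<le> P * B'"
        proof -
          have "\<bar>\<phi> x\<bar> * \<bar>annular' c a b (norm x)\<bar> \<le> P * B'" using P B' x xb by (intro mult_mono) auto
          then show ?thesis using x by (auto simp: abs_mult norm_sgn)
        qed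
        ultimately show ?thesis unfolding H_def by (intro order_trans[OF norm_triangle_ineq] add_mono)
      qed
      then have "norm (H x) powr p \<le> (B * norm (G x) + P * B') powr p" using p1 by (intro powr_mono2) auto
      also have "\<dots> \<le> 2 powr p * ((B * norm (G x)) powr p + (P * B') powr p)"
        using B P B' p1 by (intro add_powr_le) auto
      also have "\<dots> = 2 powr p * (P * B') powr p + 2 powr p * B powr p * norm (G x) powr p"
        using B by (simp add: powr_mult algebra_simps)
      finally show "\<bar>norm (H x) powr p\<bar> \<le> 2 powr p * (P * B') powr p + 2 powr p * B powr p * norm (G x) powr p" by simp
    qed auto
  qed
  have Tr: "trace_ext p u H (\<lambda>_. 0)"
    unfolding trace_ext_def using green(2) sphere_integrable_bounded[of "\<lambda>_::'a. 0::real" 0] p1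
    by (auto simp: sphere_int_def sphere_integrable_def)
  have E: "(LINT x|M. norm (G x) powr (p - 2) * (G x \<bullet> H x)) = lam * (LINT x|M. Q x * u x)"
    using weak[OF Wp Tr] by (simp add: sphere_int_def Q_def)
  show iG: "integrable M (\<lambda>x. annular c a b (norm x) * norm (G x) powr p)"
  proof (rule dominated_by_G[where R=b and B=0 and C=B])
    show "(\<lambda>x. annular c a b (norm x) * norm (G x) powr p) \<in> borel_measurable M" by measurable
    show "\<bar>annular c a b (norm x) * norm (G x) powr p\<bar> \<le> 0 + B * norm (G x) powr p" if "norm x \<le> b" for x
      using that B by (auto simp: abs_mult intro!: mult_right_mono)
  qed (use z B in auto)
  show iR: "integrable M (\<lambda>x. norm (G x) powr (p - 2) * (G x \<bullet> (h (norm x) *\<^sub>R sgn x)))"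
    if h: "continuous_on UNIV h" and hz: "\<And>r. r \<ge> b \<Longrightarrow> h r = 0" for h
  proof -
    obtain L where L: "L \<ge> 0" "\<And>r. 0 \<le> r \<Longrightarrow> r \<le> b \<Longrightarrow> \<bar>h r\<bar> \<le> L"
      using continuous_bounded_Icc[OF continuous_on_subset[OF h], of 0 b] by auto
    show ?thesis
    proof (rule dominated_by_G[where R=b and B=L and C=L])
      have "(\<lambda>x. h (norm x)) \<in> borel_measurable M" by (rule Mcomp[OF h])
      then show "(\<lambda>x. norm (G x) powr (p - 2) * (G x \<bullet> (h (norm x) *\<^sub>R sgn x))) \<in> borel_measurable M" by measurable
      fix x :: 'a assume x: "norm x > 1" "norm x \<le> b"
      have "\<bar>G x \<bullet> sgn x\<bar> \<le> norm (G x)" using abs_inner_sgn_le[of x "G x"] by (simp add: inner_commute)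
      then have "norm (G x) powr (p - 2) * \<bar>G x \<bullet> sgn x\<bar> \<le> norm (G x) powr (p - 2) * norm (G x)"
        by (intro mult_left_mono) auto
      also have "\<dots> = norm (G x) powr (p - 1)" by (rule norm_powr_mult_self(1)[OF p1])
      also have "\<dots> \<le> 1 + norm (G x) powr p"
      proof (cases "norm (G x) \<le> 1")
        case True
        then have "norm (G x) powr (p - 1) \<le> 1" using p1 by (intro powr_le1) auto
        then show ?thesis using powr_ge_zero[of "norm (G x)" p] by linarith
      next
        case False
        then have "norm (G x) powr (p - 1) \<le> norm (G x) powr p" by (intro powr_mono) auto
        then show ?thesis by simp
      qed
      finally have "\<bar>h (norm x)\<bar> * (norm (G x) powr (p - 2) * \<bar>G x \<bullet> sgn x\<bar>) \<le> L * (1 + norm (G x) powr p)"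
        using L x by (intro mult_mono) auto
      then show "\<bar>norm (G x) powr (p - 2) * (G x \<bullet> (h (norm x) *\<^sub>R sgn x))\<bar> \<le> L + L * norm (G x) powr p"
        by (simp add: abs_mult algebra_simps)
    qed (use hz L in auto)
  qed
  \<comment> \<open>The maxima extend the radial factor continuously to the whole line, as
    \<open>radial_flux\<close> asks; for r > 1 they change nothing.\<close>
  define h where "h = (\<lambda>r. f (max 1 r) * annular' c a b (max 0 r))"
  have hc: "continuous_on UNIV h" unfolding h_def by (intro continuous_intros f_max_cont)
  have hz: "h r = 0" if "r \<ge> b" for r using z[of "max 0 r"] that ab by (simp add: h_def)
  have "(LINT x|M. norm (G x) powr (p - 2) * (G x \<bullet> H x)) =
    (LINT x|M. annular c a b (norm x) * norm (G x) powr p + norm (G x) powr (p - 2) * (G x \<bullet> (h (norm x) *\<^sub>R sgn x)))"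
  proof (rule Bochner_Integration.integral_cong[OF refl])
    fix x assume "x \<in> space M"
    then have x: "norm x > 1" by (simp add: ext_ball_def)
    have "norm (G x) powr (p - 2) * (G x \<bullet> G x) = norm (G x) powr p"
      using norm_powr_mult_self(2)[OF p1, of "G x"] by (simp add: dot_square_norm)
    then show "norm (G x) powr (p - 2) * (G x \<bullet> H x) =
      annular c a b (norm x) * norm (G x) powr p + norm (G x) powr (p - 2) * (G x \<bullet> (h (norm x) *\<^sub>R sgn x))"
      using x by (simp add: H_def h_def \<eta>_def phi_eq inner_add_right algebra_simps)
  qed
  also have "\<dots> = (LINT x|M. annular c a b (norm x) * norm (G x) powr p) + (LINT t:{1<..}|lborel. h t * k t)"
    using radial_flux[OF hc hz] by (subst Bochner_Integration.integral_add[OF iG iR[OF hc hz]]) auto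
  also have "(LINT t:{1<..}|lborel. h t * k t) = (LINT t:{1<..}|lborel. f t * annular' c a b t * k t)"
    by (rule set_lebesgue_integral_cong) (auto simp: h_def)
  finally have "(LINT x|M. annular c a b (norm x) * norm (G x) powr p) = lam * (LINT x|M. Q x * u x) - (LINT t:{1<..}|lborel. f t * annular' c a b t * k t)"
    using E by simp
  also have "(LINT x|M. Q x * u x) = (LINT x|M. Q x * (f (norm x) * annular c a b (norm x)))"
    by (rule Bochner_Integration.integral_cong) (auto simp: u_def \<eta>_def phi_eq ext_ball_def)
  finally show "(LINT x|M. annular c a b (norm x) * norm (G x) powr p) =
     lam * (LINT x|M. Q x * (f (norm x) * annular c a b (norm x))) - (LINT t:{1<..}|lborel. f t * annular' c a b t * k t)" .
qed

text \<open>Integrating the jump identity against the density of k: the weak gradient tested with the radial flux field.\<close>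
lemma flux_identity:
  assumes ab: "1 < a" "a < b"
  defines "c \<equiv> real DIM('a) / 2"
  shows "(LINT x|M. annular 0 a b (norm x) * (G x \<bullet> x) * k (norm x)) = K * (LINT x|M. annular c a b (norm x) * norm (G x) powr p)"
proof -
  have a0: "0 < a" using ab by simp
  note z = annular_zero[OF a0 ab(2)]
  define F where "F = (\<lambda>x. annular 0 a b (norm x) * (G x \<bullet> x))"
  have Fi: "integrable M F" unfolding F_def by (rule sphere_jump(2)[OF ab, of 1]) simp
  have Fz: "F x = 0" if "norm x \<ge> b" for x using z[of "norm x"] that by (simp add: F_def)
  \<comment> \<open>The cut makes \<open>Q\<close> integrable. As the bump inside \<open>F\<close>
    and \<open>H\<close> vanishes from b on, only radii up to b matter.\<close>
  define Qb where "Qb = (\<lambda>x::'a. indicator {..<b} (norm x) * Q x)"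
  have Qi: "integrable M Qb" unfolding Qb_def by (rule Q_int_less)
  define H where "H = (\<lambda>r. indicator {1<..} r * (f r * annular' c a b r))"
  have H0: "set_integrable lborel {1<..} (\<lambda>r. f r * annular' c a b r)"
    by (rule continuous_cutoff_integrable[where b=b]) (use z ab in \<open>auto intro!: continuous_intros f_cont\<close>)
  have Hi: "integrable lborel H" using H0 by (simp add: set_integrable_def H_def)
  have Hz: "H r = 0" if "r \<ge> b" for r using z[of r] that ab by (simp add: H_def)
  have jump: "(LINT x|M. indicator {d<..} (norm x) * F x) = - K * ((LINT r|lborel. indicator {d<..} r * H r) + f d * annular c a b d)"
    if "d \<ge> 1" for d
  proof -
    have "(LINT r:{1<..}|lborel. indicator {d<..} r * (f r * annular' c a b r)) = (LINT r|lborel. indicator {d<..} r * H r)"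
      unfolding set_lebesgue_integral_def by (intro Bochner_Integration.integral_cong) (auto simp: H_def indicator_def)
    then show ?thesis using sphere_jump(1)[OF ab that] by (simp add: F_def c_def)
  qed
  \<comment> \<open>A jump at d = 1 accounts for the constant part \<beta> \<tau> of
    \<open>k\<close>. The bump vanishes at 1, so there is no jump term.\<close>
  have F1: "(LINT x|M. F x) = - K * (LINT r|lborel. H r)"
  proof -
    have "(LINT x|M. F x) = (LINT x|M. indicator {1<..} (norm x) * F x)"
      by (rule Bochner_Integration.integral_cong) (auto simp: ext_ball_def)
    moreover have "(LINT r|lborel. indicator {1<..} r * H r) = (LINT r|lborel. H r)"
      by (rule Bochner_Integration.integral_cong) (auto simp: H_def indicator_def)
    ultimately show ?thesis using jump[of 1] z[of 1 c] ab by simp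
  qed
  have fub1: "(LINT y|M. Qb y * (LINT x|M. indicator {norm y<..} (norm x) * F x)) =
     (LINT x|M. F x * (LINT y|M. indicator {..<norm x} (norm y) * Qb y))"
    by (rule fubini_level_sets[OF sigma_finite_ext_ball sigma_finite_ext_ball Qi Fi]) measurable
  have fub2: "(LINT y|M. Qb y * (LINT r|lborel. indicator {norm y<..} r * H r)) =
     (LINT r|lborel. H r * (LINT y|M. indicator {..<r} (norm y) * Qb y))"
    by (rule fubini_level_sets[OF sigma_finite_ext_ball sigma_finite_lborel Qi Hi]) measurable
  define q where "q = (\<lambda>t. LINT y|M. indicator {..<t} (norm y) * Q y)"
  have qb: "(LINT y|M. indicator {..<t} (norm y) * Qb y) = q t" if "t \<le> b" for t
    unfolding q_def using that by (intro Bochner_Integration.integral_cong) (auto simp: Qb_def indicator_def)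
  have Hq: "H r * (LINT y|M. indicator {..<r} (norm y) * Qb y) = H r * q r" for r
    using qb[of r] Hz[of r] by (cases "r \<le> b") auto
  have Fq: "F x * (LINT y|M. indicator {..<norm x} (norm y) * Qb y) = F x * q (norm x)" for x
    using qb[of "norm x"] Fz[of x] by (cases "norm x \<le> b") auto
  obtain B where B: "B \<ge> 0" "\<And>x. norm x > 1 \<Longrightarrow> norm x \<le> b \<Longrightarrow> \<bar>Q x\<bar> \<le> B" by (rule Q_bounded[of b]) (rule that)
  have Ecut: "integrable M (\<lambda>y. Q y * (f (norm y) * annular c a b (norm y)))"
  proof -
    obtain L where L: "L \<ge> 0" "\<And>r. 1 \<le> r \<Longrightarrow> r \<le> b \<Longrightarrow> \<bar>f r * annular c a b r\<bar> \<le> L"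
    proof -
      have "continuous_on {1..b} (\<lambda>r. f r * annular c a b r)"
        by (intro continuous_intros f_cont_subset) auto
      then show ?thesis by (rule continuous_bounded_Icc) (rule that)
    qed
    show ?thesis
    proof (rule ext_integrable_bounded[where R=b and B="B * L"])
      have "(\<lambda>y. f (norm y) * annular c a b (norm y)) \<in> borel_measurable M"
        by (rule ext_measurable_radial_continuous) (auto intro!: continuous_intros f_cont_subset)
      then show "(\<lambda>y. Q y * (f (norm y) * annular c a b (norm y))) \<in> borel_measurable M" by measurable
      fix x :: 'a assume x: "norm x > 1"
      show "\<bar>Q x * (f (norm x) * annular c a b (norm x))\<bar> \<le> B * L"
      proof (cases "norm x \<le> b")
        case True
        then show ?thesis unfolding abs_mult[of "Q x"] using x B L by (intro mult_mono) auto
      qed (use z[of "norm x"] B L in simp)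
    qed (use z in simp)
  qed
  define J where "J = (LINT y|M. Q y * (f (norm y) * annular c a b (norm y)))"
  have ml: "(\<lambda>y. LINT r|lborel. indicator {norm y<..} r * H r) \<in> borel_measurable M"
  proof -
    interpret sigma_finite_measure "lborel :: real measure" by (rule sigma_finite_lborel)
    have [measurable]: "H \<in> borel_measurable borel" using Hi by auto
    have "(\<lambda>y::'a. LINT r|lborel. indicator {z. 0 < z} (r - norm y) * H r) \<in> borel_measurable M" by measurable
    also have "(\<lambda>y::'a. LINT r|lborel. indicator {z. 0 < z} (r - norm y) * H r) = (\<lambda>y. LINT r|lborel. indicator {norm y<..} r * H r)"
      by (intro ext Bochner_Integration.integral_cong) (auto simp: indicator_def)
    finally show ?thesis .
  qed
  have i1: "integrable M (\<lambda>y. Qb y * (LINT r|lborel. indicator {norm y<..} r * H r))"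
  proof (rule Bochner_Integration.integrable_bound)
    show "integrable M (\<lambda>y. Qb y * (LINT r|lborel. norm (H r)))" using Qi by simp
    show "(\<lambda>y. Qb y * (LINT r|lborel. indicator {norm y<..} r * H r)) \<in> borel_measurable M"
      by (rule borel_measurable_times[OF borel_measurable_integrable[OF Qi] ml])
    have "norm (LINT r|lborel. indicator {norm y<..} r * H r) \<le> (LINT r|lborel. norm (H r))" for y :: 'a
    proof (rule order_trans[OF integral_norm_bound integral_mono])
      show "integrable lborel (\<lambda>r. norm (indicator {norm y<..} r * H r))"
      proof (rule integrable_norm, rule Bochner_Integration.integrable_bound[OF Hi])
        show "(\<lambda>r. indicator {norm y<..} r * H r) \<in> borel_measurable lborel"
          using borel_measurable_integrable[OF Hi] by (intro borel_measurable_times) auto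
      qed (auto simp: indicator_def)
    qed (use Hi in \<open>auto simp: indicator_def\<close>)
    then show "AE y in M. norm (Qb y * (LINT r|lborel. indicator {norm y<..} r * H r)) \<le> norm (Qb y * (LINT r|lborel. norm (H r)))"
      by (intro AE_I2) (auto simp: abs_mult intro!: mult_left_mono intro: order_trans)
  qed
  \<comment> \<open>The nonconstant part of \<open>k\<close>: the jump identity is used at d = |y|
    and integrated against Q(y). Its jump term f(|y|) times the bump becomes \<open>J\<close>, the
    right-hand side of the energy identity up to the factor \<open>lam\<close>.\<close>
  have main: "(LINT x|M. F x * q (norm x)) = - K * ((LINT r|lborel. H r * q r) + J)"
  proof -
    have "(LINT x|M. F x * q (norm x)) = (LINT y|M. Qb y * (LINT x|M. indicator {norm y<..} (norm x) * F x))"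
      unfolding fub1 Fq ..
    also have "\<dots> = (LINT y|M. - K * (Qb y * (LINT r|lborel. indicator {norm y<..} r * H r) + Q y * (f (norm y) * annular c a b (norm y))))"
    proof (rule Bochner_Integration.integral_cong[OF refl])
      fix y assume "y \<in> space M"
      then have y: "norm y > 1" by (simp add: ext_ball_def)
      have eqc: "Qb y * annular c a b (norm y) = Q y * annular c a b (norm y)"
        using z[of "norm y"] by (auto simp: Qb_def indicator_def not_less)
      let ?X = "LINT r|lborel. indicator {norm y<..} r * H r"
      have "Qb y * (- K * (?X + f (norm y) * annular c a b (norm y))) = - K * (Qb y * ?X + f (norm y) * (Qb y * annular c a b (norm y)))"
        by (simp only: algebra_simps)
      also have "\<dots> = - K * (Qb y * ?X + Q y * (f (norm y) * annular c a b (norm y)))"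
        unfolding eqc by (simp only: mult_ac)
      finally show "Qb y * (LINT x|M. indicator {norm y<..} (norm x) * F x) =
        - K * (Qb y * (LINT r|lborel. indicator {norm y<..} r * H r) + Q y * (f (norm y) * annular c a b (norm y)))"
        unfolding jump[OF less_imp_le[OF y]] .
    qed
    also have "\<dots> = - K * ((LINT y|M. Qb y * (LINT r|lborel. indicator {norm y<..} r * H r)) + J)"
      unfolding J_def using i1 Ecut by simp
    finally show ?thesis unfolding fub2 Hq .
  qed
  have keq: "k t = \<beta> * \<tau> - lam * q t" for t by (simp add: k_def q_def)
  have qcont: "continuous_on {1..} (\<lambda>t. lam * q t)"
  proof -
    have eq: "(\<lambda>t. lam * q t) = (\<lambda>t. \<beta> * \<tau> - k t)" by (simp add: keq fun_eq_iff)
    show ?thesis unfolding eq by (intro continuous_intros k_cont)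
  qed
  have Hk: "integrable lborel (\<lambda>r. H r * (lam * q r))"
  proof -
    have "set_integrable lborel {1<..} (\<lambda>r. f r * annular' c a b r * (lam * q r))"
      by (rule continuous_cutoff_integrable[where b=b]) (use z ab in \<open>auto intro!: continuous_intros f_cont qcont\<close>)
    then show ?thesis by (simp add: set_integrable_def H_def mult.assoc)
  qed
  have Fk: "integrable M (\<lambda>x. F x * (lam * q (norm x)))"
  proof -
    obtain L where L: "L \<ge> 0" "\<And>r. 1 \<le> r \<Longrightarrow> r \<le> b \<Longrightarrow> \<bar>lam * q r\<bar> \<le> L"
      using continuous_bounded_Icc[of 1 b "\<lambda>r. lam * q r"] continuous_on_subset[OF qcont, of "{1..b}"] by auto
    show ?thesis
    proof (rule Bochner_Integration.integrable_bound)
      show "integrable M (\<lambda>x. F x * L)" using Fi by simp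
      have "(\<lambda>x. lam * q (norm x)) \<in> borel_measurable M"
        by (rule ext_measurable_radial_continuous[of "\<lambda>t. lam * q t"]) (auto intro: continuous_on_subset[OF qcont])
      then show "(\<lambda>x. F x * (lam * q (norm x))) \<in> borel_measurable M"
        by (rule borel_measurable_times[OF borel_measurable_integrable[OF Fi]])
      show "AE x in M. norm (F x * (lam * q (norm x))) \<le> norm (F x * L)"
      proof (rule AE_I2)
        fix x assume "x \<in> space M"
        then have x: "norm x > 1" by (simp add: ext_ball_def)
        show "norm (F x * (lam * q (norm x))) \<le> norm (F x * L)"
        proof (cases "norm x \<le> b")
          case True
          then have "\<bar>F x\<bar> * \<bar>lam * q (norm x)\<bar> \<le> \<bar>F x\<bar> * L" using L x by (intro mult_left_mono) auto
          then show ?thesis using L(1) by (simp add: abs_mult)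
        qed (use Fz[of x] in simp)
      qed
    qed
  qed
  have "(LINT x|M. F x * k (norm x)) = (LINT x|M. F x * (\<beta> * \<tau>) - F x * (lam * q (norm x)))"
    by (rule Bochner_Integration.integral_cong) (auto simp: keq algebra_simps)
  also have "\<dots> = (LINT x|M. F x) * (\<beta> * \<tau>) - lam * (LINT x|M. F x * q (norm x))"
    using Fi Fk by (subst Bochner_Integration.integral_diff) (auto simp: mult.left_commute)
  also have "\<dots> = K * (lam * J - (LINT r|lborel. H r) * (\<beta> * \<tau>) + lam * (LINT r|lborel. H r * q r))"
    unfolding F1 main by (simp add: algebra_simps)
  also have "(LINT r|lborel. H r) * (\<beta> * \<tau>) = (LINT r|lborel. H r * k r) + lam * (LINT r|lborel. H r * q r)"
  proof -
    have "(LINT r|lborel. H r * k r) = (LINT r|lborel. H r * (\<beta> * \<tau>) - H r * (lam * q r))"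
      by (rule Bochner_Integration.integral_cong) (auto simp: keq algebra_simps)
    also have "\<dots> = (LINT r|lborel. H r) * (\<beta> * \<tau>) - lam * (LINT r|lborel. H r * q r)"
      using Hi Hk by (subst Bochner_Integration.integral_diff) (auto simp: mult.left_commute)
    finally show ?thesis by simp
  qed
  also have "(LINT r|lborel. H r * k r) = (LINT t:{1<..}|lborel. f t * annular' c a b t * k t)"
    by (simp add: set_lebesgue_integral_def H_def mult.assoc)
  finally have "(LINT x|M. F x * k (norm x)) = K * (lam * J - (LINT t:{1<..}|lborel. f t * annular' c a b t * k t))" by simp
  \<comment> \<open>The remaining bracket is the weighted energy obtained from the test with \<phi>
    times the cutoff.\<close>
  then show ?thesis using energy_identity(1)[OF ab, of c] by (simp add: F_def J_def)
qed

end

section \<open>Identification of the weak gradient by monotonicity\<close>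

lemma signed_powr_cont: "q > 0 \<Longrightarrow> continuous_on UNIV (\<lambda>z::real. sgn z * \<bar>z\<bar> powr q)"
proof -
  assume q: "q > 0"
  \<comment> \<open>Splitting into positive and negative parts avoids the discontinuity of
    \<open>sgn\<close> at 0.\<close>
  have "(\<lambda>z::real. sgn z * \<bar>z\<bar> powr q) = (\<lambda>z. max z 0 powr q - max (- z) 0 powr q)"
    by (rule ext) (auto simp: sgn_if max_def)
  moreover have "continuous_on UNIV (\<lambda>z::real. max z 0 powr q - max (- z) 0 powr q)"
    using q by (intro continuous_intros continuous_on_powr') auto
  ultimately show ?thesis by (simp only:)
qed

context radial_robin
begin

text \<open>\<open>w\<close> is the flux per unit area of the sphere of radius r. \<open>v\<close>
  solves |v|^(p-2) v = w, since the inverse of |z|^(p-2) z raises |z| to the power 1/(p-1) and keeps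
  the sign. \<open>V\<close> is the corresponding radial field, the candidate for the
  gradient.\<close>

definition w :: "real \<Rightarrow> real" where "w r = k r / (K * r ^ (DIM('a) - 1))"
definition v :: "real \<Rightarrow> real" where "v r = sgn (w r) * \<bar>w r\<bar> powr (1 / (p - 1))"
definition V :: "'a \<Rightarrow> 'a" where "V x = v (norm x) *\<^sub>R sgn x"

lemma w_cont: "A \<subseteq> {1..} \<Longrightarrow> continuous_on A w"
proof -
  have "continuous_on {1..} w"
    unfolding w_def using K_pos by (intro continuous_intros k_cont) auto
  then show "A \<subseteq> {1..} \<Longrightarrow> continuous_on A w" by (rule continuous_on_subset)
qed

lemma v_cont: "A \<subseteq> {1..} \<Longrightarrow> continuous_on A v"
  unfolding v_def using p1 w_cont by (intro continuous_on_compose2[OF signed_powr_cont]) auto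

lemma v_max_cont: "continuous_on A (\<lambda>r. v (max 1 r))"
  by (rule continuous_on_compose2[OF v_cont[OF subset_refl]]) (auto intro!: continuous_intros)

lemma v_power: "\<bar>v r\<bar> powr (p - 2) * v r = w r"
proof (cases "w r = 0")
  case False
  have "\<bar>v r\<bar> = \<bar>w r\<bar> powr (1 / (p - 1))" using False by (simp add: v_def abs_mult abs_sgn_eq)
  then have "\<bar>v r\<bar> powr (p - 2) * v r = sgn (w r) * (\<bar>w r\<bar> powr ((1 / (p - 1)) * (p - 2)) * \<bar>w r\<bar> powr (1 / (p - 1)))"
    by (simp add: v_def powr_powr)
  also have "\<bar>w r\<bar> powr ((1 / (p - 1)) * (p - 2)) * \<bar>w r\<bar> powr (1 / (p - 1)) = \<bar>w r\<bar> powr 1"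
  proof -
    have "(1 / (p - 1)) * (p - 2) + 1 / (p - 1) = 1" using p1 by (simp add: field_simps)
    then show ?thesis by (simp only: powr_add[symmetric])
  qed
  finally show ?thesis using sgn_mult_abs[of "w r"] by simp
qed (simp add: v_def)

lemma V_norm: "norm x > 1 \<Longrightarrow> norm (V x) = \<bar>v (norm x)\<bar>"
  by (auto simp: V_def norm_sgn)

lemma V_power: "norm x > 1 \<Longrightarrow> (norm (V x) powr (p - 2)) *\<^sub>R V x = w (norm x) *\<^sub>R sgn x"
  using v_power[of "norm x"] by (simp add: V_norm) (simp add: V_def)

text \<open>Minty's trick: the monotone difference integrates to zero because all four cross terms are known.\<close>
lemma G_eq_V_annulus:
  assumes ab: "1 < a" "a < b"
  shows "AE x in M. a < norm x \<and> norm x < b \<longrightarrow> G x = V x"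
proof -
  let ?c = "real DIM('a) / 2"
  have a0: "0 < a" using ab by simp
  note z = annular_zero[OF a0 ab(2), of _ ?c]
  define E where "E = (\<lambda>x::'a. annular ?c a b (norm x))"
  define D where "D = (\<lambda>x. ((norm (G x) powr (p - 2)) *\<^sub>R G x - (norm (V x) powr (p - 2)) *\<^sub>R V x) \<bullet> (G x - V x))"
  \<comment> \<open>The radial weight of the cross term |G|^(p-2) G . V, which
    \<open>radial_flux\<close> evaluates.\<close>
  define h where "h = (\<lambda>r. v (max 1 r) * annular ?c a b (max 0 r))"
  have hc: "continuous_on UNIV h" unfolding h_def by (intro continuous_intros v_max_cont)
  have hz: "h r = 0" if "r \<ge> b" for r using z[of "max 0 r"] that ab by (simp add: h_def)
  note i1 = energy_identity(2)[OF ab, of ?c]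
  note i2 = energy_identity(3)[OF ab hc hz]
  \<comment> \<open>Divided by K this is the other cross term, |V|^(p-2) V . G with weight E: the
    weight E has the factor r^N, while \<open>w\<close> contributes r^(1-N) and the normalisation of
    x contributes 1/r.\<close>
  define F where "F = (\<lambda>x. annular 0 a b (norm x) * (G x \<bullet> x) * k (norm x))"
  have i3: "integrable M F"
  proof -
    note Fi = sphere_jump(2)[OF ab order_refl]
    obtain L where L: "L \<ge> 0" "\<And>r. 1 \<le> r \<Longrightarrow> r \<le> b \<Longrightarrow> \<bar>k r\<bar> \<le> L"
      using continuous_bounded_Icc[of 1 b k] continuous_on_subset[OF k_cont, of "{1..b}"] by auto
    show ?thesis
    proof (rule Bochner_Integration.integrable_bound)
      show "integrable M (\<lambda>x. (annular 0 a b (norm x) * (G x \<bullet> x)) * L)" using Fi by simp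
      have "(\<lambda>x. k (norm x)) \<in> borel_measurable M"
        by (rule ext_measurable_radial_continuous) (auto intro: continuous_on_subset[OF k_cont])
      then show "F \<in> borel_measurable M" unfolding F_def
        by (rule borel_measurable_times[OF borel_measurable_integrable[OF Fi]])
      show "AE x in M. norm (F x) \<le> norm ((annular 0 a b (norm x) * (G x \<bullet> x)) * L)"
      proof (rule AE_I2)
        fix x assume "x \<in> space M"
        then have x: "norm x > 1" by (simp add: ext_ball_def)
        show "norm (F x) \<le> norm ((annular 0 a b (norm x) * (G x \<bullet> x)) * L)"
        proof (cases "norm x \<le> b")
          case True
          then have "\<bar>annular 0 a b (norm x) * (G x \<bullet> x)\<bar> * \<bar>k (norm x)\<bar> \<le> \<bar>annular 0 a b (norm x) * (G x \<bullet> x)\<bar> * L"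
            using L x by (intro mult_left_mono) auto
          then show ?thesis using L(1) by (simp only: F_def real_norm_def abs_mult[of _ "k _"] abs_mult[of _ L] abs_of_nonneg[OF L(1)])
        qed (use annular_zero[OF a0 ab(2), of "norm x" 0] in \<open>simp add: F_def\<close>)
      qed
    qed
  qed
  \<comment> \<open>The radial profile of the weighted |V|^p, which equals w v.\<close>
  define H where "H = (\<lambda>r. w r * v r * annular ?c a b r)"
  have Hc: "continuous_on {1..} H" unfolding H_def by (intro continuous_intros w_cont v_cont) auto
  have Hz: "H r = 0" if "r \<ge> b" for r using z[of r] that ab by (simp add: H_def)
  note i4 = ext_radial_integral(2)[OF Hc Hz]
  have eq: "E x * D x = (E x * norm (G x) powr p - F x / K) -
      (norm (G x) powr (p - 2) * (G x \<bullet> (h (norm x) *\<^sub>R sgn x)) - H (norm x))" if x: "norm x > 1" for x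
  proof -
    have x0: "norm x > 0" "x \<noteq> 0" using x by auto
    have gg: "norm (G x) powr (p - 2) * (G x \<bullet> G x) = norm (G x) powr p"
      using norm_powr_mult_self(2)[OF p1, of "G x"] by (simp add: dot_square_norm)
    have ss: "sgn x \<bullet> sgn x = 1" using x0 by (simp add: dot_square_norm norm_sgn)
    have D1: "D x = norm (G x) powr p - norm (G x) powr (p - 2) * v (norm x) * (G x \<bullet> sgn x)
        - w (norm x) * (G x \<bullet> sgn x) + w (norm x) * v (norm x)"
      unfolding D_def V_power[OF x] gg[symmetric] 
      by (simp add: V_def inner_diff_left inner_diff_right ss inner_commute algebra_simps)
    have Fx: "F x / K = E x * w (norm x) * (G x \<bullet> sgn x)"
    proof -
      have rN: "norm x ^ DIM('a) = norm x * norm x ^ (DIM('a) - 1)" by (metis DIM_positive power_minus_mult mult.commute)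
      have "G x \<bullet> sgn x = (G x \<bullet> x) / norm x" by (simp add: sgn_div_norm divide_inverse mult.commute)
      then show ?thesis using x0 K_pos unfolding F_def E_def w_def annular_shift(1)[OF x0(1)] rN by simp
    qed
    show ?thesis unfolding Fx D1 using x by (simp add: h_def H_def E_def algebra_simps)
  qed
  have i12: "integrable M (\<lambda>x. E x * norm (G x) powr p - F x / K)"
    unfolding E_def using i1 i3 by simp
  have i34: "integrable M (\<lambda>x. norm (G x) powr (p - 2) * (G x \<bullet> (h (norm x) *\<^sub>R sgn x)) - H (norm x))"
    using i2 i4 by simp
  have iD: "integrable M (\<lambda>x. E x * D x)"
    by (subst Bochner_Integration.integrable_cong[OF refl eq])
      (use Bochner_Integration.integrable_diff[OF i12 i34] in \<open>auto simp: ext_ball_def\<close>)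
  have "(LINT x|M. E x * D x) = (LINT x|M. (E x * norm (G x) powr p - F x / K) -
      (norm (G x) powr (p - 2) * (G x \<bullet> (h (norm x) *\<^sub>R sgn x)) - H (norm x)))"
    by (rule Bochner_Integration.integral_cong[OF refl eq]) (simp add: ext_ball_def)
  also have "\<dots> = ((LINT x|M. E x * norm (G x) powr p) - (LINT x|M. F x) / K) -
      ((LINT x|M. norm (G x) powr (p - 2) * (G x \<bullet> (h (norm x) *\<^sub>R sgn x))) - (LINT x|M. H (norm x)))"
    using i1 i2 i3 i4 i12 i34 by (simp add: E_def)
  \<comment> \<open>The four terms cancel in pairs: the energy of \<open>G\<close> against V-flux
    times G by \<open>flux_identity\<close>, and G-flux times V against the energy of
    \<open>V\<close>, both of which equal the integral of h k.\<close>
  also have "(LINT x|M. E x * norm (G x) powr p) - (LINT x|M. F x) / K = 0"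
    using flux_identity[OF ab] K_pos by (simp add: F_def E_def)
  also have "(LINT x|M. norm (G x) powr (p - 2) * (G x \<bullet> (h (norm x) *\<^sub>R sgn x))) = (LINT t:{1<..}|lborel. h t * k t)"
    by (rule radial_flux[OF hc hz])
  also have "(LINT x|M. H (norm x)) = (LINT t:{1<..}|lborel. h t * k t)"
  proof -
    have "(LINT x|M. H (norm x)) = K * (LINT r:{1<..}|lborel. H r * r ^ (DIM('a) - 1))"
      by (rule ext_radial_integral(1)[OF Hc Hz])
    also have "\<dots> = (LINT r:{1<..}|lborel. K * (H r * r ^ (DIM('a) - 1)))" by simp
    also have "\<dots> = (LINT t:{1<..}|lborel. h t * k t)"
      by (rule set_lebesgue_integral_cong) (use K_pos in \<open>auto simp: H_def h_def w_def\<close>)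
    finally show ?thesis .
  qed
  finally have int0: "(LINT x|M. E x * D x) = 0" by simp
  have nn: "AE x in M. 0 \<le> E x * D x"
    unfolding E_def D_def by (intro AE_I2 mult_nonneg_nonneg annular_nonneg p_monotone(1)[OF p1])
  have "AE x in M. E x * D x = 0"
    using integral_nonneg_eq_0_iff_AE[OF iD nn] int0 by simp
  then show ?thesis
  proof eventually_elim
    case (elim x)
    show ?case
    proof
      assume "a < norm x \<and> norm x < b"
      then have "E x > 0" unfolding E_def using a0 by (intro annular_pos) auto
      then have "D x = 0" using elim by simp
      then show "G x = V x" unfolding D_def by (rule p_monotone(2)[OF p1])
    qed
  qed
qed

lemma G_eq_V: "AE x in M. G x = V x"
proof -
  \<comment> \<open>Countably many annuli exhaust the exterior domain. The offset 2 makes already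
    the first of them nonempty, since 3/2 < 2.\<close>
  have "AE x in M. \<forall>n::nat. 1 + 1 / real (n + 2) < norm x \<and> norm x < real (n + 2) \<longrightarrow> G x = V x"
    unfolding AE_all_countable
  proof
    fix n :: nat
    show "AE x in M. 1 + 1 / real (n + 2) < norm x \<and> norm x < real (n + 2) \<longrightarrow> G x = V x"
    proof (rule G_eq_V_annulus)
      have "1 / real (n + 2) \<le> 1 / 2" by (intro divide_left_mono) auto
      then show "1 + 1 / real (n + 2) < real (n + 2)" by linarith
    qed simp
  qed
  then show ?thesis
  proof (rule AE_mp, intro AE_I2 impI)
    fix x assume "x \<in> space M" and H: "\<forall>n::nat. 1 + 1 / real (n + 2) < norm x \<and> norm x < real (n + 2) \<longrightarrow> G x = V x"
    then have x: "norm x > 1" by (simp add: ext_ball_def)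
    obtain n1 :: nat where n1: "norm x < real n1" using reals_Archimedean2 by blast
    obtain n2 :: nat where n2: "1 / (norm x - 1) < real n2" using reals_Archimedean2 by blast
    define n where "n = max n1 n2"
    have "1 / (norm x - 1) < real (n + 2)" using n2 by (simp add: n_def)
    then have "1 < real (n + 2) * (norm x - 1)" using x by (simp add: pos_divide_less_eq)
    then have "1 / real (n + 2) < norm x - 1" by (simp add: pos_divide_less_eq mult.commute)
    moreover have "norm x < real (n + 2)" using n1 by (simp add: n_def)
    ultimately show "G x = V x" using H by (metis add.commute less_diff_eq)
  qed
qed

text \<open>Once G = V, the jump identity at radius d expresses f(d) times the bump by an integral
  of a continuous function over the radii from d to b. Hence f is locally a quotient of continuously
  differentiable functions, and its derivative can be computed.\<close>

lemma f_deriv: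
  assumes "r > 1"
  shows "(f has_real_derivative v r) (at r)"
proof -
  let ?c = "real DIM('a) / 2"
  define a where "a = (1 + r) / 2"
  define b where "b = r + 1"
  have ab: "1 < a" "a < b" "a < r" "r < b" using assms by (auto simp: a_def b_def)
  have a0: "0 < a" using ab by simp
  note z = annular_zero[OF a0 ab(2), of _ ?c]
  define E where "E = annular ?c a b"
  define E' where "E' = annular' ?c a b"
  \<comment> \<open>What the derivative of f E has to be if f' = v. The maxima make it continuous on
    the whole line, so that it has a primitive.\<close>
  define H where "H = (\<lambda>t. f (max 1 t) * E' t + E t * v (max 1 t))"
  have Hc: "continuous_on A H" for A
    unfolding H_def E_def E'_def by (intro continuous_intros f_max_cont v_max_cont)
  obtain W where W: "\<And>t. t > 0 \<Longrightarrow> (W has_real_derivative H t) (at t)"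
    by (rule antiderivative_exists[OF Hc]) (rule that)
  have key: "f d * E d = W d - W b" if d: "1 < d" "d < b" for d
  proof -
    have "(LINT x|M. indicator {d<..} (norm x) * (annular 0 a b (norm x) * (G x \<bullet> x))) =
      (LINT x|M. indicator {d<..} (norm x) * (annular 0 a b (norm x) * (V x \<bullet> x)))"
    proof (rule integral_cong_AE)
      have m: "(\<lambda>x. annular 0 a b (norm x)) \<in> borel_measurable M" "(\<lambda>x. v (norm x)) \<in> borel_measurable M"
        by (auto intro!: ext_measurable_radial_continuous annular_cont v_cont)
      note [measurable] = m G_meas ident_meas sgn_meas
      show "(\<lambda>x. indicator {d<..} (norm x) * (annular 0 a b (norm x) * (G x \<bullet> x))) \<in> borel_measurable M"
        by measurable
      show "(\<lambda>x. indicator {d<..} (norm x) * (annular 0 a b (norm x) * (V x \<bullet> x))) \<in> borel_measurable M"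
        unfolding V_def by measurable
    qed (use G_eq_V in eventually_elim, simp)
    also have "\<dots> = (LINT x|M. indicator {d..<b} (norm x) * (\<lambda>r. annular 0 a b r * v r * r) (norm x))"
    proof (rule integral_cong_AE)
      have m: "(\<lambda>x. annular 0 a b (norm x)) \<in> borel_measurable M" "(\<lambda>x. v (norm x)) \<in> borel_measurable M"
        by (auto intro!: ext_measurable_radial_continuous annular_cont v_cont)
      note [measurable] = m ident_meas sgn_meas
      show "(\<lambda>x. indicator {d<..} (norm x) * (annular 0 a b (norm x) * (V x \<bullet> x))) \<in> borel_measurable M"
        unfolding V_def by measurable
      show "(\<lambda>x. indicator {d..<b} (norm x) * (\<lambda>r. annular 0 a b r * v r * r) (norm x)) \<in> borel_measurable M"
        by measurable
      \<comment> \<open>The jump identity uses the open range |x| > d, the radial integral a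
        half-open shell; the sphere between them is a null set.\<close>
      have ns: "AE x in M. norm x \<noteq> d"
      proof -
        have "sphere (0::'a) d \<in> null_sets lebesgue"
          using negligible_sphere by (simp only: negligible_iff_null_sets)
        then have "AE x in lebesgue. x \<notin> sphere (0::'a) d" by (rule AE_not_in)
        then show ?thesis by (subst AE_restrict_space_iff) (auto elim!: eventually_mono)
      qed
      show "AE x in M. indicator {d<..} (norm x) * (annular 0 a b (norm x) * (V x \<bullet> x)) =
        indicator {d..<b} (norm x) * (\<lambda>r. annular 0 a b r * v r * r) (norm x)"
        using ns
      proof eventually_elim
        case (elim x)
        have "sgn x \<bullet> x = norm x" by (cases "x = 0") (simp_all add: sgn_div_norm dot_square_norm power2_eq_square)
        then have "V x \<bullet> x = v (norm x) * norm x" by (simp add: V_def)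
        moreover have "annular 0 a b (norm x) = 0" if "norm x \<ge> b" using annular_zero[OF a0 ab(2), of "norm x" 0] that by simp
        ultimately show ?case using elim by (auto simp: indicator_def not_less)
      qed
    qed
    also have "\<dots> = K * (LINT r:{d..b}|lborel. annular 0 a b r * v r * r * r ^ (DIM('a) - 1))"
      by (rule radial_interval(1)) (use d in \<open>auto intro!: continuous_intros v_cont\<close>)
    also have "(LINT r:{d..b}|lborel. annular 0 a b r * v r * r * r ^ (DIM('a) - 1)) = (LINT r:{d..b}|lborel. E r * v (max 1 r))"
    proof (rule set_lebesgue_integral_cong)
      show "\<forall>r. r \<in> {d..b} \<longrightarrow> annular 0 a b r * v r * r * r ^ (DIM('a) - 1) = E r * v (max 1 r)"
      proof (intro allI impI)
        fix r assume "r \<in> {d..b}"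
        then have r: "r > 0" "max 1 r = r" using d by auto
        have rN: "r ^ DIM('a) = r * r ^ (DIM('a) - 1)" by (metis DIM_positive power_minus_mult mult.commute)
        show "annular 0 a b r * v r * r * r ^ (DIM('a) - 1) = E r * v (max 1 r)"
          unfolding E_def annular_shift(1)[OF r(1)] rN r(2) by simp
      qed
    qed simp
    finally have 1: "(LINT x|M. indicator {d<..} (norm x) * (annular 0 a b (norm x) * (G x \<bullet> x))) = K * (LINT r:{d..b}|lborel. E r * v (max 1 r))" .
    have 2: "(LINT r:{1<..}|lborel. indicator {d<..} r * (f r * E' r)) = (LINT r:{d..b}|lborel. f (max 1 r) * E' r)"
      unfolding set_lebesgue_integral_def
    proof (rule integral_cong_AE)
      have [measurable]: "(\<lambda>r. f (max 1 r)) \<in> borel_measurable borel" "E' \<in> borel_measurable borel"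
        unfolding E'_def by (intro borel_measurable_continuous_onI f_max_cont annular'_cont)+
      have "(\<lambda>r. indicator {1<..} r *\<^sub>R (indicator {d<..} r * (f r * E' r))) = (\<lambda>r. indicator {1<..} r *\<^sub>R (indicator {d<..} r * (f (max 1 r) * E' r)))"
        by (auto simp: indicator_def)
      then show "(\<lambda>r. indicator {1<..} r *\<^sub>R (indicator {d<..} r * (f r * E' r))) \<in> borel_measurable lborel" by simp
      show "(\<lambda>r. indicator {d..b} r *\<^sub>R (f (max 1 r) * E' r)) \<in> borel_measurable lborel" by measurable
      show "AE r in lborel. indicator {1<..} r *\<^sub>R (indicator {d<..} r * (f r * E' r)) = indicator {d..b} r *\<^sub>R (f (max 1 r) * E' r)"
        using AE_lborel_singleton[of d]
        by eventually_elim (use d z in \<open>auto simp: indicator_def E'_def\<close>)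
    qed
    have si: "set_integrable lborel {d..b} h" if "continuous_on UNIV h" for h :: "real \<Rightarrow> real"
      unfolding set_integrable_def by (intro borel_integrable_compact) (auto intro: continuous_on_subset[OF that])
    have cc: "continuous_on UNIV (\<lambda>r. E r * v (max 1 r))" "continuous_on UNIV (\<lambda>r. f (max 1 r) * E' r)"
      unfolding E_def E'_def by (intro continuous_intros f_max_cont v_max_cont)+
    have "(LINT r:{d..b}|lborel. H r) = W b - W d"
      unfolding set_lebesgue_integral_def using d
      by (intro integral_FTC_Icc Hc) (auto simp: has_real_derivative_iff_has_vector_derivative[symmetric] intro!: has_field_derivative_at_within W)
    moreover have "(LINT r:{d..b}|lborel. H r) = (LINT r:{d..b}|lborel. f (max 1 r) * E' r) + (LINT r:{d..b}|lborel. E r * v (max 1 r))"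
      unfolding H_def by (rule set_integral_add[OF si[OF cc(2)] si[OF cc(1)]])
    moreover have "K * (LINT r:{d..b}|lborel. E r * v (max 1 r)) = - K * ((LINT r:{d..b}|lborel. f (max 1 r) * E' r) + f d * E d)"
      using sphere_jump(1)[OF ab(1,2), of d] d unfolding 1 E'_def[symmetric] 2 E_def[symmetric] by simp
    then have "K * ((LINT r:{d..b}|lborel. E r * v (max 1 r)) + ((LINT r:{d..b}|lborel. f (max 1 r) * E' r) + f d * E d)) = 0"
      by (simp add: algebra_simps)
    then have "(LINT r:{d..b}|lborel. E r * v (max 1 r)) + ((LINT r:{d..b}|lborel. f (max 1 r) * E' r) + f d * E d) = 0"
      using K_pos by simp
    ultimately show ?thesis by linarith
  qed
  have Epos: "E t > 0" if "a < t" "t < b" for t unfolding E_def using a0 that by (intro annular_pos)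
  have "((\<lambda>t. (W t - W b) / E t) has_real_derivative (H r * E r - (W r - W b) * E' r) / (E r * E r)) (at r)"
    using assms Epos[OF ab(3,4)]
    by (auto intro!: derivative_eq_intros W annular_deriv[of ?c a b r, folded E_def E'_def])
  moreover have "(H r * E r - (W r - W b) * E' r) / (E r * E r) = v r"
    using Epos[OF ab(3,4)] key[OF assms ab(4)] assms
    by (simp add: H_def field_simps flip: key[OF assms ab(4)])
  ultimately have "((\<lambda>t. (W t - W b) / E t) has_real_derivative v r) (at r)" by simp
  then show ?thesis
  proof (rule has_field_derivative_transform_within_open[of _ _ _ "{a<..<b}"])
    show "(W t - W b) / E t = f t" if "t \<in> {a<..<b}" for t
      using key[of t] Epos[of t] that ab by (simp add: field_simps)
  qed (use ab in auto)
qed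

end

section \<open>The boundary trace and the monotonicity of the flux\<close>

context radial_robin
begin

text \<open>With G = V the pair (\<phi>, G) is radial and continuously differentiable up to the
  sphere, so \<open>radial_gauss_green\<close> evaluates with boundary value f(1) the same integral
  that defines \<open>T\<close>.\<close>

lemma trace_green:
  fixes \<Phi> :: "'a \<Rightarrow> 'a"
  assumes \<Phi>: "\<forall>i\<in>Basis. test_fun UNIV (\<lambda>y. \<Phi> y \<bullet> i)"
  shows "sphere_int (\<lambda>x. T x * (\<Phi> x \<bullet> (- x))) = sphere_int (\<lambda>x. f 1 * (\<Phi> x \<bullet> (- x)))"
proof -
  obtain W where W: "\<And>t. t > 0 \<Longrightarrow> (W has_real_derivative v (max 1 t)) (at t)"
    by (rule antiderivative_exists[OF v_max_cont]) (rule that)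
  \<comment> \<open>Extends the profile below radius 1 with the constant slope v(1), as
    \<open>radial_gauss_green\<close> asks for a differentiable profile on all positive
    radii.\<close>
  define u where "u = (\<lambda>r. f 1 + (W r - W 1))"
  have du: "(u has_real_derivative v (max 1 r)) (at r)" if "r > 0" for r
    unfolding u_def using W[OF that] by (auto intro!: derivative_eq_intros)
  have u_eq: "u r = f r" if "r > 1" for r
  proof -
    have cu: "continuous_on {1..r} u"
      by (intro continuous_at_imp_continuous_on ballI) (auto intro!: DERIV_isCont[OF du])
    have "(\<lambda>r. f r - u r) r = (\<lambda>r. f r - u r) 1"
    proof (rule DERIV_isconst2[OF that])
      show "continuous_on {1..r} (\<lambda>r. f r - u r)"
        by (intro continuous_intros cu f_cont_subset) auto
      show "((\<lambda>r. f r - u r) has_real_derivative 0) (at x)" if "1 < x" "x < r" for x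
        using DERIV_diff[OF f_deriv[OF that(1)] du[of x]] that by (simp add: max_def)
    qed (use that in auto)
    then show ?thesis by (simp add: u_def)
  qed
  note gg = radial_gauss_green[OF du v_max_cont \<Phi>]
  have "(LINT x|M. \<phi> x * divergence \<Phi> x + G x \<bullet> \<Phi> x) =
    (LINT x|M. u (norm x) * divergence \<Phi> x + (v (max 1 (norm x)) *\<^sub>R sgn x) \<bullet> \<Phi> x)"
  proof (rule integral_cong_AE)
    have "divergence \<Phi> \<in> borel_measurable M" "\<Phi> \<in> borel_measurable M"
      using test_field_borel[OF \<Phi>] by (auto intro: borel_measurable_ext_ball)
    then show "(\<lambda>x. \<phi> x * divergence \<Phi> x + G x \<bullet> \<Phi> x) \<in> borel_measurable M"
      using phi_meas G_meas by measurable
    show "AE x in M. \<phi> x * divergence \<Phi> x + G x \<bullet> \<Phi> x = u (norm x) * divergence \<Phi> x + (v (max 1 (norm x)) *\<^sub>R sgn x) \<bullet> \<Phi> x"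
      using G_eq_V AE_space
    proof eventually_elim
      case (elim x)
      then have "norm x > 1" by (simp add: ext_ball_def)
      then show ?case using elim u_eq[of "norm x"] by (simp add: phi_eq V_def max_def)
    qed
  qed (rule borel_measurable_integrable[OF gg(1)])
  also have "\<dots> = sphere_int (\<lambda>x. f 1 * (\<Phi> x \<bullet> (- x)))" using gg(2) by (simp add: u_def)
  finally show ?thesis using trace \<Phi> by (simp add: trace_ext_def)
qed

text \<open>Testing with the triple (0, 0, T - f 1) and comparing means identifies the trace, again by strict monotonicity.\<close>
lemma tau_eq:
  assumes "\<beta> \<noteq> 0"
  shows "\<tau> = K * f 1 powr (p - 1)"
proof -
  define B where "B = lebesgue_on (ball (0::'a) 1)"
  define c where "c = f 1"
  define t where "t = (\<lambda>x. T (x /\<^sub>R norm x))"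
  have c0: "c \<ge> 0" unfolding c_def by (rule f_nonneg) simp
  have SI: "sphere_int h = real DIM('a) * (LINT x|B. h (x /\<^sub>R norm x))" for h
    by (simp add: sphere_int_def B_def)
  have fin: "finite_measure B"
  proof
    show "emeasure B (space B) \<noteq> \<infinity>"
      by (simp add: B_def emeasure_restrict_space emeasure_ball)
  qed
  interpret finite_measure B by (rule fin)
  have tm [measurable]: "t \<in> borel_measurable B" and tp: "integrable B (\<lambda>x. \<bar>t x\<bar> powr p)"
    using trace by (auto simp: trace_ext_def sphere_integrable_def t_def B_def)
  have bd: "integrable B h" if "h \<in> borel_measurable B" "\<And>x. \<bar>h x\<bar> \<le> C * (1 + \<bar>t x\<bar> powr p)" for h C
  proof (rule Bochner_Integration.integrable_bound)
    show "integrable B (\<lambda>x. C * (1 + \<bar>t x\<bar> powr p))" using tp by (intro integrable_mult_right Bochner_Integration.integrable_add) auto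
    show "AE x in B. norm (h x) \<le> norm (C * (1 + \<bar>t x\<bar> powr p))"
      using order_trans[OF that(2) abs_ge_self] by simp
  qed (rule that)
  have ti: "integrable B t"
    by (rule bd[of _ 1]) (use le_one_plus_powr[of "\<bar>t _\<bar>" p] p1 in auto)
  have tq: "\<bar>t x\<bar> powr (p - 2) * t x * t x = \<bar>t x\<bar> powr p" for x
    using norm_powr_mult_self(2)[OF p1, of "t x"] by (simp add: power2_eq_square mult.assoc)
  have qi: "integrable B (\<lambda>x. \<bar>t x\<bar> powr (p - 2) * t x)"
  proof (rule bd[of _ 1])
    show "(\<lambda>x. \<bar>t x\<bar> powr (p - 2) * t x) \<in> borel_measurable B" by measurable
    fix x
    have "\<bar>\<bar>t x\<bar> powr (p - 2) * t x\<bar> = \<bar>t x\<bar> powr (p - 1)"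
      using norm_powr_mult_self(1)[OF p1, of "t x"] by (simp add: abs_mult)
    also have "\<dots> \<le> 1 + \<bar>t x\<bar> powr p"
    proof (cases "\<bar>t x\<bar> \<le> 1")
      case True
      then have "\<bar>t x\<bar> powr (p - 1) \<le> 1" using p1 by (intro powr_le1) auto
      then show ?thesis using powr_ge_zero[of "\<bar>t x\<bar>" p] by linarith
    next
      case False
      then have "\<bar>t x\<bar> powr (p - 1) \<le> \<bar>t x\<bar> powr p" by (intro powr_mono) auto
      then show ?thesis by simp
    qed
    finally show "\<bar>\<bar>t x\<bar> powr (p - 2) * t x\<bar> \<le> 1 * (1 + \<bar>t x\<bar> powr p)" by simp
  qed
  have mean: "(LINT x|B. t x) = (LINT x|B. c)"
  proof -
    \<comment> \<open>The factor 1 / \<open>exp_bump 0 3\<close> normalises the bump to be 1 on the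
      unit sphere, where 4 - |x|^2 = 3. The field \<eta>(x) x then has normal component -1 there,
      and \<open>trace_green\<close> compares the means of \<open>T\<close> and f(1).\<close>
    define \<eta> where "\<eta> = (\<lambda>x::'a. exp_bump 0 (4 - (norm x)\<^sup>2) * (1 / exp_bump 0 3))"
    have e3: "exp_bump 0 3 \<noteq> 0" by (simp add: exp_bump_def)
    have "smooth_fun \<eta>" unfolding \<eta>_def
      by (intro smooth_fun_mult smooth_fun_compose[OF exp_bump_smooth] smooth_fun_diff smooth_fun_const smooth_fun_norm_sq)
    then have \<eta>: "test_fun UNIV \<eta>"
    proof (rule test_funI[where C="cball 0 2"])
      show "\<eta> x = 0" if "x \<notin> cball 0 2" for x
      proof -
        have "2\<^sup>2 \<le> (norm x)\<^sup>2" using that by (intro power_mono) auto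
        then show ?thesis by (simp add: \<eta>_def exp_bump_def)
      qed
    qed auto
    have \<Phi>: "\<forall>i\<in>Basis. test_fun UNIV (\<lambda>y. (\<eta> y *\<^sub>R y) \<bullet> i)"
      using test_fun_mult[OF \<eta> smooth_fun_inner] by simp
    have ne: "AE x in B. x \<noteq> 0"
    proof -
      have "{0::'a} \<in> null_sets lebesgue" using negligible_sing[of "0::'a"] by (simp only: negligible_iff_null_sets)
      then have "AE x in lebesgue. x \<notin> {0::'a}" by (rule AE_not_in)
      then show ?thesis unfolding B_def by (subst AE_restrict_space_iff) (auto elim!: eventually_mono)
    qed
    have val: "(\<eta> (x /\<^sub>R norm x) *\<^sub>R (x /\<^sub>R norm x)) \<bullet> (- (x /\<^sub>R norm x)) = - 1" if "x \<noteq> 0" for x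
    proof -
      have n1: "norm (x /\<^sub>R norm x) = 1" using that by simp
      then have "\<eta> (x /\<^sub>R norm x) = 1" using e3 unfolding \<eta>_def n1 by simp
      moreover have "(x /\<^sub>R norm x) \<bullet> (x /\<^sub>R norm x) = 1" unfolding dot_square_norm n1 by simp
      ultimately show ?thesis by (simp only: scaleR_one inner_minus_right)
    qed
    have \<Phi>m: "(\<lambda>x. (\<eta> (x /\<^sub>R norm x) *\<^sub>R (x /\<^sub>R norm x)) \<bullet> (- (x /\<^sub>R norm x))) \<in> borel_measurable B"
    proof -
      have [measurable]: "\<eta> \<in> borel_measurable borel" by (rule test_fun_borel[OF \<eta>])
      show ?thesis unfolding B_def by (intro measurable_restrict_space1 measurable_completion) measurable
    qed
    have e1: "(LINT x|B. t x * ((\<eta> (x /\<^sub>R norm x) *\<^sub>R (x /\<^sub>R norm x)) \<bullet> (- (x /\<^sub>R norm x)))) = (LINT x|B. t x * - 1)"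
    proof (rule integral_cong_AE)
      show "(\<lambda>x. t x * ((\<eta> (x /\<^sub>R norm x) *\<^sub>R (x /\<^sub>R norm x)) \<bullet> (- (x /\<^sub>R norm x)))) \<in> borel_measurable B"
        by (rule borel_measurable_times[OF tm \<Phi>m])
      show "(\<lambda>x. t x * - 1) \<in> borel_measurable B" by measurable
      show "AE x in B. t x * ((\<eta> (x /\<^sub>R norm x) *\<^sub>R (x /\<^sub>R norm x)) \<bullet> (- (x /\<^sub>R norm x))) = t x * - 1"
        using ne by eventually_elim (erule val[THEN arg_cong])
    qed
    have e2: "(LINT x|B. c * ((\<eta> (x /\<^sub>R norm x) *\<^sub>R (x /\<^sub>R norm x)) \<bullet> (- (x /\<^sub>R norm x)))) = (LINT x|B. c * - 1)"
    proof (rule integral_cong_AE)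
      show "(\<lambda>x. c * ((\<eta> (x /\<^sub>R norm x) *\<^sub>R (x /\<^sub>R norm x)) \<bullet> (- (x /\<^sub>R norm x)))) \<in> borel_measurable B"
        by (rule borel_measurable_times[OF borel_measurable_const \<Phi>m])
      show "AE x in B. c * ((\<eta> (x /\<^sub>R norm x) *\<^sub>R (x /\<^sub>R norm x)) \<bullet> (- (x /\<^sub>R norm x))) = c * - 1"
        using ne by eventually_elim (erule val[THEN arg_cong])
    qed simp
    have "real DIM('a) * (LINT x|B. t x * ((\<eta> (x /\<^sub>R norm x) *\<^sub>R (x /\<^sub>R norm x)) \<bullet> (- (x /\<^sub>R norm x)))) =
      real DIM('a) * (LINT x|B. c * ((\<eta> (x /\<^sub>R norm x) *\<^sub>R (x /\<^sub>R norm x)) \<bullet> (- (x /\<^sub>R norm x))))"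
      using trace_green[OF \<Phi>] by (simp only: SI t_def c_def)
    then have "real DIM('a) * (LINT x|B. t x * - 1) = real DIM('a) * (LINT x|B. c * - 1)"
      by (simp only: e1 e2)
    then show ?thesis by simp
  qed
  \<comment> \<open>For the zero function with zero gradient the Gauss--Green formula only asks that
    T - c be orthogonal to all normal components of test fields, and this is
    \<open>trace_green\<close>. The weak equation can therefore be tested with it.\<close>
  have "trace_ext p (\<lambda>_::'a. 0) (\<lambda>_. 0) (\<lambda>x. T x - c)"
    unfolding trace_ext_def sphere_integrable_def B_def[symmetric] SI
  proof (intro conjI allI impI)
    show "integrable B (\<lambda>x. \<bar>T (x /\<^sub>R norm x) - c\<bar> powr p)"
    proof (rule bd[of _ "2 powr p * (1 + c powr p)"])
      show "(\<lambda>x. \<bar>T (x /\<^sub>R norm x) - c\<bar> powr p) \<in> borel_measurable B" using tm unfolding t_def by measurable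
      fix x
      have "\<bar>t x - c\<bar> powr p \<le> (\<bar>t x\<bar> + c) powr p" using c0 p1 by (intro powr_mono2) auto
      also have "\<dots> \<le> 2 powr p * (\<bar>t x\<bar> powr p + c powr p)" using c0 p1 by (intro add_powr_le) auto
      also have "\<dots> \<le> 2 powr p * ((1 + c powr p) * (1 + \<bar>t x\<bar> powr p))"
        by (intro mult_left_mono) (auto simp: algebra_simps)
      finally show "\<bar>\<bar>T (x /\<^sub>R norm x) - c\<bar> powr p\<bar> \<le> 2 powr p * (1 + c powr p) * (1 + \<bar>t x\<bar> powr p)"
        by (simp add: t_def mult.assoc)
    qed
    show "(\<lambda>x. T (x /\<^sub>R norm x) - c) \<in> borel_measurable B" using tm unfolding t_def by measurable
    fix \<Phi> :: "'a \<Rightarrow> 'a" assume \<Phi>: "\<forall>i\<in>Basis. test_fun UNIV (\<lambda>y. \<Phi> y \<bullet> i)"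
    obtain R D where RD: "R > 0" "D > 0" "\<And>i x. i \<in> Basis \<Longrightarrow> \<bar>\<Phi> x \<bullet> i\<bar> \<le> D"
      "\<And>i j x. i \<in> Basis \<Longrightarrow> j \<in> Basis \<Longrightarrow> \<bar>partial (\<lambda>y. \<Phi> y \<bullet> i) j x\<bar> \<le> D"
      "\<And>i x. i \<in> Basis \<Longrightarrow> norm x > R \<Longrightarrow> \<Phi> x \<bullet> i = 0"
      "\<And>i j x. i \<in> Basis \<Longrightarrow> norm x > R \<Longrightarrow> partial (\<lambda>y. \<Phi> y \<bullet> i) j x = 0"
      "\<And>x. norm x > R \<Longrightarrow> \<Phi> x = 0" "\<And>x. norm x > R \<Longrightarrow> divergence \<Phi> x = 0"
      "\<And>x. norm (\<Phi> x) \<le> D" "\<And>x. \<bar>divergence \<Phi> x\<bar> \<le> D"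
      by (rule test_field_bounds[OF \<Phi>]) (rule that)
    define b where "b = (\<lambda>x. \<Phi> (x /\<^sub>R norm x) \<bullet> (- (x /\<^sub>R norm x)))"
    have bm: "b \<in> borel_measurable B"
    proof -
      have [measurable]: "\<Phi> \<in> borel_measurable borel" by (rule test_field_borel(1)[OF \<Phi>])
      show ?thesis unfolding B_def b_def by (intro measurable_restrict_space1 measurable_completion) measurable
    qed
    have bb: "\<bar>b x\<bar> \<le> D" for x
    proof -
      have "\<bar>b x\<bar> = \<bar>sgn x \<bullet> \<Phi> (x /\<^sub>R norm x)\<bar>" by (simp add: b_def sgn_div_norm inner_commute)
      also have "\<dots> \<le> D" by (rule order_trans[OF abs_inner_sgn_le RD(9)])
      finally show ?thesis .
    qed
    have i1: "integrable B (\<lambda>x. t x * b x)"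
    proof (rule Bochner_Integration.integrable_bound)
      show "integrable B (\<lambda>x. t x * D)" using ti by simp
      show "(\<lambda>x. t x * b x) \<in> borel_measurable B" by (rule borel_measurable_times[OF tm bm])
      show "AE x in B. norm (t x * b x) \<le> norm (t x * D)"
        using bb RD(2) by (auto simp: abs_mult intro!: mult_left_mono)
    qed
    have i2: "integrable B (\<lambda>x. c * b x)"
    proof (rule Bochner_Integration.integrable_bound)
      show "integrable B (\<lambda>x. c * D)" by simp
      show "(\<lambda>x. c * b x) \<in> borel_measurable B" by (rule borel_measurable_times[OF borel_measurable_const bm])
      show "AE x in B. norm (c * b x) \<le> norm (c * D)"
        using bb RD(2) by (auto simp: abs_mult intro!: mult_left_mono)
    qed
    have "(LINT x|B. t x * b x) = (LINT x|B. c * b x)"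
      using trace_green[OF \<Phi>] unfolding SI t_def b_def c_def by simp
    then have "(LINT x|B. (t x - c) * b x) = 0"
      using Bochner_Integration.integral_diff[OF i1 i2] by (simp add: left_diff_distrib)
    then show "(LINT x|M. 0 * divergence \<Phi> x + 0 \<bullet> \<Phi> x) =
        real DIM('a) * (LINT x|B. (T (x /\<^sub>R norm x) - c) * (\<Phi> (x /\<^sub>R norm x) \<bullet> - (x /\<^sub>R norm x)))"
      unfolding t_def b_def by simp
  qed
  moreover have "W1p_grad p ext_ball (\<lambda>_::'a. 0) (\<lambda>_. 0)"
    using p1 by (simp add: W1p_grad_def Lp_on_def weak_grad_def)
  ultimately have "\<beta> * sphere_int (\<lambda>x. \<bar>T x\<bar> powr (p - 2) * T x * (T x - c)) = 0"
    using weak[of "\<lambda>_. 0" "\<lambda>_. 0"] by simp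
  then have w0: "(LINT x|B. \<bar>t x\<bar> powr (p - 2) * t x * (t x - c)) = 0"
    using assms unfolding SI t_def by simp
  define d where "d = \<bar>c\<bar> powr (p - 2) * c"
  \<comment> \<open>Subtracting the multiple d (t - c), whose integral vanishes by the equality of
    means, turns the tested expression into the monotone pairing of t and c.\<close>
  define E where "E = (\<lambda>x. (\<bar>t x\<bar> powr (p - 2) * t x - d) * (t x - c))"
  have i3: "integrable B (\<lambda>x. \<bar>t x\<bar> powr (p - 2) * t x * (t x - c))"
  proof -
    have "(\<lambda>x. \<bar>t x\<bar> powr (p - 2) * t x * (t x - c)) = (\<lambda>x. \<bar>t x\<bar> powr p - (\<bar>t x\<bar> powr (p - 2) * t x) * c)"
      by (simp only: right_diff_distrib tq)
    then show ?thesis using tp qi by simp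
  qed
  have i4: "integrable B (\<lambda>x. d * (t x - c))" using ti by simp
  have E_eq: "E = (\<lambda>x. \<bar>t x\<bar> powr (p - 2) * t x * (t x - c) - d * (t x - c))"
    unfolding E_def by (simp only: left_diff_distrib)
  have Ei: "integrable B E" unfolding E_eq by (rule Bochner_Integration.integrable_diff[OF i3 i4])
  have "(LINT x|B. E x) = 0"
    unfolding E_eq Bochner_Integration.integral_diff[OF i3 i4] w0 using ti mean
    by (simp add: Bochner_Integration.integral_diff)
  moreover have "AE x in B. 0 \<le> E x"
    using p_monotone(1)[OF p1, where 'a=real] by (intro AE_I2) (simp add: E_def d_def)
  ultimately have "AE x in B. E x = 0" using integral_nonneg_eq_0_iff_AE[OF Ei] by simp
  then have tc: "AE x in B. t x = c"
  proof eventually_elim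
    case (elim x)
    then show ?case using p_monotone(2)[OF p1, of "t x" c] by (simp add: E_def d_def)
  qed
  have "(LINT x|B. \<bar>t x\<bar> powr (p - 2) * t x) = (LINT x|B. d)"
    by (rule integral_cong_AE) (use tc in \<open>auto simp: d_def elim!: eventually_mono\<close>)
  then have "\<tau> = real DIM('a) * (LINT x|B. d)"
    unfolding \<tau>_def SI t_def by simp
  moreover have "K = real DIM('a) * (LINT x|B. 1)" unfolding K_def SI by simp
  moreover have "d = c powr (p - 1)"
    using norm_powr_mult_self(1)[OF p1, of c] c0 by (simp add: d_def)
  ultimately show ?thesis by (simp add: c_def mult_ac)
qed

lemma k_one: "\<beta> \<noteq> 0 \<Longrightarrow> k 1 = \<beta> * K * f 1 powr (p - 1)"
  using k_1 tau_eq by simp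

text \<open>The exterior domain has infinite volume, so an eigenfunction in the p-th Lebesgue space cannot stay away from zero.\<close>
lemma f_small:
  assumes c: "c > 0"
  shows "\<exists>r>R. f r < c"
proof (rule ccontr)
  assume "\<not> (\<exists>r>R. f r < c)"
  then have fc: "f r \<ge> c" if "r > R" for r using that by (meson not_less)
  define R' where "R' = max R 1"
  have c1: "continuous_on {1<..} (\<lambda>r. \<bar>f r\<bar> powr p)"
    using p1 by (intro continuous_on_powr' continuous_intros f_cont_subset) auto
  have "integrable M (\<lambda>x. \<bar>f (norm x)\<bar> powr p)"
    using phi_int by (subst (asm) Bochner_Integration.integrable_cong[OF refl, where g="\<lambda>x. \<bar>f (norm x)\<bar> powr p"]) (auto simp: phi_eq ext_ball_def)
  then have i: "set_integrable lborel {1<..} (\<lambda>r. \<bar>f r\<bar> powr p * r ^ (DIM('a) - 1))"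
    using ext_integrable_radial_iff[OF set_borel_measurable_Ioi[OF c1], where 'a='a] by simp
  have "integrable lborel (\<lambda>r. (c powr p) * indicator {R'<..} r)"
  proof (rule Bochner_Integration.integrable_bound[OF i[unfolded set_integrable_def]])
    show "AE r in lborel. norm (c powr p * indicator {R'<..} r) \<le> norm (indicator {1<..} r *\<^sub>R (\<bar>f r\<bar> powr p * r ^ (DIM('a) - 1)))"
    proof (rule AE_I2)
      fix r :: real
      show "norm (c powr p * indicator {R'<..} r) \<le> norm (indicator {1<..} r *\<^sub>R (\<bar>f r\<bar> powr p * r ^ (DIM('a) - 1)))"
      proof (cases "r > R'")
        case True
        then have r: "r > 1" "r > R" by (auto simp: R'_def)
        have "c powr p * 1 \<le> \<bar>f r\<bar> powr p * r ^ (DIM('a) - 1)"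
          using fc[OF r(2)] c p1 r by (intro mult_mono powr_mono2 one_le_power) auto
        then show ?thesis using True r by simp
      qed simp
    qed
  qed simp
  then have "integrable lborel (indicator {R'<..} :: real \<Rightarrow> real)" using c by simp
  then have fin: "emeasure lborel {R'<..} < \<infinity>" by (simp add: integrable_indicator_iff)
  have "ennreal (real n) \<le> emeasure lborel {R'<..}" for n :: nat
  proof -
    have "emeasure lborel {R'<..<R' + real n} \<le> emeasure lborel {R'<..}" by (intro emeasure_mono) auto
    then show ?thesis by simp
  qed
  moreover obtain m where m: "emeasure lborel {R'<..} = ennreal m" "m \<ge> 0" using fin by (cases "emeasure lborel {R'<..}") auto
  obtain n :: nat where "m < real n" using reals_Archimedean2 by blast
  ultimately show False using m by (metis ennreal_le_iff not_less)
qed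

lemma k_mono: "lam \<le> 0 \<Longrightarrow> 1 \<le> a \<Longrightarrow> a \<le> b \<Longrightarrow> k a \<le> k b"
proof -
  assume lam: "lam \<le> 0" and ab: "1 \<le> a" "a \<le> b"
  have "(LINT x|M. indicator {a..<b} (norm x) * Q x) \<ge> 0"
    by (intro integral_nonneg_AE AE_I2) (auto simp: indicator_def ext_ball_def less_imp_le[OF Q_pos])
  then have "k a - k b \<le> 0" unfolding k_diff[OF ab(2)] using lam by (simp add: mult_nonpos_nonneg)
  then show ?thesis by simp
qed

text \<open>\<open>Q\<close> is positive, so a vanishing increment would make the shell a null set;
  its volume is at least K (b - a), because r^(N-1) is at least 1 for r >= 1.\<close>

lemma k_strict:
  assumes lam: "lam > 0" and ab: "1 \<le> a" "a < b"
  shows "k b < k a"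
proof -
  let ?h = "\<lambda>x::'a. indicator {a..<b} (norm x) * Q x"
  have i: "integrable M ?h" by (rule Q_int[of _ b]) auto
  have nn: "AE x in M. 0 \<le> ?h x"
    by (intro AE_I2) (auto simp: indicator_def ext_ball_def less_imp_le[OF Q_pos])
  have "(LINT x|M. ?h x) \<noteq> 0"
  proof
    assume "(LINT x|M. ?h x) = 0"
    then have "AE x in M. ?h x = 0" using integral_nonneg_eq_0_iff_AE[OF i nn] by simp
    then have ae: "AE x in M. \<not> (a \<le> norm x \<and> norm x < b)"
      using AE_space
    proof eventually_elim
      case (elim x)
      then show ?case using Q_pos[of x] by (auto simp: indicator_def ext_ball_def)
    qed
    have "(LINT x|M. indicator {a..<b} (norm x) * (1 :: real)) = (LINT x|M. 0)"
    proof (rule integral_cong_AE)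
      from ae show "AE x in M. indicator {a..<b} (norm x) * 1 = (0 :: real)"
        by eventually_elim (auto simp: indicator_def)
    qed measurable
    then have "K * (LINT r:{a..b}|lborel. 1 * r ^ (DIM('a) - 1)) = 0"
      using radial_interval(1)[of "\<lambda>_. 1" a b] ab by simp
    moreover have "(LINT r:{a..b}|lborel. 1 * r ^ (DIM('a) - 1)) \<ge> (LINT r:{a..b}|lborel. 1)"
      unfolding set_lebesgue_integral_def using ab
      by (intro integral_mono borel_integrable_compact continuous_intros) (auto simp: indicator_def intro!: one_le_power)
    moreover have "(LINT r:{a..b}|lborel. 1) = b - a" using ab by (simp add: set_lebesgue_integral_def)
    ultimately show False using K_pos ab by simp
  qed
  moreover have "(LINT x|M. ?h x) \<ge> 0" using nn by (rule integral_nonneg_AE)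
  ultimately have "lam * (LINT x|M. ?h x) > 0" using lam by simp
  then show ?thesis using k_diff[of a b] ab by simp
qed

text \<open>Half of the bootstrap: decay of \<open>g\<close> and of the profile limits how much the
  flux can change between two radii.\<close>

lemma k_decrease:
  assumes lam: "lam \<ge> 0" and ab: "1 \<le> a" "a \<le> b" and C: "\<And>x. norm x > 1 \<Longrightarrow> g x \<le> C * norm x powr (- l)"
  shows "k a - k b \<le> lam * (C * K) * (LINT r:{a..b}|lborel. r powr (- l) * f r powr (p - 1) * r ^ (DIM('a) - 1))"
proof -
  have cont: "continuous_on {1..} (\<lambda>r. C * (r powr (- l) * f r powr (p - 1)))"
    using p1 by (intro continuous_intros continuous_on_powr' f_cont) (auto simp: f_nonneg)
  have "(LINT x|M. indicator {a..<b} (norm x) * Q x) \<le> (LINT x|M. indicator {a..<b} (norm x) * (C * (norm x powr (- l) * f (norm x) powr (p - 1))))"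
  proof (rule integral_mono)
    show "integrable M (\<lambda>x. indicator {a..<b} (norm x) * Q x)" by (rule Q_int[of _ b]) auto
    show "integrable M (\<lambda>x. indicator {a..<b} (norm x) * (C * (norm x powr (- l) * f (norm x) powr (p - 1))))"
      by (rule radial_interval(2)[OF cont ab])
    fix x assume "x \<in> space M"
    then have x: "norm x > 1" by (simp add: ext_ball_def)
    have "Q x \<le> C * (norm x powr (- l) * f (norm x) powr (p - 1))"
      unfolding Q_eq[OF x] mult.assoc[symmetric] by (intro mult_right_mono C x) auto
    then show "indicator {a..<b} (norm x) * Q x \<le> indicator {a..<b} (norm x) * (C * (norm x powr (- l) * f (norm x) powr (p - 1)))"
      by (simp add: mult_left_mono)
  qed
  also have "\<dots> = K * (LINT r:{a..b}|lborel. C * (r powr (- l) * f r powr (p - 1)) * r ^ (DIM('a) - 1))"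
    by (rule radial_interval(1)[OF cont ab])
  also have "\<dots> = C * K * (LINT r:{a..b}|lborel. r powr (- l) * f r powr (p - 1) * r ^ (DIM('a) - 1))"
    by (simp add: mult.assoc)
  finally have "lam * (LINT x|M. indicator {a..<b} (norm x) * Q x) \<le> lam * (C * K * (LINT r:{a..b}|lborel. r powr (- l) * f r powr (p - 1) * r ^ (DIM('a) - 1)))"
    using lam by (rule mult_left_mono)
  then show ?thesis unfolding k_diff[OF ab(2)] by (simp add: mult.assoc)
qed

end

section \<open>Monotonicity and decay of the profile\<close>

lemma powr_lipschitz:
  fixes l h q :: real
  assumes "0 < l"
  obtains B where "B \<ge> 0" "\<And>x y. l \<le> x \<Longrightarrow> x \<le> h \<Longrightarrow> l \<le> y \<Longrightarrow> y \<le> h \<Longrightarrow> \<bar>x powr q - y powr q\<bar> \<le> B * \<bar>x - y\<bar>"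
proof -
  have cont: "continuous_on {l..h} (\<lambda>x. q * x powr (q - 1))"
    by (intro continuous_on_mult continuous_on_const continuous_on_powr' continuous_on_id) (use assms in auto)
  obtain B where B: "B \<ge> 0" "\<And>r. l \<le> r \<Longrightarrow> r \<le> h \<Longrightarrow> \<bar>q * r powr (q - 1)\<bar> \<le> B"
    using continuous_bounded_Icc[OF cont] by blast
  show ?thesis
  proof (rule that[OF B(1)])
    fix x y assume xy: "l \<le> x" "x \<le> h" "l \<le> y" "y \<le> h"
    have "norm (x powr q - y powr q) \<le> B * norm (x - y)"
    proof (rule field_differentiable_bound[where S="{l..h}" and f'="\<lambda>x. q * x powr (q - 1)"])
      show "((\<lambda>x. x powr q) has_field_derivative q * z powr (q - 1)) (at z within {l..h})" if "z \<in> {l..h}" for z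
        using that assms by (intro has_field_derivative_at_within[OF has_real_derivative_powr]) auto
      show "norm (q * z powr (q - 1)) \<le> B" if "z \<in> {l..h}" for z using B(2)[of z] that by simp
    qed (use xy in simp_all)
    then show "\<bar>x powr q - y powr q\<bar> \<le> B * \<bar>x - y\<bar>" by simp
  qed
qed

lemma sgn_lipschitz:
  fixes x y :: "'a::real_normed_vector"
  assumes "norm x \<ge> 1" "norm y \<ge> 1"
  shows "norm (sgn x - sgn y) \<le> 2 * norm (x - y)"
proof -
  have x: "x \<noteq> 0" and y: "y \<noteq> 0" using assms by auto
  have "norm y *\<^sub>R sgn y = y" using y by (simp add: sgn_div_norm)
  then have "(x - y) + (norm y - norm x) *\<^sub>R sgn y = x - norm x *\<^sub>R sgn y"
    by (simp add: scaleR_left_diff_distrib)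
  moreover have "(1 / norm x) *\<^sub>R (x - norm x *\<^sub>R sgn y) = sgn x - sgn y"
    using x by (simp add: sgn_div_norm[of x] scaleR_right_diff_distrib divide_inverse)
  ultimately have "sgn x - sgn y = (1 / norm x) *\<^sub>R ((x - y) + (norm y - norm x) *\<^sub>R sgn y)" by (simp only:)
  then have "norm (sgn x - sgn y) = (1 / norm x) * norm ((x - y) + (norm y - norm x) *\<^sub>R sgn y)" by simp
  also have "\<dots> \<le> 1 * (norm (x - y) + \<bar>norm y - norm x\<bar>)"
  proof (rule mult_mono)
    show "norm ((x - y) + (norm y - norm x) *\<^sub>R sgn y) \<le> norm (x - y) + \<bar>norm y - norm x\<bar>"
      by (rule order_trans[OF norm_triangle_ineq]) (use y in \<open>simp add: norm_sgn\<close>)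
  qed (use assms in \<open>auto simp: divide_le_eq\<close>)
  also have "\<bar>norm y - norm x\<bar> \<le> norm (x - y)" using norm_triangle_ineq3[of y x] by (simp add: norm_minus_commute)
  finally show ?thesis by simp
qed

lemma integral_powr_Icc:
  fixes a b \<sigma> :: real
  assumes "0 < a" "a \<le> b" "\<sigma> \<noteq> 0"
  shows "(LINT t:{a..b}|lborel. t powr (\<sigma> - 1)) = (b powr \<sigma> - a powr \<sigma>) / \<sigma>"
proof -
  have "(LINT t|lborel. indicator {a..b} t *\<^sub>R t powr (\<sigma> - 1)) = b powr \<sigma> / \<sigma> - a powr \<sigma> / \<sigma>"
  proof (rule integral_FTC_Icc[OF assms(2)])
    fix x assume "a \<le> x" "x \<le> b"
    then have "((\<lambda>t. t powr \<sigma> / \<sigma>) has_real_derivative x powr (\<sigma> - 1)) (at x)"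
      using assms by (auto intro!: derivative_eq_intros)
    then show "((\<lambda>t. t powr \<sigma> / \<sigma>) has_vector_derivative x powr (\<sigma> - 1)) (at x within {a..b})"
      by (simp add: has_real_derivative_iff_has_vector_derivative has_vector_derivative_at_within)
  qed (use assms in \<open>auto intro!: continuous_intros\<close>)
  then show ?thesis by (simp add: set_lebesgue_integral_def diff_divide_distrib)
qed

section \<open>The sign of the flux, the critical radius and the decay bootstrap\<close>

locale decaying_robin = radial_robin S s p \<beta> lam C\<^sub>0 g \<phi> f G T
  for S s p \<beta> lam C\<^sub>0 and g \<phi> :: "'a::euclidean_space \<Rightarrow> real" and f G T +
  fixes l :: real
  assumes beta: "\<beta> > 0" and pN: "p < real DIM('a)" and l: "l > p"
    and decay: "\<And>x. norm x > 1 \<Longrightarrow> g x \<le> C\<^sub>0 * norm x powr (- l)"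
begin

lemma k_1_eq: "k 1 = \<beta> * K * f 1 powr (p - 1)"
  using beta by (intro k_one) simp

text \<open>Separates the sign and the size of the flux from the factor r^(-(N-1)/(p-1)), the rate
  in (b): two-sided bounds on the gradient are two-sided bounds on |k|.\<close>

lemma v_eq:
  assumes "r \<ge> 1"
  shows "v r = sgn (k r) * (\<bar>k r\<bar> / K) powr (1 / (p - 1)) * r powr (- (real DIM('a) - 1) / (p - 1))"
proof -
  have r: "r > 0" using assms by simp
  have w: "w r = k r / K * r powr (- (real DIM('a) - 1))"
  proof -
    have "r powr (- (real DIM('a) - 1)) = 1 / r ^ (DIM('a) - 1)"
      unfolding powr_minus_divide using r by (simp add: powr_realpow[symmetric] of_nat_diff Suc_leI)
    then show ?thesis by (simp only: w_def) simp
  qed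
  have "sgn (w r) = sgn (k r)" using r K_pos by (simp add: w sgn_mult sgn_divide)
  moreover have "\<bar>w r\<bar> = \<bar>k r\<bar> / K * r powr (- (real DIM('a) - 1))" using K_pos by (simp add: w abs_mult)
  moreover have "(\<bar>k r\<bar> / K * r powr (- (real DIM('a) - 1))) powr (1 / (p - 1)) =
     (\<bar>k r\<bar> / K) powr (1 / (p - 1)) * r powr (- (real DIM('a) - 1) / (p - 1))"
    using K_pos by (subst powr_mult) (auto simp: powr_powr)
  ultimately show ?thesis by (simp add: v_def)
qed

lemma v_sign:
  assumes "r \<ge> 1"
  shows "v r > 0 \<longleftrightarrow> k r > 0" "v r < 0 \<longleftrightarrow> k r < 0" "v r = 0 \<longleftrightarrow> k r = 0"
proof -
  have "k r \<noteq> 0 \<Longrightarrow> (\<bar>k r\<bar> / K) powr (1 / (p - 1)) * r powr (- (real DIM('a) - 1) / (p - 1)) > 0"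
    using K_pos assms by simp
  then show "v r > 0 \<longleftrightarrow> k r > 0" "v r < 0 \<longleftrightarrow> k r < 0" "v r = 0 \<longleftrightarrow> k r = 0"
    unfolding v_eq[OF assms] mult.assoc by (auto simp: sgn_if zero_less_mult_iff mult_less_0_iff)
qed

lemma f_increasing:
  assumes "1 \<le> a" "a < b" "\<And>r. a < r \<Longrightarrow> r < b \<Longrightarrow> k r \<ge> 0"
  shows "f a \<le> f b"
proof (rule DERIV_nonneg_imp_increasing_open[of a b f])
  show "\<exists>y. (f has_real_derivative y) (at x) \<and> 0 \<le> y" if "a < x" "x < b" for x
    using f_deriv[of x] v_sign(2)[of x] assms(3)[OF that] that assms(1) by (intro exI[of _ "v x"]) auto
qed (use assms in \<open>auto intro!: f_cont_subset\<close>)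

lemma f_decreasing:
  assumes "1 \<le> a" "a < b" "\<And>r. a < r \<Longrightarrow> r < b \<Longrightarrow> k r < 0"
  shows "f b < f a"
proof (rule DERIV_neg_imp_decreasing_open[of a b f])
  show "\<exists>y. (f has_real_derivative y) (at x) \<and> y < 0" if "a < x" "x < b" for x
    using f_deriv[of x] v_sign(2)[of x] assms(3)[OF that] that assms(1) by (intro exI[of _ "v x"]) auto
qed (use assms in \<open>auto intro!: f_cont_subset\<close>)

text \<open>Otherwise the profile would be nondecreasing and stay above f(2) for all r > 2, against
  \<open>f_small\<close>.\<close>

lemma k_not_nonneg: "\<exists>r>1. k r < 0"
proof (rule ccontr)
  assume "\<not> (\<exists>r>1. k r < 0)"
  then have "k r \<ge> 0" if "r > 1" for r using that by (meson not_less)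
  then have "f 2 \<le> f r" if "r > 2" for r using that by (intro f_increasing) auto
  moreover obtain r where "r > 2" "f r < f 2" using f_small[of "f 2" 2] f_pos[of 2] by auto
  ultimately show False by (meson not_less)
qed

text \<open>For \<open>lam\<close> <= 0 the flux would never fall below k(1), which is nonnegative
  by the Robin condition; but the flux does become negative.\<close>

lemma lam_pos: "lam > 0"
proof (rule ccontr)
  assume "\<not> lam > 0"
  then have "k 1 \<le> k r" if "r > 1" for r using k_mono[of 1 r] that by simp
  moreover have "k 1 \<ge> 0" unfolding k_1_eq using beta K_pos by simp
  ultimately show False using k_not_nonneg by (meson order_trans not_less)
qed

lemma k_strict': "1 \<le> a \<Longrightarrow> a < b \<Longrightarrow> k b < k a"
  by (rule k_strict[OF lam_pos])

text \<open>A Hopf-type argument: if f(1) = 0, the Robin condition gives k(1) = 0, the flux is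
  negative immediately beyond the sphere, and the profile would drop below zero.\<close>

lemma f1_pos: "f 1 > 0"
proof (rule ccontr)
  assume "\<not> f 1 > 0"
  then have f1: "f 1 = 0" using f_nonneg[of 1] by simp
  then have "k 1 = 0" using k_1_eq p1 by simp
  then have "k r < 0" if "1 < r" for r using k_strict'[of 1 r] that by simp
  then have "f 2 < f 1" by (intro f_decreasing) auto
  then show False using f_pos[of 2] f1 by simp
qed

lemma k1_pos: "k 1 > 0"
  unfolding k_1_eq using beta K_pos f1_pos by simp

text \<open>The Robin condition solved for the slope at the sphere. This is the origin of
  \<beta>^(1/(p-1)) \<phi>(1) in (a).\<close>

lemma v1_eq: "v 1 = \<beta> powr (1 / (p - 1)) * f 1"
proof -
  have "v 1 = (\<beta> * f 1 powr (p - 1)) powr (1 / (p - 1))"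
    using v_eq[of 1] k1_pos K_pos by (simp add: k_1_eq)
  also have "\<dots> = \<beta> powr (1 / (p - 1)) * f 1"
    using beta f1_pos p1 by (simp add: powr_mult powr_powr)
  finally show ?thesis .
qed

lemma critical_radius:
  obtains rs where "rs > 1" "k rs = 0" "\<And>r. 1 \<le> r \<Longrightarrow> k r = 0 \<Longrightarrow> r = rs" "\<And>r. r > rs \<Longrightarrow> k r < 0"
proof -
  obtain b where b: "b > 1" "k b < 0" using k_not_nonneg by blast
  obtain rs where rs: "1 \<le> rs" "rs \<le> b" "k rs = 0"
    using IVT2'[of k b 0 1] b k1_pos continuous_on_subset[OF k_cont, of "{1..b}"] by auto
  then have "rs > 1" using k1_pos by (cases "rs = 1") auto
  show ?thesis
  proof (rule that[OF \<open>rs > 1\<close> rs(3)])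
    show "r = rs" if "1 \<le> r" "k r = 0" for r
      using k_strict'[of r rs] k_strict'[of rs r] that rs by (cases r rs rule: linorder_cases) auto
    show "k r < 0" if "r > rs" for r using k_strict'[of rs r] that rs by simp
  qed
qed

text \<open>For p > 2 the power 1/(p-1) is not Lipschitz at zero. On the range up to \<rho> the flux
  stays at least k(\<rho>) > 0, away from the singularity, and both factors of \<open>v\<close> are
  Lipschitz.\<close>

lemma v_lipschitz:
  assumes "k \<rho> > 0" "1 \<le> \<rho>" "\<rho> \<le> 2"
  obtains L where "L \<ge> 0" "\<And>r t. 1 \<le> r \<Longrightarrow> r \<le> \<rho> \<Longrightarrow> 1 \<le> t \<Longrightarrow> t \<le> \<rho> \<Longrightarrow> \<bar>v r - v t\<bar> \<le> L * \<bar>r - t\<bar>"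
proof -
  define q where "q = 1 / (p - 1)"
  define e where "e = - (real DIM('a) - 1) / (p - 1)"
  obtain L1 where L1: "L1 \<ge> 0" "\<And>a b. 1 \<le> a \<Longrightarrow> a \<le> b \<Longrightarrow> b \<le> 1 + 1 \<Longrightarrow> \<bar>k a - k b\<bar> \<le> L1 * (b - a)"
    by (rule k_lipschitz[OF order_refl]) (rule that)
  have kl: "\<bar>k r - k t\<bar> \<le> L1 * \<bar>r - t\<bar>" if "1 \<le> r" "r \<le> \<rho>" "1 \<le> t" "t \<le> \<rho>" for r t
    using L1(2)[of r t] L1(2)[of t r] that assms(3) by (cases "r \<le> t") (auto simp: abs_minus_commute)
  have kb: "k \<rho> \<le> k r" "k r \<le> k 1" if "1 \<le> r" "r \<le> \<rho>" for r
    using k_strict'[of r \<rho>] k_strict'[of 1 r] that by (cases "r = \<rho>"; cases "r = 1"; simp)+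
  have l0: "0 < k \<rho> / K" using assms(1) K_pos by simp
  obtain B1 where B1: "B1 \<ge> 0" "\<And>x y. k \<rho> / K \<le> x \<Longrightarrow> x \<le> k 1 / K \<Longrightarrow> k \<rho> / K \<le> y \<Longrightarrow> y \<le> k 1 / K \<Longrightarrow> \<bar>x powr q - y powr q\<bar> \<le> B1 * \<bar>x - y\<bar>"
    by (rule powr_lipschitz[OF l0, of "k 1 / K" q]) (rule that)
  obtain B2 where B2: "B2 \<ge> 0" "\<And>x y. 1 \<le> x \<Longrightarrow> x \<le> 2 \<Longrightarrow> 1 \<le> y \<Longrightarrow> y \<le> 2 \<Longrightarrow> \<bar>x powr e - y powr e\<bar> \<le> B2 * \<bar>x - y\<bar>"
    by (rule powr_lipschitz[OF zero_less_one, of 2 e]) (rule that)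
  have e0: "e \<le> 0" unfolding e_def using p1 by (auto simp: divide_nonpos_pos)
  define P where "P = (k 1 / K) powr q"
  show ?thesis
  proof (rule that[of "B1 * (L1 / K) + P * B2"])
    show "B1 * (L1 / K) + P * B2 \<ge> 0" using B1 B2 L1 K_pos by (simp add: P_def)
    fix r t assume rt: "1 \<le> r" "r \<le> \<rho>" "1 \<le> t" "t \<le> \<rho>"
    have V: "v x = (k x / K) powr q * x powr e" if "1 \<le> x" "x \<le> \<rho>" for x
      using v_eq[OF that(1)] kb(1)[OF that] assms(1) by (simp add: q_def e_def)
    have "v r - v t = ((k r / K) powr q - (k t / K) powr q) * r powr e + (k t / K) powr q * (r powr e - t powr e)"
      unfolding V[OF rt(1,2)] V[OF rt(3,4)] by (simp add: algebra_simps)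
    also have "\<bar>\<dots>\<bar> \<le> \<bar>(k r / K) powr q - (k t / K) powr q\<bar> * \<bar>r powr e\<bar> + \<bar>(k t / K) powr q\<bar> * \<bar>r powr e - t powr e\<bar>"
      unfolding abs_mult[symmetric] by (rule abs_triangle_ineq)
    also have "\<dots> \<le> (B1 * (L1 / K * \<bar>r - t\<bar>)) * 1 + P * (B2 * \<bar>r - t\<bar>)"
    proof (intro add_mono mult_mono)
      have "\<bar>(k r / K) powr q - (k t / K) powr q\<bar> \<le> B1 * \<bar>k r / K - k t / K\<bar>"
        using kb rt K_pos by (intro B1(2) divide_right_mono) auto
      also have "\<bar>k r / K - k t / K\<bar> = \<bar>k r - k t\<bar> / K" using K_pos by (simp add: diff_divide_distrib[symmetric])
      also have "\<dots> \<le> L1 * \<bar>r - t\<bar> / K" using kl[OF rt] K_pos by (intro divide_right_mono) auto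
      finally show "\<bar>(k r / K) powr q - (k t / K) powr q\<bar> \<le> B1 * (L1 / K * \<bar>r - t\<bar>)"
        using B1(1) by (simp add: mult_left_mono)
      show "\<bar>r powr e\<bar> \<le> 1" using rt e0 powr_mono[of e 0 r] by simp
      have "0 \<le> k t / K" using kb(1)[OF rt(3,4)] assms(1) K_pos by simp
      then show "\<bar>(k t / K) powr q\<bar> \<le> P" unfolding P_def
        using kb(2)[OF rt(3,4)] K_pos p1 by (simp add: q_def) (intro powr_mono2 divide_right_mono; simp)
      show "\<bar>r powr e - t powr e\<bar> \<le> B2 * \<bar>r - t\<bar>" using rt assms(3) by (intro B2) auto
    qed (use B1 L1 K_pos in \<open>auto simp: P_def\<close>)
    also have "\<dots> = (B1 * (L1 / K) + P * B2) * \<bar>r - t\<bar>" by (simp add: algebra_simps)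
    finally show "\<bar>v r - v t\<bar> \<le> (B1 * (L1 / K) + P * B2) * \<bar>r - t\<bar>" .
  qed
qed

text \<open>For t >= 1 the rate l may be weakened to p + \<epsilon>. The integrand is then at most C
  t^(-(p+\<epsilon>)) t^(-\<gamma>) t^(N-1) = C t^(\<sigma>-1), which defines \<sigma>. The case
  \<sigma> = 0 is excluded since its primitive is a logarithm.\<close>

lemma flux_growth:
  assumes r0: "r0 \<ge> 1" "k r0 = 0" and eps: "p + \<epsilon> \<le> l"
    and C: "C \<ge> 0" "\<And>r. r \<ge> r0 \<Longrightarrow> f r powr (p - 1) \<le> C * r powr (- \<gamma>)"
    and \<sigma>: "\<sigma> = real DIM('a) - p - \<epsilon> - \<gamma>" "\<sigma> \<noteq> 0"
  obtains D where "D \<ge> 0" "\<And>r. r \<ge> r0 \<Longrightarrow> - k r \<le> D * ((r powr \<sigma> - r0 powr \<sigma>) / \<sigma>)"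
proof -
  have C0: "C\<^sub>0 \<ge> 0"
  proof -
    obtain b :: 'a where b: "b \<in> Basis" using nonempty_Basis by blast
    have "norm (2 *\<^sub>R b) > 1" using b by simp
    then show ?thesis using g_pos[of "2 *\<^sub>R b"] g_le[of "2 *\<^sub>R b"] by linarith
  qed
  show ?thesis
  proof (rule that[of "lam * (C\<^sub>0 * K) * C"])
    show "lam * (C\<^sub>0 * K) * C \<ge> 0" using lam_pos C0 K_pos C(1) by simp
    fix r assume r: "r \<ge> r0"
    have "(LINT t:{r0..r}|lborel. t powr (- l) * f t powr (p - 1) * t ^ (DIM('a) - 1)) \<le> (LINT t:{r0..r}|lborel. C * t powr (\<sigma> - 1))"
      unfolding set_lebesgue_integral_def
    proof (rule integral_mono)
      show "integrable lborel (\<lambda>t. indicator {r0..r} t *\<^sub>R (t powr (- l) * f t powr (p - 1) * t ^ (DIM('a) - 1)))"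
        using r0 p1 by (intro borel_integrable_compact continuous_intros continuous_on_powr' f_cont_subset) (auto intro: f_nonneg)
      show "integrable lborel (\<lambda>t. indicator {r0..r} t *\<^sub>R (C * t powr (\<sigma> - 1)))"
        using r0 by (intro borel_integrable_compact continuous_intros) auto
      fix t
      have "t powr (- l) * f t powr (p - 1) * t ^ (DIM('a) - 1) \<le> C * t powr (\<sigma> - 1)" if t: "t \<ge> r0"
      proof -
        have t1: "t \<ge> 1" "t > 0" using t r0 by auto
        have "t powr (- l) * f t powr (p - 1) * t ^ (DIM('a) - 1) \<le> t powr (- (p + \<epsilon>)) * (C * t powr (- \<gamma>)) * t powr (real DIM('a) - 1)"
          using t1 eps C t by (intro mult_mono powr_mono) (auto simp: powr_realpow[symmetric] of_nat_diff)
        also have "\<dots> = C * (t powr (- (p + \<epsilon>)) * t powr (- \<gamma>) * t powr (real DIM('a) - 1))" by simp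
        also have "t powr (- (p + \<epsilon>)) * t powr (- \<gamma>) * t powr (real DIM('a) - 1) = t powr (\<sigma> - 1)"
          unfolding powr_add[symmetric] by (simp add: \<sigma>(1) algebra_simps)
        finally show ?thesis .
      qed
      then show "indicator {r0..r} t *\<^sub>R (t powr (- l) * f t powr (p - 1) * t ^ (DIM('a) - 1)) \<le> indicator {r0..r} t *\<^sub>R (C * t powr (\<sigma> - 1))"
        by (auto simp: indicator_def)
    qed
    also have "\<dots> = C * ((r powr \<sigma> - r0 powr \<sigma>) / \<sigma>)"
      using integral_powr_Icc[of r0 r \<sigma>] r0 r \<sigma>(2) by simp
    finally have le: "(LINT t:{r0..r}|lborel. t powr (- l) * f t powr (p - 1) * t ^ (DIM('a) - 1)) \<le> C * ((r powr \<sigma> - r0 powr \<sigma>) / \<sigma>)" .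
    have "- k r \<le> lam * (C\<^sub>0 * K) * (LINT t:{r0..r}|lborel. t powr (- l) * f t powr (p - 1) * t ^ (DIM('a) - 1))"
      using k_decrease[of r0 r C\<^sub>0 l] lam_pos r0 r decay by simp
    also have "\<dots> \<le> lam * (C\<^sub>0 * K) * (C * ((r powr \<sigma> - r0 powr \<sigma>) / \<sigma>))"
      using le lam_pos C0 K_pos by (intro mult_left_mono) auto
    finally show "- k r \<le> lam * (C\<^sub>0 * K) * C * ((r powr \<sigma> - r0 powr \<sigma>) / \<sigma>)" by (simp add: mult.assoc)
  qed
qed

text \<open>The other half of the bootstrap. A flux of size at most D r^\<sigma> bounds the slope by
  c r^(-\<mu>-1), where \<sigma> < N - p makes \<mu> positive. Integrating this from infinity, where
  the profile becomes arbitrarily small by \<open>f_small\<close>, gives the decay.\<close>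

lemma decay_from_flux:
  assumes r0: "r0 \<ge> 1" "k r0 = 0" "\<And>r. r > r0 \<Longrightarrow> k r < 0"
    and D: "D \<ge> 0" "\<And>r. r \<ge> r0 \<Longrightarrow> - k r \<le> D * r powr \<sigma>" and \<sigma>: "\<sigma> < real DIM('a) - p"
  defines "\<mu> \<equiv> (real DIM('a) - p - \<sigma>) / (p - 1)"
  shows "r \<ge> r0 \<Longrightarrow> f r \<le> (D / K) powr (1 / (p - 1)) / \<mu> * r powr (- \<mu>)"
proof -
  define c where "c = (D / K) powr (1 / (p - 1))"
  have mu: "\<mu> > 0" unfolding \<mu>_def using \<sigma> p1 by simp
  have vb: "v r \<ge> - c * r powr (- \<mu> - 1)" if r: "r > r0" for r
  proof -
    have r1: "r \<ge> 1" using r r0 by simp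
    have "\<bar>k r\<bar> \<le> D * r powr \<sigma>" using D(2)[of r] r r0(3)[OF r] by simp
    then have "\<bar>k r\<bar> / K \<le> D * r powr \<sigma> / K" using K_pos by (intro divide_right_mono) auto
    then have "\<bar>k r\<bar> / K \<le> D / K * r powr \<sigma>" by simp
    then have "(\<bar>k r\<bar> / K) powr (1 / (p - 1)) \<le> (D / K * r powr \<sigma>) powr (1 / (p - 1))"
      using K_pos p1 by (intro powr_mono2) auto
    also have "\<dots> = c * r powr (\<sigma> / (p - 1))"
      using D(1) K_pos by (subst powr_mult) (auto simp: c_def powr_powr)
    finally have "(\<bar>k r\<bar> / K) powr (1 / (p - 1)) * r powr (- (real DIM('a) - 1) / (p - 1)) \<le>
      c * r powr (\<sigma> / (p - 1)) * r powr (- (real DIM('a) - 1) / (p - 1))"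
      by (rule mult_right_mono) simp
    also have "\<dots> = c * r powr (- \<mu> - 1)"
    proof -
      have "\<sigma> / (p - 1) + - (real DIM('a) - 1) / (p - 1) = - \<mu> - 1"
      proof -
        have one: "(p - 1) / (p - 1) = 1" using p1 by simp
        have "- \<mu> - 1 = (- (real DIM('a) - p - \<sigma>) - (p - 1)) / (p - 1)"
          unfolding diff_divide_distrib[of "- (real DIM('a) - p - \<sigma>)" "p - 1"] one \<mu>_def by (simp only: minus_divide_left)
        also have "- (real DIM('a) - p - \<sigma>) - (p - 1) = \<sigma> + - (real DIM('a) - 1)" by simp
        finally show ?thesis by (simp only: add_divide_distrib)
      qed
      then show ?thesis by (simp only: mult.assoc powr_add[symmetric])
    qed
    finally show ?thesis using v_eq[OF r1] r0(3)[OF r] by simp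
  qed
  assume r: "r \<ge> r0"
  \<comment> \<open>The slope bound makes this difference nondecreasing. If it were positive at r it
    would stay above that value, and so would f, which contradicts \<open>f_small\<close>; no limit
    of f at infinity has to be known beforehand.\<close>
  have mono: "f r - c / \<mu> * r powr (- \<mu>) \<le> f R - c / \<mu> * R powr (- \<mu>)" if R: "R > r" for R
  proof (rule DERIV_nonneg_imp_increasing_open[of r R "\<lambda>r. f r - c / \<mu> * r powr (- \<mu>)"])
    fix x assume x: "r < x" "x < R"
    then have x1: "x > 1" "x > r0" using r r0 by auto
    have "((\<lambda>r. f r - c / \<mu> * r powr (- \<mu>)) has_real_derivative v x - c / \<mu> * (- \<mu> * x powr (- \<mu> - 1))) (at x)"
      using x1 by (auto intro!: derivative_eq_intros f_deriv)
    moreover have "v x - c / \<mu> * (- \<mu> * x powr (- \<mu> - 1)) \<ge> 0"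
      using vb[OF x1(2)] mu by simp
    ultimately show "\<exists>y. ((\<lambda>r. f r - c / \<mu> * r powr (- \<mu>)) has_real_derivative y) (at x) \<and> 0 \<le> y" by blast
  qed (use r r0(1) R mu in \<open>auto intro!: continuous_intros f_cont_subset\<close>)
  show "f r \<le> (D / K) powr (1 / (p - 1)) / \<mu> * r powr (- \<mu>)"
  proof (rule ccontr)
    assume "\<not> ?thesis"
    then have "f r - c / \<mu> * r powr (- \<mu>) > 0" by (simp add: c_def)
    then obtain R where R: "R > r" "f R < f r - c / \<mu> * r powr (- \<mu>)" using f_small by blast
    have "c / \<mu> * R powr (- \<mu>) \<ge> 0" using mu by (simp add: c_def)
    then show False using mono[OF R(1)] R(2) by linarith
  qed
qed

text \<open>Each round improves the decay exponent by a fixed amount; the amount is chosen so that the critical exponent is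
  jumped over, never hit.\<close>
lemma flux_bounded:
  assumes r0: "r0 \<ge> 1" "k r0 = 0" "\<And>r. r > r0 \<Longrightarrow> k r < 0"
  obtains B where "B > 0" "\<And>r. r \<ge> r0 \<Longrightarrow> \<bar>k r\<bar> \<le> B"
proof -
  define d where "d = real DIM('a) - p"
  have d0: "d > 0" using pN by (simp add: d_def)
  obtain J :: nat where J: "d / (l - p) < real J" using reals_Archimedean2 by blast
  \<comment> \<open>The half in the denominator places d = N - p strictly between J \<epsilon> and
    (J + 1) \<epsilon>. J is chosen so large that \<epsilon> < l - p, the gain that the decay of
    \<open>g\<close> affords.\<close>
  define \<epsilon> where "\<epsilon> = d / (real J + 1/2)"
  have eps0: "\<epsilon> > 0" using d0 by (simp add: \<epsilon>_def)
  have Je: "real J * \<epsilon> < d" "real (Suc J) * \<epsilon> > d"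
    using d0 by (auto simp: \<epsilon>_def field_simps)
  have eps: "p + \<epsilon> \<le> l"
  proof -
    have "d < real J * (l - p)" using J l by (simp add: pos_divide_less_eq)
    also have "\<dots> \<le> (real J + 1/2) * (l - p)" using l by (intro mult_right_mono) auto
    finally have "\<epsilon> < l - p" by (simp add: \<epsilon>_def pos_divide_less_eq mult.commute)
    then show ?thesis by simp
  qed
  have claim: "\<exists>C\<ge>0. \<forall>r\<ge>r0. f r powr (p - 1) \<le> C * r powr (- (real j * \<epsilon>))" if "j \<le> J" for j
    using that
  proof (induction j)
    case 0
    have "f r powr (p - 1) \<le> f r0 powr (p - 1) * r powr (- (real 0 * \<epsilon>))" if r: "r \<ge> r0" for r
    proof -
      have "f r \<le> f r0" using f_decreasing[of r0 r] r r0 by (cases "r = r0") auto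
      then have "f r powr (p - 1) \<le> f r0 powr (p - 1)" using f_nonneg[of r] r r0 p1 by (intro powr_mono2) auto
      then show ?thesis using r r0 by simp
    qed
    then show ?case by (intro exI[of _ "f r0 powr (p - 1)"]) auto
  next
    case (Suc j)
    then obtain C where C: "C \<ge> 0" "\<And>r. r \<ge> r0 \<Longrightarrow> f r powr (p - 1) \<le> C * r powr (- (real j * \<epsilon>))" by auto
    \<comment> \<open>Equal to d - (j + 1) \<epsilon>, and still positive because j + 1 <= J. The
      flux may grow in this round, but slower than r^d.\<close>
    define \<sigma> where "\<sigma> = real DIM('a) - p - \<epsilon> - real j * \<epsilon>"
    have "real (Suc j) * \<epsilon> \<le> real J * \<epsilon>" using Suc.prems eps0 by (intro mult_right_mono) auto
    then have s0: "\<sigma> > 0" using Je(1) by (simp add: \<sigma>_def d_def algebra_simps)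
    then have "\<sigma> \<noteq> 0" by simp
    then obtain D where D: "D \<ge> 0" "\<And>r. r \<ge> r0 \<Longrightarrow> - k r \<le> D * ((r powr \<sigma> - r0 powr \<sigma>) / \<sigma>)"
      using flux_growth[OF r0(1,2) eps C(1) _ \<sigma>_def] C(2) by blast
    have D': "- k r \<le> (D / \<sigma>) * r powr \<sigma>" if "r \<ge> r0" for r
    proof -
      have "D * ((r powr \<sigma> - r0 powr \<sigma>) / \<sigma>) \<le> D * (r powr \<sigma> / \<sigma>)"
        using D(1) s0 by (intro mult_left_mono divide_right_mono) auto
      then show ?thesis using D(2)[OF that] by simp
    qed
    have "real j * \<epsilon> \<ge> 0" using eps0 by simp
    then have sl: "\<sigma> < real DIM('a) - p" using eps0 unfolding \<sigma>_def by linarith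
    define \<mu> where "\<mu> = (real DIM('a) - p - \<sigma>) / (p - 1)"
    define c where "c = (D / \<sigma> / K) powr (1 / (p - 1)) / \<mu>"
    have mu: "\<mu> > 0" using sl p1 by (simp add: \<mu>_def)
    have c0: "c \<ge> 0" using mu by (simp add: c_def)
    have "f r powr (p - 1) \<le> c powr (p - 1) * r powr (- (real (Suc j) * \<epsilon>))" if r: "r \<ge> r0" for r
    proof -
      have "f r \<le> c * r powr (- \<mu>)"
        unfolding c_def \<mu>_def by (rule decay_from_flux[OF r0(1,2) _ _ _ sl r]) (use r0(3) D D' s0 in auto)
      then have "f r powr (p - 1) \<le> (c * r powr (- \<mu>)) powr (p - 1)"
        using f_nonneg[of r] r r0 p1 by (intro powr_mono2) auto
      also have "\<dots> = c powr (p - 1) * r powr (- (real (Suc j) * \<epsilon>))"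
      proof -
        \<comment> \<open>Raising the new decay of f to the power p - 1 yields (j + 1) \<epsilon>,
          one more \<epsilon> than before.\<close>
        have "\<mu> * (p - 1) = real DIM('a) - p - \<sigma>" using p1 by (simp add: \<mu>_def)
        then have "\<mu> * (p - 1) = real (Suc j) * \<epsilon>" by (simp add: \<sigma>_def algebra_simps)
        then show ?thesis using c0 by (simp add: powr_mult powr_powr)
      qed
      finally show ?thesis .
    qed
    then show ?case by (intro exI[of _ "c powr (p - 1)"]) auto
  qed
  obtain C where C: "C \<ge> 0" "\<And>r. r \<ge> r0 \<Longrightarrow> f r powr (p - 1) \<le> C * r powr (- (real J * \<epsilon>))" using claim[of J] by auto
  \<comment> \<open>The last round: \<sigma> = d - (J + 1) \<epsilon> is negative, so the integral
    converges at infinity and the flux is bounded.\<close>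
  define \<sigma> where "\<sigma> = real DIM('a) - p - \<epsilon> - real J * \<epsilon>"
  have s0: "\<sigma> < 0" using Je(2) by (simp add: \<sigma>_def d_def algebra_simps)
  then have "\<sigma> \<noteq> 0" by simp
  then obtain D where D: "D \<ge> 0" "\<And>r. r \<ge> r0 \<Longrightarrow> - k r \<le> D * ((r powr \<sigma> - r0 powr \<sigma>) / \<sigma>)"
    using flux_growth[OF r0(1,2) eps C(1) _ \<sigma>_def] C(2) by blast
  show ?thesis
  proof (rule that[of "D * (r0 powr \<sigma> / (- \<sigma>)) + 1"])
    have "D * (r0 powr \<sigma> / (- \<sigma>)) \<ge> 0" using D(1) s0 by (intro mult_nonneg_nonneg divide_nonneg_pos) auto
    then show "D * (r0 powr \<sigma> / (- \<sigma>)) + 1 > 0" by linarith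
    fix r assume r: "r \<ge> r0"
    have "(r powr \<sigma> - r0 powr \<sigma>) / \<sigma> = (r0 powr \<sigma> - r powr \<sigma>) / (- \<sigma>)" by (simp add: minus_divide_left[symmetric] diff_divide_distrib)
    also have "\<dots> \<le> r0 powr \<sigma> / (- \<sigma>)" using s0 by (intro divide_right_mono) auto
    finally have "D * ((r powr \<sigma> - r0 powr \<sigma>) / \<sigma>) \<le> D * (r0 powr \<sigma> / (- \<sigma>))" using D(1) by (rule mult_left_mono)
    then have "- k r \<le> D * (r0 powr \<sigma> / (- \<sigma>))" using D(2)[OF r] by linarith
    moreover have "k r \<le> 0" using r0(3)[of r] r0(2) r by (cases "r = r0") auto
    ultimately show "\<bar>k r\<bar> \<le> D * (r0 powr \<sigma> / (- \<sigma>)) + 1" by linarith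
  qed
qed

lemma V_gderiv:
  assumes "norm x > 1"
  shows "GDERIV \<phi> x :> V x"
proof -
  have x0: "x \<noteq> 0" using assms by auto
  have "((\<lambda>x. f (norm x)) has_derivative (\<lambda>h. v (norm x) * (sgn x \<bullet> h))) (at x)"
    by (rule radial_has_derivative[OF x0 f_deriv[OF assms]])
  then have "(\<phi> has_derivative (\<lambda>h. v (norm x) * (sgn x \<bullet> h))) (at x)"
    by (rule has_derivative_transform_within_open[of _ _ _ UNIV ext_ball])
      (use assms ext_ball_open phi_eq in \<open>auto simp: ext_ball_def\<close>)
  then show ?thesis by (simp add: gderiv_def V_def inner_commute)
qed

text \<open>The gradient is Lipschitz near the sphere, and on a bounded set this gives every smaller
  Hoelder exponent; 1/2 is a convenient choice. The two-sided bound is continuity of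
  \<open>v\<close> at 1 together with v(1) > 0.\<close>

lemma gradient_near_boundary:
  obtains \<delta> where "\<delta> > 0" "hoelder_on (1/2) {x. 1 < norm x \<and> norm x < 1 + \<delta>} V"
    "\<And>x. norm x > 1 \<Longrightarrow> norm x < 1 + \<delta> \<Longrightarrow> v 1 / 2 \<le> norm (V x) \<and> norm (V x) \<le> 2 * v 1"
proof -
  have v1: "v 1 > 0" using v_sign(1)[of 1] k1_pos by simp
  obtain rs where rs: "rs > 1" "k rs = 0" by (rule critical_radius) (rule that)
  obtain d where d: "d > 0" "\<And>r. r \<ge> 1 \<Longrightarrow> \<bar>r - 1\<bar> < d \<Longrightarrow> \<bar>v r - v 1\<bar> < v 1 / 2"
  proof -
    obtain d where "d > 0" "\<forall>r\<in>{1..}. dist r 1 < d \<longrightarrow> dist (v r) (v 1) < v 1 / 2"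
      using v_cont[OF subset_refl, unfolded continuous_on_iff, rule_format, of 1 "v 1 / 2"] v1 by auto
    then show ?thesis by (intro that[of d]) (auto simp: dist_real_def)
  qed
  \<comment> \<open>Strictly between 1 and the critical radius, so that the flux is still positive
    at \<rho>, and at most 2, as \<open>v_lipschitz\<close> asks.\<close>
  define \<rho> where "\<rho> = min 2 ((1 + rs) / 2)"
  have \<rho>: "1 < \<rho>" "\<rho> \<le> 2" "\<rho> < rs" using rs(1) by (auto simp: \<rho>_def min_less_iff_disj)
  have kr: "k \<rho> > 0" using k_strict'[of \<rho> rs] \<rho> rs by simp
  obtain L where L: "L \<ge> 0" "\<And>r t. 1 \<le> r \<Longrightarrow> r \<le> \<rho> \<Longrightarrow> 1 \<le> t \<Longrightarrow> t \<le> \<rho> \<Longrightarrow> \<bar>v r - v t\<bar> \<le> L * \<bar>r - t\<bar>"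
    by (rule v_lipschitz[OF kr less_imp_le[OF \<rho>(1)] \<rho>(2)]) (rule that)
  define \<delta> where "\<delta> = min d (\<rho> - 1)"
  have dl: "\<delta> > 0" "\<delta> \<le> d" "1 + \<delta> \<le> \<rho>" using d \<rho> by (auto simp: \<delta>_def)
  have vb: "v 1 / 2 \<le> v r" "v r \<le> 2 * v 1" if "1 \<le> r" "r < 1 + \<delta>" for r
  proof -
    have "\<bar>v r - v 1\<bar> < v 1 / 2" using that dl by (intro d(2)) auto
    then show "v 1 / 2 \<le> v r" "v r \<le> 2 * v 1" unfolding abs_less_iff using v1 by linarith+
  qed
  have H: "norm (V x - V y) \<le> ((L + 4 * v 1) * 2) * norm (x - y) powr (1/2)"
    if x: "1 < norm x" "norm x < 1 + \<delta>" and y: "1 < norm y" "norm y < 1 + \<delta>" for x y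
  proof -
    \<comment> \<open>Both points lie in the ball of radius 2, so their distance t is at most 4 and
      t <= 2 t^(1/2).\<close>
    have sq: "norm (x - y) \<le> 2 * norm (x - y) powr (1/2)"
    proof -
      have "norm (x - y) \<le> 4" using norm_triangle_ineq4[of x y] x y dl \<rho> by linarith
      then have "norm (x - y) powr (1/2) \<le> 4 powr (1/2)" by (intro powr_mono2) auto
      then have "norm (x - y) powr (1/2) * norm (x - y) powr (1/2) \<le> 2 * norm (x - y) powr (1/2)"
        by (intro mult_right_mono) (auto simp: powr_half_sqrt)
      then show ?thesis by (simp add: powr_add[symmetric])
    qed
    have "V x - V y = (v (norm x) - v (norm y)) *\<^sub>R sgn x + v (norm y) *\<^sub>R (sgn x - sgn y)"
      by (simp add: V_def algebra_simps)
    also have "norm \<dots> \<le> \<bar>v (norm x) - v (norm y)\<bar> * norm (sgn x) + \<bar>v (norm y)\<bar> * norm (sgn x - sgn y)"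
      by (rule order_trans[OF norm_triangle_ineq]) simp
    also have "\<dots> \<le> (L * norm (x - y)) * 1 + (2 * v 1) * (2 * norm (x - y))"
    proof (intro add_mono mult_mono)
      have "\<bar>v (norm x) - v (norm y)\<bar> \<le> L * \<bar>norm x - norm y\<bar>" using x y dl by (intro L(2)) auto
      also have "\<dots> \<le> L * norm (x - y)" using L(1) norm_triangle_ineq3 by (intro mult_left_mono) auto
      finally show "\<bar>v (norm x) - v (norm y)\<bar> \<le> L * norm (x - y)" .
      show "norm (sgn x) \<le> 1" by (simp add: norm_sgn)
      show "\<bar>v (norm y)\<bar> \<le> 2 * v 1" using vb[of "norm y"] y v1 by auto
      show "norm (sgn x - sgn y) \<le> 2 * norm (x - y)" using x y by (intro sgn_lipschitz) auto
    qed (use L v1 in auto)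
    also have "\<dots> = (L + 4 * v 1) * norm (x - y)" by (simp add: algebra_simps)
    also have "\<dots> \<le> (L + 4 * v 1) * (2 * norm (x - y) powr (1/2))"
      using sq L(1) v1 by (intro mult_left_mono) auto
    finally show ?thesis by (simp only: mult.assoc)
  qed
  show ?thesis
  proof (rule that[OF dl(1)])
    show "hoelder_on (1/2) {x. 1 < norm x \<and> norm x < 1 + \<delta>} V"
      unfolding hoelder_on_def using H by (intro exI[of _ "(L + 4 * v 1) * 2"]) auto
    show "v 1 / 2 \<le> norm (V x) \<and> norm (V x) \<le> 2 * v 1" if "norm x > 1" "norm x < 1 + \<delta>" for x
      using vb[of "norm x"] that v1 V_norm[OF that(1)] by auto
  qed
qed

text \<open>Beyond the critical radius |k| increases, so its value at twice that radius bounds it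
  from below; \<open>flux_bounded\<close> bounds it from above. Twice the radius is used because |k|
  vanishes at the critical radius itself.\<close>

lemma gradient_at_infinity:
  assumes rs: "rs > 1" "k rs = 0" "\<And>r. r > rs \<Longrightarrow> k r < 0" and \<theta>: "\<theta> \<ge> 0"
  obtains C1 C2 where "0 < C1" "C1 < C2"
    "\<And>x. norm x > 2 * rs \<Longrightarrow> C1 * norm x powr (- (real DIM('a) - 1) / (p - 1)) \<le> norm (V x) \<and>
      norm (V x) \<le> C2 * ln (norm x) powr \<theta> * norm x powr (- (real DIM('a) - 1) / (p - 1))"
proof -
  obtain B where B: "B > 0" "\<And>r. r \<ge> rs \<Longrightarrow> \<bar>k r\<bar> \<le> B"
    using flux_bounded[OF less_imp_le[OF rs(1)] rs(2)] rs(3) by blast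
  define q where "q = 1 / (p - 1)"
  have q: "q > 0" using p1 by (simp add: q_def)
  define e where "e = - (real DIM('a) - 1) / (p - 1)"
  have kr: "k (2 * rs) < 0" using rs by (intro rs(3)) auto
  define C1 where "C1 = (\<bar>k (2 * rs)\<bar> / K) powr q"
  \<comment> \<open>For |x| > 2 the factor (log |x|)^\<theta> is at least (log 2)^\<theta>, so
    dividing the bound by this number lets the logarithm be inserted. The alternative C1 + 1 keeps
    C1 < C2.\<close>
  define C2 where "C2 = max (C1 + 1) ((B / K) powr q / ln 2 powr \<theta>)"
  have C1: "C1 > 0" using kr K_pos by (simp add: C1_def)
  have ln2: "ln 2 powr \<theta> > (0::real)" by simp
  show ?thesis
  proof (rule that[OF C1])
    show "C1 < C2" by (simp add: C2_def)
    fix x :: 'a assume x: "norm x > 2 * rs"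
    then have x1: "norm x > 1" "norm x > rs" "norm x > 2" using rs by auto
    have V: "norm (V x) = (\<bar>k (norm x)\<bar> / K) powr q * norm x powr e"
      unfolding V_norm[OF x1(1)] using v_eq[of "norm x"] x1 rs(3)[OF x1(2)] by (simp add: q_def e_def abs_mult)
    have "k (norm x) < k (2 * rs)" using x rs(1) by (intro k_strict') auto
    then have "\<bar>k (2 * rs)\<bar> \<le> \<bar>k (norm x)\<bar>" using kr by linarith
    then have "C1 \<le> (\<bar>k (norm x)\<bar> / K) powr q"
      unfolding C1_def using K_pos q by (intro powr_mono2 divide_right_mono) auto
    then have low: "C1 * norm x powr e \<le> norm (V x)" unfolding V by (rule mult_right_mono) simp
    have "(\<bar>k (norm x)\<bar> / K) powr q \<le> (B / K) powr q"
      using B(2)[of "norm x"] x1 K_pos q by (intro powr_mono2 divide_right_mono) auto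
    also have "\<dots> \<le> C2 * ln 2 powr \<theta>"
    proof -
      have "(B / K) powr q = ((B / K) powr q / ln 2 powr \<theta>) * ln 2 powr \<theta>" using ln2 by simp
      also have "\<dots> \<le> C2 * ln 2 powr \<theta>" by (intro mult_right_mono) (auto simp: C2_def)
      finally show ?thesis .
    qed
    also have "\<dots> \<le> C2 * ln (norm x) powr \<theta>"
    proof (intro mult_left_mono powr_mono2)
      show "ln 2 \<le> ln (norm x)" using x1(3) by (subst ln_le_cancel_iff) auto
    qed (use \<theta> C1 in \<open>auto simp: C2_def\<close>)
    finally have "norm (V x) \<le> C2 * ln (norm x) powr \<theta> * norm x powr e" unfolding V by (rule mult_right_mono) simp
    then show "C1 * norm x powr (- (real DIM('a) - 1) / (p - 1)) \<le> norm (V x) \<and>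
      norm (V x) \<le> C2 * ln (norm x) powr \<theta> * norm x powr (- (real DIM('a) - 1) / (p - 1))"
      using low unfolding e_def by simp
  qed
qed

end

section \<open>The gradient estimates for the eigenfunction\<close>

theorem theorem1p3:
  fixes p \<beta> l C\<^sub>0 :: real
    and g \<phi> :: "'a::euclidean_space \<Rightarrow> real"
    and \<Phi>r :: "real \<Rightarrow> real"
  assumes N2: "DIM('a) \<ge> 2"
    and p: "1 < p" "p < real DIM('a)"
    and beta: "\<beta> > 0"
    and gF: "F_space (real DIM('a) / p) ext_ball g"
    and gL: "Lp_on (real DIM('a) / p) ext_ball g"
    and grad: "radial g ext_ball"
    and gpos: "\<forall>x\<in>ext_ball. g x > 0"
    and gdecay: "l > p" "C\<^sub>0 > 0" "\<forall>x\<in>ext_ball. g x \<le> C\<^sub>0 * norm x powr (- l)"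
    and eig: "robin_eigen p \<beta> g (lambda1 p \<beta> g) \<phi>"
    and phipos: "\<forall>x\<in>ext_ball. \<phi> x > 0"
    and phirad: "\<forall>x. norm x \<ge> 1 \<longrightarrow> \<phi> x = \<Phi>r (norm x)"
    and phicont: "continuous_on {x. norm x \<ge> 1} \<phi>"
  shows "\<exists>D\<phi> :: 'a \<Rightarrow> 'a. (\<forall>x\<in>ext_ball. GDERIV \<phi> x :> D\<phi> x) \<and>
     (\<exists>m M C \<delta> \<alpha>. 0 < m \<and> m < M \<and> C > 0 \<and> \<delta> > 0 \<and> 0 < \<alpha> \<and> \<alpha> < 1 \<and>
        hoelder_on \<alpha> {x. 1 < norm x \<and> norm x < 1 + \<delta>} D\<phi> \<and>
        (\<forall>x\<in>ext_ball. norm x - 1 < \<delta> \<longrightarrow>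
           m * \<beta> powr (1 / (p - 1)) * \<Phi>r 1 \<le> norm (D\<phi> x) \<and>
           norm (D\<phi> x) \<le> M * \<beta> powr (1 / (p - 1)) * \<Phi>r 1 * (1 + C * (norm x - 1) powr \<alpha>))) \<and>
     (\<exists>r\<^sub>s. r\<^sub>s > 1 \<and> (\<Phi>r has_real_derivative 0) (at r\<^sub>s) \<and>
        (\<forall>s. s > 1 \<and> (\<Phi>r has_real_derivative 0) (at s) \<longrightarrow> s = r\<^sub>s) \<and>
        (\<exists>C1 C2. 0 < C1 \<and> C1 < C2 \<and>
           (\<forall>x. norm x > 2 * r\<^sub>s \<longrightarrow>
              C1 * norm x powr (- (real DIM('a) - 1) / (p - 1)) \<le> norm (D\<phi> x) \<and>
              norm (D\<phi> x) \<le> C2 * ln (norm x) powr ((real DIM('a) - p) / (real DIM('a) * (p - 1)))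
                                 * norm x powr (- (real DIM('a) - 1) / (p - 1)))))"
proof -
  obtain S s where step: "smooth_step S s" using smooth_step_ex by blast
  \<comment> \<open>A unit vector: along its ray the continuity and positivity of \<phi> pass to the
    profile.\<close>
  obtain e :: 'a where e: "e \<in> Basis" using nonempty_Basis by blast
  have Phi_eq: "\<Phi>r r = \<phi> (r *\<^sub>R e)" if "r \<ge> 1" for r using phirad[rule_format, of "r *\<^sub>R e"] that e by simp
  have Phi_cont: "continuous_on {1..} \<Phi>r"
  proof -
    have "continuous_on {1..} (\<lambda>r. \<phi> (r *\<^sub>R e))"
      by (rule continuous_on_compose2[OF phicont]) (use e in \<open>auto intro!: continuous_intros\<close>)
    then show ?thesis by (rule continuous_on_eq) (simp add: Phi_eq)
  qed
  have Phi_pos: "\<Phi>r r > 0" if "r > 1" for r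
    using phipos that e by (simp add: Phi_eq ext_ball_def)
  obtain G T where GT: "W1p_grad p ext_ball \<phi> G" "trace_ext p \<phi> G T"
      "\<And>v Gv Tv. W1p_grad p ext_ball v Gv \<Longrightarrow> trace_ext p v Gv Tv \<Longrightarrow>
          (LINT x|lebesgue_on ext_ball. norm (G x) powr (p - 2) * (G x \<bullet> Gv x))
          + \<beta> * sphere_int (\<lambda>x. \<bar>T x\<bar> powr (p - 2) * T x * Tv x)
          = lambda1 p \<beta> g * (LINT x|lebesgue_on ext_ball. g x * \<bar>\<phi> x\<bar> powr (p - 2) * \<phi> x * v x)"
    using eig unfolding robin_eigen_def by blast
  have g_le: "g x \<le> C\<^sub>0" if x: "norm x > 1" for x
  proof -
    have "norm x powr (- l) \<le> 1"
      using powr_mono[of "- l" 0 "norm x"] x gdecay(1) p by (cases "x = 0") auto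
    then have "C\<^sub>0 * norm x powr (- l) \<le> C\<^sub>0 * 1" using gdecay(2) x by (intro mult_left_mono) auto
    then show ?thesis using gdecay(3) x by (force simp: ext_ball_def)
  qed
  interpret smooth_step S s by (rule step)
  interpret R: decaying_robin S s p \<beta> "lambda1 p \<beta> g" C\<^sub>0 g \<phi> \<Phi>r G T l
  proof unfold_locales
    show "g \<in> borel_measurable (lebesgue_on ext_ball)" using gL by (simp add: Lp_on_def)
    show "0 < g x" if "norm x > 1" for x using gpos that by (simp add: ext_ball_def)
    show "\<phi> x = \<Phi>r (norm x)" if "norm x > 1" for x using phirad that by simp
    show "g x \<le> C\<^sub>0 * norm x powr (- l)" if "norm x > 1" for x using gdecay(3) that by (simp add: ext_ball_def)
  qed (fact p beta gdecay(1) g_le GT Phi_cont Phi_pos)+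
  obtain \<delta> where \<delta>: "\<delta> > 0" "hoelder_on (1/2) {x. 1 < norm x \<and> norm x < 1 + \<delta>} R.V"
    "\<And>x. norm x > 1 \<Longrightarrow> norm x < 1 + \<delta> \<Longrightarrow> R.v 1 / 2 \<le> norm (R.V x) \<and> norm (R.V x) \<le> 2 * R.v 1"
    by (rule R.gradient_near_boundary) (rule that)
  obtain rs where rs: "rs > 1" "R.k rs = 0" "\<And>r. 1 \<le> r \<Longrightarrow> R.k r = 0 \<Longrightarrow> r = rs" "\<And>r. r > rs \<Longrightarrow> R.k r < 0"
    by (rule R.critical_radius) (rule that)
  define \<theta> where "\<theta> = (real DIM('a) - p) / (real DIM('a) * (p - 1))"
  have \<theta>: "\<theta> \<ge> 0" using p by (simp add: \<theta>_def)
  obtain C1 C2 where C: "0 < C1" "C1 < C2"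
    "\<And>x. norm x > 2 * rs \<Longrightarrow> C1 * norm x powr (- (real DIM('a) - 1) / (p - 1)) \<le> norm (R.V x) \<and>
      norm (R.V x) \<le> C2 * ln (norm x) powr \<theta> * norm x powr (- (real DIM('a) - 1) / (p - 1))"
    using R.gradient_at_infinity[OF rs(1,2) _ \<theta>] rs(4) by blast
  \<comment> \<open>m = 1/2 and M = 2 are the bounds v(1)/2 and 2 v(1) on |V|, rewritten by
    \<open>R.v1_eq\<close>. The factor with C = 1 is at least 1, so it only weakens the upper
    bound.\<close>
  have boundary: "1/2 * \<beta> powr (1 / (p - 1)) * \<Phi>r 1 \<le> norm (R.V x) \<and>
      norm (R.V x) \<le> 2 * \<beta> powr (1 / (p - 1)) * \<Phi>r 1 * (1 + 1 * (norm x - 1) powr (1/2))"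
    if x: "x \<in> ext_ball" "norm x - 1 < \<delta>" for x
  proof -
    have b: "R.v 1 / 2 \<le> norm (R.V x)" "norm (R.V x) \<le> 2 * R.v 1"
      using \<delta>(3)[of x] x by (auto simp: ext_ball_def)
    have "2 * R.v 1 * 1 \<le> 2 * R.v 1 * (1 + 1 * (norm x - 1) powr (1/2))"
      using R.v_sign(1)[of 1] R.k1_pos by (intro mult_left_mono) auto
    then have "norm (R.V x) \<le> 2 * R.v 1 * (1 + 1 * (norm x - 1) powr (1/2))" using b(2) by linarith
    then show ?thesis using b(1) by (simp add: R.v1_eq mult.assoc)
  qed
  \<comment> \<open>A critical point of the profile is a zero of \<open>R.v\<close>, hence of the
    flux, which has only one.\<close>
  have unique: "s = rs" if "s > 1" "(\<Phi>r has_real_derivative 0) (at s)" for s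
  proof -
    have "R.v s = 0" using DERIV_unique[OF R.f_deriv[OF that(1)] that(2)] .
    then show ?thesis using R.v_sign(3)[of s] rs(3)[of s] that(1) by simp
  qed
  have "R.v rs = 0" using R.v_sign(3)[of rs] rs by simp
  then have crit: "(\<Phi>r has_real_derivative 0) (at rs)" using R.f_deriv[OF rs(1)] by simp
  have gd: "\<forall>x\<in>ext_ball. GDERIV \<phi> x :> R.V x" using R.V_gderiv by (simp add: ext_ball_def)
  have a: "\<exists>m M C \<delta> \<alpha>. 0 < m \<and> m < M \<and> C > 0 \<and> \<delta> > 0 \<and> 0 < \<alpha> \<and> \<alpha> < 1 \<and>
        hoelder_on \<alpha> {x. 1 < norm x \<and> norm x < 1 + \<delta>} R.V \<and>
        (\<forall>x\<in>ext_ball. norm x - 1 < \<delta> \<longrightarrow>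
           m * \<beta> powr (1 / (p - 1)) * \<Phi>r 1 \<le> norm (R.V x) \<and>
           norm (R.V x) \<le> M * \<beta> powr (1 / (p - 1)) * \<Phi>r 1 * (1 + C * (norm x - 1) powr \<alpha>))"
    by (rule exI[of _ "1/2"], rule exI[of _ 2], rule exI[of _ 1], rule exI[of _ \<delta>], rule exI[of _ "1/2"])
      (use \<delta>(1,2) boundary in auto)
  have C3: "\<forall>x. norm x > 2 * rs \<longrightarrow>
      C1 * norm x powr (- (real DIM('a) - 1) / (p - 1)) \<le> norm (R.V x) \<and>
      norm (R.V x) \<le> C2 * ln (norm x) powr ((real DIM('a) - p) / (real DIM('a) * (p - 1)))
                         * norm x powr (- (real DIM('a) - 1) / (p - 1))"
    using C(3) unfolding \<theta>_def by blast
  have u: "\<forall>s. s > 1 \<and> (\<Phi>r has_real_derivative 0) (at s) \<longrightarrow> s = rs" using unique by blast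
  show ?thesis
    by (rule exI[of _ R.V], rule conjI[OF gd conjI[OF a]], rule exI[of _ rs],
        rule conjI[OF rs(1) conjI[OF crit conjI[OF u]]], rule exI[of _ C1], rule exI[of _ C2],
        rule conjI[OF C(1) conjI[OF C(2) C3]])
qed

end
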